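(* Let $T\setminus S=(t_{ij})$ be a skew orthogonal semistandard tableau for $\mathfrak{so}(2n+1)$ with non-spin columns, with a star $\star$ placed in an interior corner of $S$ lying in row $s$. Let $dble(T\setminus S)=(dt_{ij})$, and suppose that $dble(T\setminus S)$ has two columns of height $s$ (i.e. $T$ has a column of height $s$) and that $dt_{s(j+1)}<dt_{(s+1)j}$ for each $j$ for which these two entries exist. Then: 1. For no $j$ does one have $t_{sj}=0$ and $t_{(s+1)j}=0$. 2. The orthogonal jeu de taquin moves the star only horizontally (along row $s$). 3. Each elementary move, taking the star from box $(s,j)$ to box $(s,j+1)$, is given as follows, where the columns $j$ and $j+1$ before the move are written with the displayed sets: - Move 1: if $t_{s(j+1)}=a$ is unbarred (and nonzero), $$g(B_j\cup\{\star\},O_j,C_j)\,f(A_{j+1}\cup\{a\},O_{j+1},D_{j+1})\mapsto g(B_j\cup\{a\},O_j,C_j)\,f(A_{j+1}\cup\{\star\},O_{j+1},D_{j+1});$$ - Move 2: if $t_{s(j+1)}$ is barred and $\overline c$ is the entry in row $s$ of the left column of the double of column $j+1$, $$f(A_j,O_j,D_j\cup\{\star\})\,g(B_{j+1},O_{j+1},C_{j+1}\cup\{c\})\mapsto f(A_j,O_j,D_j\cup\{c\})\,g(B_{j+1},O_{j+1},C_{j+1}\cup\{\star\});$$ - Move 3: if $t_{s(j+1)}=0$, the star and the $0$ are exchanged: $$f(A_j,O_j\cup\{\star\},D_j)\,g(B_{j+1},O_{j+1}\cup\{0\},C_{j+1})\mapsto f(A_j,O_j\cup\{0\},D_j)\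,g(B_{j+1},O_{j+1}\cup\{\star\},C_{j+1}).$$
   Context: **Columns.** Order the letters $1<2<\dots<n<0<\overline n<\dots<\overline 1$. Write $[1,n]=\{1,\dots,n\}$ and $A\triangle D=(A\cup D)\setminus(A\cap D)$. A (non-spin) column is written $f(A,O,D)$ with $A,D\subset[1,n]$ and $k=\#O\ge 0$: from top to bottom it consists of the elements of $A$ in increasing order, $k$ zeros, and the letters $\overline d$ ($d\in D$) in increasing order. Put $I=A\cap D=\{x_1<\dots<x_r\}$ and $X=[1,n]\setminus(A\triangle D)$. The column is semistandard if (i) there is $J=\{y_1<\dots<y_r\}\subset X\setminus I$ with $y_i>x_i$ for all $i$; the componentwise smallest such $J$ is denoted $\delta(I)$ and we take $J=\delta(I)$; and (ii) $\#(A\cup D\cup J)+k\le n$. Put $B=(A\setminus I)\cup J$, $C=(D\setminus I)\cup J$, and let $K$ be the set of the $k$ largest elements of $[1,n]\setminus(A\cup D\cup J)$. $f(A,O,D)$ is determined by $(B,O,C)$ and is also written $g(B,O,C)$. Its double is the two-column tableau whose left column has entries $A\cup K$ and $\overline C$ and whose right column has entries $B$ and $\overline D\cup\overline K$, each sorted increasingly. **Skew tableaux.** An orthogonal tableau (without spin column) is a sequence of semistandard columns of weakly decreasing heights; $dble(T)$ is the juxtaposition of the doubles of its columns, and $T$ is orthogonal semistandard if the rows of $dble(T)$ are weakly increasing. $T\setminus S$ denotes an orthogonal semistandard tableau $T$ in which a Young diagram $S$ placed in the top left corner is made empty; the sets $A,O,D$ of a column of $T\setminus S$ are formed from its remaining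 entries, the double has the same empty (or starred) boxes in both columns, and the resulting $dble(T\setminus S)$ is required to be skew semistandard (weakly increasing rows). An interior corner of $S$ is a box of $S$ with no box of $S$ immediately to its right or immediately below it. The notation $f(A\cup\{\star\},O,D)$, etc., means that the column contains the remaining entries described by $A,O,D$ (resp. $B,O,C$) and a star in row $s$, placed among the entries of the indicated part. **Symplectic jeu de taquin ($sjdt$).** Symplectic columns are the semistandard columns without zeros ($O=\emptyset$, $k=0$), written $f(A,D)=g(B,C)$, where $I=A\cap D$, $J=\delta(I)$, $B=(A\setminus I)\cup J$ and $C=(D\setminus I)\cup J$; the double of such a column is the two-column tableau whose left column has entries $A$ and $\overline C$ and whose right column has entries $B$ and $\overline D$, each sorted increasingly (here $K=\emptyset$). Let $U$ be a skew tableau of symplectic columns whose double has weakly increasing rows, with a star in the box $(i,j)$ (doubled as well in the double). Let $q$ be the entry in row $i+1$ of the right column of the double of column $j$, and $r$ the entry in row $i$ of the left column of the double of column $j+1$ (if they exist). If $q$ exists and ($r$ does not exist or $q\le r$), exchange $\star$ with the entry below it in $U$. If $r$ exists and ($q$ does not exist or $q>r$), $\star$ moves to $(i,j+1)$ and: if $r=a'$ is unbarred, column $j$, $g(B,C)$, becomes $g(B\cup\{a'\},C)$ and column $j+1$, $f(A',D')$, becomes $f(A'\setminus\{a'\},D')$; if $r=\overline{c'}$, column $j$, $f(A,D)$, becomes $f(A,D\cup\{c'\})$ and column $j+1$, $g(B',C')$, becomes $g(B',C'\setminus\{c'\})$. If neither $q$ nor $r$ exists, the box containing $\star$ is deleted.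 **Orthogonal jeu de taquin ($ojdt$).** Given $T\setminus S$ with a star in an interior corner of $S$, form $dble(T\setminus S)$, which has two adjacent stars; slide first the right star and then the left star by $sjdt$. The result is the double of a skew orthogonal tableau $T'\setminus S'$, and $ojdt(T\setminus S)=T'\setminus S'$. An elementary move of $ojdt$ is the combined effect, on two consecutive columns $j,j+1$ of the orthogonal tableau, of moving both stars from the double of column $j$ to the double of column $j+1$; the slide ends by deleting the starred box when it has no neighbour to the right or below. *)

theory Defs
  imports Main
begin
text \<open>\<open>Unbarred a\<close> is the letter \<open>a\<close>, \<open>Barred d\<close> is the letter \<open>d\<close> with a bar. The order is
  \<open>1 < 2 < ... < n < 0 < n-bar < ... < 1-bar\<close>; the bound \<open>n\<close> is imposed on columns, below.\<close>

datatype letter = Unbarred nat | Zero | Barred nat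

instantiation letter :: linorder
begin

fun less_eq_letter :: "letter \<Rightarrow> letter \<Rightarrow> bool" where
  "less_eq_letter (Unbarred a) (Unbarred b) \<longleftrightarrow> a \<le> b"
| "less_eq_letter (Unbarred a) Zero \<longleftrightarrow> True"
| "less_eq_letter (Unbarred a) (Barred b) \<longleftrightarrow> True"
| "less_eq_letter Zero (Unbarred b) \<longleftrightarrow> False"
| "less_eq_letter Zero Zero \<longleftrightarrow> True"
| "less_eq_letter Zero (Barred b) \<longleftrightarrow> True"
| "less_eq_letter (Barred a) (Unbarred b) \<longleftrightarrow> False"
| "less_eq_letter (Barred a) Zero \<longleftrightarrow> False"
| "less_eq_letter (Barred a) (Barred b) \<longleftrightarrow> b \<le> a"

definition less_letter :: "letter \<Rightarrow> letter \<Rightarrow> bool" where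
  "less_letter x y \<longleftrightarrow> x \<le> y \<and> \<not> y \<le> x"

instance
proof
  fix x y z :: letter
  show "(x < y) = (x \<le> y \<and> \<not> y \<le> x)" by (rule less_letter_def)
  show "x \<le> x" by (cases x) auto
  show "x \<le> y \<Longrightarrow> y \<le> z \<Longrightarrow> x \<le> z" by (cases x; cases y; cases z) auto
  show "x \<le> y \<Longrightarrow> y \<le> x \<Longrightarrow> x = y" by (cases x; cases y) auto
  show "x \<le> y \<or> y \<le> x" by (cases x; cases y) auto
qed

end

text \<open>\<open>Col h st A k D\<close> is a column \<open>f(A,O,D)\<close> with \<open>k = #O\<close> zeros, pushed down by \<open>h\<close> empty boxes
  on top (\<open>h = 0\<close> for a column of a non-skew tableau). If \<open>st = Some i\<close> the column moreover
  contains one star, in row \<open>i\<close>, and the letters fill the other rows \<open>h+1, h+2, ...\<close> in order.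
  Symplectic columns are those with \<open>k = 0\<close>. Rows and columns of tableaux are numbered from 1.\<close>

datatype col = Col (empties: nat) (star: "nat option") (setA: "nat set") (zeros: nat) (setD: "nat set")

datatype box = Empty | Star | Letter letter

definition letters :: "col \<Rightarrow> letter list" where
  "letters c = map Unbarred (sorted_list_of_set (setA c)) @ replicate (zeros c) Zero
     @ map Barred (rev (sorted_list_of_set (setD c)))"

definition column_boxes :: "col \<Rightarrow> box list" where
  "column_boxes c = replicate (empties c) Empty @
     (let ls = map Letter (letters c) in
      case star c of
        None \<Rightarrow> ls
      | Some i \<Rightarrow> take (i - 1 - empties c) ls @ [Star] @ drop (i - 1 - empties c) ls)"

definition height :: "col \<Rightarrow> nat" where
  "height c = length (column_boxes c)"

definition entry :: "col \<Rightarrow> nat \<Rightarrow> letter option" where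
  "entry c i = (if 1 \<le> i \<and> i \<le> height c
     then (case column_boxes c ! (i - 1) of Letter x \<Rightarrow> Some x | _ \<Rightarrow> None) else None)"

text \<open>\<open>delta n A D\<close> is \<open>\<delta>(I)\<close> for \<open>I = A \<inter> D\<close>; it is meaningful only if some admissible \<open>J\<close> exists.\<close>

definition admissible_J :: "nat \<Rightarrow> nat set \<Rightarrow> nat set \<Rightarrow> nat set \<Rightarrow> bool" where
  "admissible_J n A D J \<longleftrightarrow>
     J \<subseteq> ({1..n} - ((A \<union> D) - (A \<inter> D))) - (A \<inter> D) \<and>
     card J = card (A \<inter> D) \<and>
     (\<forall>i < card J. sorted_list_of_set (A \<inter> D) ! i < sorted_list_of_set J ! i)"

definition delta :: "nat \<Rightarrow> nat set \<Rightarrow> nat set \<Rightarrow> nat set" where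
  "delta n A D = (THE J. admissible_J n A D J \<and>
     (\<forall>J'. admissible_J n A D J' \<longrightarrow>
        (\<forall>i < card J. sorted_list_of_set J ! i \<le> sorted_list_of_set J' ! i)))"

definition setI :: "col \<Rightarrow> nat set" where
  "setI c = setA c \<inter> setD c"

definition setJ :: "nat \<Rightarrow> col \<Rightarrow> nat set" where
  "setJ n c = delta n (setA c) (setD c)"

definition semistd :: "nat \<Rightarrow> col \<Rightarrow> bool" where
  "semistd n c \<longleftrightarrow>
     setA c \<subseteq> {1..n} \<and> setD c \<subseteq> {1..n} \<and>
     (\<exists>J. admissible_J n (setA c) (setD c) J) \<and>
     card (setA c \<union> setD c \<union> setJ n c) + zeros c \<le> n"

definition setB :: "nat \<Rightarrow> col \<Rightarrow> nat set" where
  "setB n c = (setA c - setI c) \<union> setJ n c"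

definition setC :: "nat \<Rightarrow> col \<Rightarrow> nat set" where
  "setC n c = (setD c - setI c) \<union> setJ n c"

definition setK :: "nat \<Rightarrow> col \<Rightarrow> nat set" where
  "setK n c = set (take (zeros c)
     (rev (sorted_list_of_set ({1..n} - (setA c \<union> setD c \<union> setJ n c)))))"

text \<open>\<open>is_f n c h st A k D\<close> and \<open>is_g n c h st B k C\<close> say that \<open>c\<close> is the semistandard column
  \<open>f(A,O,D)\<close>, respectively \<open>g(B,O,C)\<close>, with \<open>#O = k\<close> (and empty boxes and star as given).\<close>

definition is_f :: "nat \<Rightarrow> col \<Rightarrow> nat \<Rightarrow> nat option \<Rightarrow> nat set \<Rightarrow> nat \<Rightarrow> nat set \<Rightarrow> bool" where
  "is_f n c h st A k D \<longleftrightarrow> semistd n c \<and> empties c = h \<and> star c = st \<and>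
     setA c = A \<and> zeros c = k \<and> setD c = D"

definition is_g :: "nat \<Rightarrow> col \<Rightarrow> nat \<Rightarrow> nat option \<Rightarrow> nat set \<Rightarrow> nat \<Rightarrow> nat set \<Rightarrow> bool" where
  "is_g n c h st B k C \<longleftrightarrow> semistd n c \<and> empties c = h \<and> star c = st \<and>
     setB n c = B \<and> zeros c = k \<and> setC n c = C"

text \<open>For \<open>k = 0\<close> the set \<open>K\<close> is empty and this is the double of a symplectic column.\<close>

definition dleft :: "nat \<Rightarrow> col \<Rightarrow> col" where
  "dleft n c = Col (empties c) (star c) (setA c \<union> setK n c) 0 (setC n c)"

definition dright :: "nat \<Rightarrow> col \<Rightarrow> col" where
  "dright n c = Col (empties c) (star c) (setB n c) 0 (setD c \<union> setK n c)"

type_synonym tableau = "col list"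

abbreviation tcol :: "tableau \<Rightarrow> nat \<Rightarrow> col" where
  "tcol U j \<equiv> U ! (j - 1)"

definition tentry :: "tableau \<Rightarrow> nat \<Rightarrow> nat \<Rightarrow> letter option" where
  "tentry U i j = (if 1 \<le> j \<and> j \<le> length U then entry (tcol U j) i else None)"

definition tboxes :: "tableau \<Rightarrow> (nat \<times> nat) set" where
  "tboxes T = {(i, j). 1 \<le> j \<and> j \<le> length T \<and> 1 \<le> i \<and> i \<le> height (tcol T j)}"

text \<open>Column \<open>j\<close> of a tableau is doubled into the columns \<open>2j - 1\<close> and \<open>2j\<close>.\<close>

definition dble :: "nat \<Rightarrow> tableau \<Rightarrow> tableau" where
  "dble n T = concat (map (\<lambda>c. [dleft n c, dright n c]) T)"

definition rows_weakly_increasing :: "tableau \<Rightarrow> bool" where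
  "rows_weakly_increasing U \<longleftrightarrow>
     (\<forall>i j j' x y. j \<le> j' \<longrightarrow> tentry U i j = Some x \<longrightarrow> tentry U i j' = Some y \<longrightarrow> x \<le> y)"

definition orthogonal_tableau :: "nat \<Rightarrow> tableau \<Rightarrow> bool" where
  "orthogonal_tableau n T \<longleftrightarrow>
     (\<forall>c \<in> set T. semistd n c \<and> empties c = 0 \<and> star c = None) \<and>
     sorted_wrt (\<ge>) (map height T)"

definition orthogonal_semistandard :: "nat \<Rightarrow> tableau \<Rightarrow> bool" where
  "orthogonal_semistandard n T \<longleftrightarrow>
     orthogonal_tableau n T \<and> rows_weakly_increasing (dble n T)"

definition young_diagram :: "(nat \<times> nat) set \<Rightarrow> bool" where
  "young_diagram S \<longleftrightarrow> finite S \<and>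
     (\<forall>(i, j) \<in> S. 1 \<le> i \<and> 1 \<le> j \<and> (\<forall>i' \<in> {1..i}. \<forall>j' \<in> {1..j}. (i', j') \<in> S))"

definition interior_corner :: "(nat \<times> nat) set \<Rightarrow> nat \<times> nat \<Rightarrow> bool" where
  "interior_corner S = (\<lambda>(i, j). (i, j) \<in> S \<and> (i, j + 1) \<notin> S \<and> (i + 1, j) \<notin> S)"

text \<open>\<open>erase h c\<close> makes the \<open>h\<close> topmost boxes of \<open>c\<close> empty; \<open>skew T S\<close> is the tableau
  \<open>T \<setminus> S\<close>.\<close>

definition erase :: "nat \<Rightarrow> col \<Rightarrow> col" where
  "erase h c = (let ls = drop h (letters c) in
     Col h None {a. Unbarred a \<in> set ls} (count_list ls Zero) {d. Barred d \<in> set ls})"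

definition skew :: "tableau \<Rightarrow> (nat \<times> nat) set \<Rightarrow> tableau" where
  "skew T S = map (\<lambda>j. erase (card {i. (i, j) \<in> S}) (tcol T j)) [1..<Suc (length T)]"

definition skew_orthogonal_semistandard :: "nat \<Rightarrow> tableau \<Rightarrow> (nat \<times> nat) set \<Rightarrow> bool" where
  "skew_orthogonal_semistandard n T S \<longleftrightarrow>
     orthogonal_semistandard n T \<and> young_diagram S \<and> S \<subseteq> tboxes T \<and>
     rows_weakly_increasing (dble n (skew T S))"

text \<open>\<open>T \<setminus> S\<close> with a star in the interior corner \<open>(s, j)\<close> of \<open>S\<close>: the last of the \<open>s\<close> empty boxes
  of column \<open>j\<close> becomes the star.\<close>

definition starred_skew :: "tableau \<Rightarrow> (nat \<times> nat) set \<Rightarrow> nat \<Rightarrow> nat \<Rightarrow> tableau" where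
  "starred_skew T S s j = (let W = skew T S; c = tcol W j in
     W[j - 1 := Col (s - 1) (Some s) (setA c) (zeros c) (setD c)])"

text \<open>A state \<open>(U, i, j)\<close> is a tableau \<open>U\<close> of symplectic columns whose active star is in the box
  \<open>(i, j)\<close>. Stars in other columns are inert, that is, they behave like empty boxes.\<close>

type_synonym state = "tableau \<times> nat \<times> nat"

definition below :: "nat \<Rightarrow> state \<Rightarrow> letter option" where
  "below n = (\<lambda>(U, i, j). tentry (dble n U) (i + 1) (2 * j))"

definition beside :: "nat \<Rightarrow> state \<Rightarrow> letter option" where
  "beside n = (\<lambda>(U, i, j). tentry (dble n U) i (2 * (j + 1) - 1))"

inductive sjdt_step :: "nat \<Rightarrow> state \<Rightarrow> state \<Rightarrow> bool" for n :: nat where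
  down:
    "\<lbrakk> below n (U, i, j) = Some q;
       \<forall>r. beside n (U, i, j) = Some r \<longrightarrow> q \<le> r;
       tcol U j = Col h (Some i) A 0 D \<rbrakk>
     \<Longrightarrow> sjdt_step n (U, i, j) (U[j - 1 := Col h (Some (i + 1)) A 0 D], i + 1, j)"
| right_unbarred:
    "\<lbrakk> beside n (U, i, j) = Some (Unbarred a);
       \<forall>q. below n (U, i, j) = Some q \<longrightarrow> q > Unbarred a;
       is_g n (tcol U j) h (Some i) B 0 C;
       is_f n (tcol U (j + 1)) h' None A' 0 D';
       is_g n c1 h None (B \<union> {a}) 0 C;
       is_f n c2 h' (Some i) (A' - {a}) 0 D' \<rbrakk>
     \<Longrightarrow> sjdt_step n (U, i, j) (U[j - 1 := c1, j := c2], i, j + 1)"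
| right_barred:
    "\<lbrakk> beside n (U, i, j) = Some (Barred c);
       \<forall>q. below n (U, i, j) = Some q \<longrightarrow> q > Barred c;
       is_f n (tcol U j) h (Some i) A 0 D;
       is_g n (tcol U (j + 1)) h' None B' 0 C';
       is_f n c1 h None A 0 (D \<union> {c});
       is_g n c2 h' (Some i) B' 0 (C' - {c}) \<rbrakk>
     \<Longrightarrow> sjdt_step n (U, i, j) (U[j - 1 := c1, j := c2], i, j + 1)"

text \<open>\<open>sjdt n st sts V\<close>: the complete slide starting in the state \<open>st\<close> runs through the list of
  states \<open>sts\<close> (beginning with \<open>st\<close>) and, the starred box being deleted at the end, yields \<open>V\<close>.\<close>

inductive sjdt :: "nat \<Rightarrow> state \<Rightarrow> state list \<Rightarrow> tableau \<Rightarrow> bool" for n :: nat where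
  delete:
    "\<lbrakk> below n (U, i, j) = None; beside n (U, i, j) = None;
       tcol U j = Col h (Some i) A 0 D \<rbrakk>
     \<Longrightarrow> sjdt n (U, i, j) [(U, i, j)] (U[j - 1 := Col h None A 0 D])"
| move:
    "\<lbrakk> sjdt_step n st st'; sjdt n st' sts V \<rbrakk> \<Longrightarrow> sjdt n st (st # sts) V"

text \<open>\<open>ojdt n W s j Rs Ls T'\<close>: \<open>W\<close> is a skew orthogonal tableau with a star in the box \<open>(s, j)\<close>, its
  double has stars in the boxes \<open>(s, 2j)\<close> and \<open>(s, 2j - 1)\<close>. The complete slide of the right star
  runs through the states \<open>Rs\<close>, the subsequent slide of the left star through \<open>Ls\<close>, and the
  outcome is the double of the tableau \<open>T'\<close> of semistandard columns.\<close>

definition ojdt ::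
  "nat \<Rightarrow> tableau \<Rightarrow> nat \<Rightarrow> nat \<Rightarrow> state list \<Rightarrow> state list \<Rightarrow> tableau \<Rightarrow> bool" where
  "ojdt n W s j Rs Ls T' \<longleftrightarrow>
     (\<exists>V. sjdt n (dble n W, s, 2 * j) Rs V \<and> sjdt n (V, s, 2 * j - 1) Ls (dble n T')) \<and>
     (\<forall>c \<in> set T'. semistd n c)"

text \<open>The combined effect, on the columns \<open>j\<close> and \<open>j + 1\<close>, of moving both stars in row \<open>i\<close> from the
  double of column \<open>j\<close> to the double of column \<open>j + 1\<close>: these columns are \<open>X\<close>, \<open>Y\<close> before and \<open>X'\<close>,
  \<open>Y'\<close> after the move. Since the right star finishes its slide before the left one starts, the
  doubles are read off at different times. Before the move, the right star is in \<open>(i, 2j)\<close> in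
  \<open>U0\<close> and the left one in \<open>(i, 2j - 1)\<close> in \<open>V0\<close>; after it, the right star is in \<open>(i, 2j + 2)\<close> in
  \<open>U1\<close> and the left one in \<open>(i, 2j + 1)\<close> in \<open>V1\<close>.\<close>

definition elementary_move ::
  "nat \<Rightarrow> state list \<Rightarrow> state list \<Rightarrow> nat \<Rightarrow> nat \<Rightarrow> col \<Rightarrow> col \<Rightarrow> col \<Rightarrow> col \<Rightarrow> bool" where
  "elementary_move n Rs Ls i j X Y X' Y' \<longleftrightarrow>
     1 \<le> j \<and> semistd n X \<and> semistd n Y \<and> semistd n X' \<and> semistd n Y' \<and>
     (\<exists>U0 U1 V0 V1.
        (U0, i, 2 * j) \<in> set Rs \<and> (U1, i, 2 * j + 2) \<in> set Rs \<and>
        (V0, i, 2 * j - 1) \<in> set Ls \<and> (V1, i, 2 * j + 1) \<in> set Ls \<and>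
        dleft n X = tcol V0 (2 * j - 1) \<and> dright n X = tcol U0 (2 * j) \<and>
        dleft n Y = tcol U0 (2 * j + 1) \<and> dright n Y = tcol U0 (2 * j + 2) \<and>
        dleft n X' = tcol V1 (2 * j - 1) \<and> dright n X' = tcol V1 (2 * j) \<and>
        dleft n Y' = tcol V1 (2 * j + 1) \<and> dright n Y' = tcol U1 (2 * j + 2))"

text \<open>The star lies among the entries of the first part (\<open>A\<close> or \<open>B\<close>, which have the same number of
  elements), the zeros, or the last part (\<open>D\<close> or \<open>C\<close>). A part with \<open>m\<close> entries and the star
  occupies \<open>m + 1\<close> consecutive rows.\<close>

definition star_among_unbarred :: "col \<Rightarrow> bool" where
  "star_among_unbarred c \<longleftrightarrow> (\<exists>i. star c = Some i \<and> (let m = empties c in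
     m < i \<and> i \<le> m + card (setA c) + 1))"

definition star_among_zeros :: "col \<Rightarrow> bool" where
  "star_among_zeros c \<longleftrightarrow> (\<exists>i. star c = Some i \<and> (let m = empties c + card (setA c) in
     m < i \<and> i \<le> m + zeros c + 1))"

definition star_among_barred :: "col \<Rightarrow> bool" where
  "star_among_barred c \<longleftrightarrow> (\<exists>i. star c = Some i \<and> (let m = empties c + card (setA c) + zeros c in
     m < i \<and> i \<le> m + card (setD c) + 1))"

text \<open>\<open>X\<close>, \<open>Y\<close> are the columns \<open>j\<close>, \<open>j + 1\<close> before the move, \<open>X'\<close>, \<open>Y'\<close> after it. The unions in the
  displayed sets are disjoint, as they describe the boxes of a column.\<close>

definition move1 :: "nat \<Rightarrow> nat \<Rightarrow> nat \<Rightarrow> col \<Rightarrow> col \<Rightarrow> col \<Rightarrow> col \<Rightarrow> bool" where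
  "move1 n s a X Y X' Y' \<longleftrightarrow> (\<exists>h B k C h' A' k' D'. a \<notin> B \<and> a \<notin> A' \<and>
     is_g n X h (Some s) B k C \<and> star_among_unbarred X \<and>
     is_f n Y h' None (A' \<union> {a}) k' D' \<and>
     is_g n X' h None (B \<union> {a}) k C \<and>
     is_f n Y' h' (Some s) A' k' D' \<and> star_among_unbarred Y')"

definition move2 :: "nat \<Rightarrow> nat \<Rightarrow> nat \<Rightarrow> col \<Rightarrow> col \<Rightarrow> col \<Rightarrow> col \<Rightarrow> bool" where
  "move2 n s c X Y X' Y' \<longleftrightarrow> (\<exists>h A k D h' B' k' C'. c \<notin> D \<and> c \<notin> C' \<and>
     is_f n X h (Some s) A k D \<and> star_among_barred X \<and>
     is_g n Y h' None B' k' (C' \<union> {c}) \<and>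
     is_f n X' h None A k (D \<union> {c}) \<and>
     is_g n Y' h' (Some s) B' k' C' \<and> star_among_barred Y')"

definition move3 :: "nat \<Rightarrow> nat \<Rightarrow> col \<Rightarrow> col \<Rightarrow> col \<Rightarrow> col \<Rightarrow> bool" where
  "move3 n s X Y X' Y' \<longleftrightarrow> (\<exists>h A k D h' B' k' C'.
     is_f n X h (Some s) A k D \<and> star_among_zeros X \<and>
     is_g n Y h' None B' (k' + 1) C' \<and>
     is_f n X' h None A (k + 1) D \<and>
     is_g n Y' h' (Some s) B' k' C' \<and> star_among_zeros Y')"

end

theory Submission
  imports Defs
begin

text \<open>
  For a column with double \<open>L | R\<close>, where \<open>L = (A \<union> K, C)\<close> and \<open>R = (B, D \<union> K)\<close>, the unbarred
  and the barred letters of each half are disjoint, so each half is a symplectic column which is its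
  own double. While the star is in row \<open>s\<close>, the strict inequalities of the hypothesis force every
  slide to go to the right. Let \<open>r\<close> be the letter in row \<open>s\<close> of \<open>L\<close> of the next column and \<open>\<rho>\<close> the one
  of its \<open>R\<close>. No letter of \<open>L\<close> lies in between, and this pins \<open>r\<close> down: it is the letter
  \<open>a\<close> of the tableau in Move 1, the barred letter \<open>c\<close> in Move 2, and \<open>n\<close> in Move 3. Every column
  met on the way has the form \<open>f(P \<union> {u}, Q \<union> {u}) = g(P \<union> {v}, Q \<union> {v})\<close> with \<open>P\<close>, \<open>Q\<close> disjoint and
  all letters between \<open>u < v\<close> in \<open>P \<union> Q\<close>, or has disjoint parts. Hence the second star undoes
  the defects left by the first one, and what remains is to recognise the doubles of the claimed
  columns, which the greedy description of \<open>\<delta>(I)\<close> reduces to counting letters below a bound.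
  Since \<open>g(B,O,C)\<close> determines its column, \<open>sjdt\<close> is deterministic and the slide found is the only one.
\<close>

section \<open>Counting letters\<close>

text \<open>Two obstacles shape the argument. The right star finishes its slide before the left one
  starts, so the columns entered by the left star have already been altered and need not be halves
  of any orthogonal column; they are carried along as explicit sets. Moreover \<open>K\<close>
  depends on \<open>A\<close>, \<open>D\<close> and \<open>J\<close> together, so a change of one
  letter can displace a letter of \<open>K\<close>; but a double shows only
  \<open>A \<union> K\<close> and \<open>D \<union> K\<close>, and these change in a controlled way.
  A column of height \<open>s\<close> is what ends the slides: it forces the last column reaching
  row \<open>s\<close> to have height exactly \<open>s\<close>, so nothing stands below the star
  there. The box of the star provides a spare letter: the letters of a starred column number fewer
  than \<open>n\<close>, so some letter is in neither part of its right half. In the starting column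
  row \<open>s\<close> holds no letter that could be compared with the next column; the missing
  bound is taken from the rows of \<open>dble n T\<close>, before anything is erased.\<close>

definition cnt :: "nat set \<Rightarrow> nat \<Rightarrow> nat" where
  "cnt S t = card (S \<inter> {..t})"

lemma cnt_insert:
  "cnt (insert x S) t = cnt S t + (if x \<in> S then 0 else if x \<le> t then 1 else 0)"
  by (auto simp: cnt_def insert_absorb)

lemma cnt_remove:
  "cnt (S - {x}) t = cnt S t - (if x \<in> S \<and> x \<le> t then 1 else 0)"
proof -
  have "(S - {x}) \<inter> {..t} = S \<inter> {..t} - {x}" by auto
  then show ?thesis by (simp add: cnt_def card_Diff_singleton_if)
qed

lemma cnt_pos: "x \<in> S \<Longrightarrow> x \<le> t \<Longrightarrow> 0 < cnt S t"
  by (auto simp: cnt_def card_gt_0_iff)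

lemma cnt_mono: "S \<subseteq> S' \<Longrightarrow> t \<le> t' \<Longrightarrow> cnt S t \<le> cnt S' t'"
  unfolding cnt_def by (rule card_mono) auto

lemma cnt_Un: "P \<inter> Q = {} \<Longrightarrow> cnt (P \<union> Q) t = cnt P t + cnt Q t"
  by (simp add: cnt_def Int_Un_distrib2 card_Un_disjoint inf_assoc disjoint_iff)

lemma cnt_zero_iff: "cnt S t = 0 \<longleftrightarrow> S \<inter> {..t} = {}"
  by (auto simp: cnt_def)

lemma cnt_full: "S \<subseteq> {..t} \<Longrightarrow> cnt S t = card S"
  by (simp add: cnt_def inf.absorb1)

lemma cnt_upper:
  assumes "finite S"
  shows "cnt S t + card (S \<inter> {t<..}) = card S"
proof -
  have "(S \<inter> {..t}) \<union> (S \<inter> {t<..}) = S" "(S \<inter> {..t}) \<inter> (S \<inter> {t<..}) = {}" by auto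
  then show ?thesis
    unfolding cnt_def using assms card_Un_disjoint[of "S \<inter> {..t}" "S \<inter> {t<..}"] by simp
qed

lemma cnt_le_card: "finite S \<Longrightarrow> cnt S t \<le> card S"
  using cnt_upper by (metis le_add1)

lemma cnt_gap: "t \<le> u \<Longrightarrow> cnt S t = cnt S u \<longleftrightarrow> S \<inter> {t<..u} = {}"
proof -
  assume tu: "t \<le> u"
  have e: "S \<inter> {..u} = (S \<inter> {..t}) \<union> (S \<inter> {t<..u})" using tu by auto
  have "card (S \<inter> {..u}) = card (S \<inter> {..t}) + card (S \<inter> {t<..u})"
    unfolding e by (rule card_Un_disjoint) auto
  then show ?thesis by (auto simp: cnt_def)
qed

lemma sorted_wrt_nth_card:
  assumes "sorted_wrt R xs" "\<And>x. \<not> R x x" "\<And>x y. R x y \<Longrightarrow> \<not> R y x" "q < length xs"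
  shows "card {y \<in> set xs. R y (xs ! q)} = q"
proof -
  have inj: "inj_on ((!) xs) {..<length xs}"
    using assms by (intro inj_onI) (metis lessThan_iff linorder_neqE_nat sorted_wrt_nth_less)
  have "{y \<in> set xs. R y (xs ! q)} = (!) xs ` {..<q}"
  proof
    show "{y \<in> set xs. R y (xs ! q)} \<subseteq> (!) xs ` {..<q}"
      using assms by (auto simp: in_set_conv_nth)
        (metis imageI lessThan_iff linorder_neqE_nat sorted_wrt_nth_less)
    show "(!) xs ` {..<q} \<subseteq> {y \<in> set xs. R y (xs ! q)}"
      using assms by (auto simp: sorted_wrt_nth_less)
  qed
  then show ?thesis
    using inj assms(4) by (simp add: card_image inj_on_subset)
qed

text \<open>The bridge between positions in a sorted list and counts. It turns componentwise
  comparisons of sets into inequalities between counting functions.\<close>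

lemma nth_sorted_list_le_iff:
  assumes "finite P" "i < card P"
  shows "sorted_list_of_set P ! i \<le> t \<longleftrightarrow> i < cnt P t"
proof -
  let ?xs = "sorted_list_of_set P"
  have len: "i < length ?xs" using assms by simp
  have c: "card {y \<in> P. y < ?xs ! i} = i"
    using sorted_wrt_nth_card[OF strict_sorted_list_of_set _ _ len] assms(1) by simp
  have mem: "?xs ! i \<in> P" using nth_mem[OF len] assms(1) by simp
  show ?thesis
  proof
    assume le: "?xs ! i \<le> t"
    have "card (insert (?xs ! i) {y \<in> P. y < ?xs ! i}) = Suc i"
      using c assms(1) by simp
    moreover have "insert (?xs ! i) {y \<in> P. y < ?xs ! i} \<subseteq> P \<inter> {..t}"
      using le mem by auto
    ultimately have "Suc i \<le> card (P \<inter> {..t})"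
      using card_mono[of "P \<inter> {..t}" "insert (?xs ! i) {y \<in> P. y < ?xs ! i}"] by simp
    then show "i < cnt P t" unfolding cnt_def by simp
  next
    assume "i < cnt P t"
    show "?xs ! i \<le> t"
    proof (rule ccontr)
      assume "\<not> ?xs ! i \<le> t"
      then have "P \<inter> {..t} \<subseteq> {y \<in> P. y < ?xs ! i}" by auto
      then have "card (P \<inter> {..t}) \<le> card {y \<in> P. y < ?xs ! i}"
        using assms(1) by (intro card_mono) auto
      then have "cnt P t \<le> i" unfolding cnt_def using c by simp
      then show False using \<open>i < cnt P t\<close> by simp
    qed
  qed
qed

text \<open>Larger elements are counted later, so the componentwise order is the reverse of the
  pointwise order of counting functions.\<close>

lemma sorted_list_le_iff_cnt:
  assumes "finite P" "finite Q" "card P = card Q"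
  shows "(\<forall>i < card Q. sorted_list_of_set P ! i \<le> sorted_list_of_set Q ! i)
    \<longleftrightarrow> (\<forall>t. cnt Q t \<le> cnt P t)"
proof
  assume l: "\<forall>i < card Q. sorted_list_of_set P ! i \<le> sorted_list_of_set Q ! i"
  show "\<forall>t. cnt Q t \<le> cnt P t"
  proof (rule allI, rule ccontr)
    fix t assume "\<not> cnt Q t \<le> cnt P t"
    then have a: "cnt P t < cnt Q t" by simp
    \<comment> \<open>The position \<open>cnt P t\<close> refutes the comparison: the element of
      \<open>Q\<close> there is at most \<open>t\<close>, that of \<open>P\<close> is not.\<close>
    then have b: "cnt P t < card Q" using cnt_le_card[OF assms(2), of t] by simp
    show False
      using l[rule_format, OF b] nth_sorted_list_le_iff[OF assms(2) b, of t]
        nth_sorted_list_le_iff[OF assms(1), of "cnt P t" t] a b assms(3) by auto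
  qed
next
  assume r: "\<forall>t. cnt Q t \<le> cnt P t"
  show "\<forall>i < card Q. sorted_list_of_set P ! i \<le> sorted_list_of_set Q ! i"
  proof (intro allI impI)
    fix i assume i: "i < card Q"
    have "i < cnt Q (sorted_list_of_set Q ! i)"
      using nth_sorted_list_le_iff[OF assms(2) i, of "sorted_list_of_set Q ! i"] by blast
    also have "\<dots> \<le> cnt P (sorted_list_of_set Q ! i)" using r by simp
    finally show "sorted_list_of_set P ! i \<le> sorted_list_of_set Q ! i"
      using nth_sorted_list_le_iff[OF assms(1)] i assms(3) by simp
  qed
qed

text \<open>\<open>delta\<close> in counting form: the smallest admissible \<open>J\<close> is found greedily, so no element of
  \<open>A \<inter> D\<close> may still wait for its partner when an available letter is left unused.\<close>

definition matched :: "nat \<Rightarrow> nat set \<Rightarrow> nat set \<Rightarrow> nat set \<Rightarrow> bool" where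
  "matched n A D J \<longleftrightarrow> A \<subseteq> {1..n} \<and> D \<subseteq> {1..n} \<and> J \<subseteq> {1..n} - (A \<union> D) \<and>
     card J = card (A \<inter> D) \<and> (\<forall>t. cnt J t \<le> cnt (A \<inter> D) t) \<and>
     (\<forall>t \<in> {1..n} - (A \<union> D \<union> J). cnt (A \<inter> D) t \<le> cnt J t)"

text \<open>The size of \<open>K\<close> is left open, so that the number of zeros can be carried as
  \<open>card K\<close> without a variable of its own.\<close>

definition topmost :: "nat \<Rightarrow> nat set \<Rightarrow> nat set \<Rightarrow> bool" where
  "topmost n F K \<longleftrightarrow> K \<subseteq> {1..n} - F \<and> (\<forall>q \<in> {1..n} - F - K. \<forall>z \<in> K. q < z)"

definition doubled :: "nat \<Rightarrow> nat set \<Rightarrow> nat set \<Rightarrow> nat set \<Rightarrow> nat set \<Rightarrow> bool" where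
  "doubled n A D J K \<longleftrightarrow> matched n A D J \<and> topmost n (A \<union> D \<union> J) K"

text \<open>The strict inequalities of \<open>admissible_J\<close> follow from weak ones, since
  \<open>J\<close> avoids \<open>A \<inter> D\<close>. What remains is that no initial segment of
  the letters contains more of \<open>J\<close> than of \<open>A \<inter> D\<close>.\<close>

lemma admissible_J_iff_cnt:
  assumes "A \<subseteq> {1..n}" "D \<subseteq> {1..n}"
  shows "admissible_J n A D J \<longleftrightarrow>
    J \<subseteq> {1..n} - (A \<union> D) \<and> card J = card (A \<inter> D) \<and> (\<forall>t. cnt J t \<le> cnt (A \<inter> D) t)"
proof -
  have s: "{1..n} - (A \<union> D - A \<inter> D) - A \<inter> D = {1..n} - (A \<union> D)" by auto
  { assume J: "J \<subseteq> {1..n} - (A \<union> D)" "card J = card (A \<inter> D)"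
    have fJ: "finite J" and fI: "finite (A \<inter> D)"
      using J(1) assms(1) by (meson finite_Diff finite_Int finite_atLeastAtMost finite_subset)+
    have "(\<forall>i<card J. sorted_list_of_set (A \<inter> D) ! i < sorted_list_of_set J ! i) \<longleftrightarrow>
      (\<forall>i<card J. sorted_list_of_set (A \<inter> D) ! i \<le> sorted_list_of_set J ! i)"
    proof (intro iffI allI impI)
      fix i assume h: "\<forall>i<card J. sorted_list_of_set (A \<inter> D) ! i \<le> sorted_list_of_set J ! i"
        and i: "i < card J"
      have "sorted_list_of_set J ! i \<in> J" "sorted_list_of_set (A \<inter> D) ! i \<in> A \<inter> D"
        using i fJ fI J(2) nth_mem by (metis set_sorted_list_of_set length_sorted_list_of_set)+
      then have "sorted_list_of_set (A \<inter> D) ! i \<noteq> sorted_list_of_set J ! i"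
        using J(1) by auto
      then show "sorted_list_of_set (A \<inter> D) ! i < sorted_list_of_set J ! i"
        using h i by (simp add: le_neq_implies_less)
    qed auto
    also have "\<dots> \<longleftrightarrow> (\<forall>t. cnt J t \<le> cnt (A \<inter> D) t)"
      using sorted_list_le_iff_cnt[OF fI fJ] J(2) by simp
    finally have "(\<forall>i<card J. sorted_list_of_set (A \<inter> D) ! i < sorted_list_of_set J ! i) \<longleftrightarrow>
      (\<forall>t. cnt J t \<le> cnt (A \<inter> D) t)" . }
  then show ?thesis
    unfolding admissible_J_def s by blast
qed

text \<open>By induction on \<open>t\<close>, the only way for \<open>J\<close> to gain on
  \<open>G\<close> is a letter \<open>t\<close> of \<open>J\<close> that \<open>G\<close> passes
  over. But \<open>G\<close> passes over an available letter only when no element of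
  \<open>A \<inter> D\<close> is waiting, and \<open>J\<close> cannot be further ahead than
  that.\<close>

lemma matched_least:
  assumes "matched n A D G" "admissible_J n A D J"
  shows "cnt J t \<le> cnt G t"
proof (induction t rule: less_induct)
  case (less t)
  note G = assms(1)[unfolded matched_def]
  have J: "J \<subseteq> {1..n} - (A \<union> D)" "\<And>t. cnt J t \<le> cnt (A \<inter> D) t"
    using assms(2) admissible_J_iff_cnt G by auto
  show ?case
  proof (cases "t \<in> J \<and> t \<notin> G")
    case True
    then have "cnt (A \<inter> D) t \<le> cnt G t" using G J(1) by auto
    then show ?thesis using J(2) order_trans by blast
  next
    case False
    show ?thesis
    proof (cases t)
      case 0
      then have "0 \<notin> J" using J(1) by auto
      then have "cnt J t = 0" using 0 by (auto simp: cnt_zero_iff)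
      then show ?thesis by simp
    next
      case (Suc u)
      have st: "cnt S t = cnt S u + (if t \<in> S then 1 else 0)" for S
      proof -
        have "S \<inter> {..t} = (if t \<in> S then insert t (S \<inter> {..u}) else S \<inter> {..u})"
          using Suc by (auto simp: le_Suc_eq)
        then show ?thesis using Suc by (simp add: cnt_def)
      qed
      show ?thesis using less.IH[of u] Suc False st[of J] st[of G] by auto
    qed
  qed
qed

lemma matched_exists:
  assumes A: "A \<subseteq> {1..n}" "D \<subseteq> {1..n}" and ex: "admissible_J n A D J0"
  shows "\<exists>J. matched n A D J"
proof -
  define J where "J = (ARG_MIN (\<lambda>J. \<Sum>J) J. admissible_J n A D J)"
  have adm: "admissible_J n A D J"
    and least: "\<And>J'. admissible_J n A D J' \<Longrightarrow> \<Sum>J \<le> \<Sum>J'"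
    unfolding J_def using arg_min_natI[of "admissible_J n A D", OF ex]
      arg_min_nat_le[of "admissible_J n A D"] by blast+
  have J: "J \<subseteq> {1..n} - (A \<union> D)" "card J = card (A \<inter> D)" "\<And>t. cnt J t \<le> cnt (A \<inter> D) t"
    using adm admissible_J_iff_cnt[OF A] by auto
  have fJ: "finite J" using J(1) finite_subset by blast
  have fI: "finite (A \<inter> D)" using A finite_subset by blast
  have "cnt (A \<inter> D) t \<le> cnt J t" if t: "t \<in> {1..n} - (A \<union> D \<union> J)" for t
  proof (rule ccontr)
    assume "\<not> cnt (A \<inter> D) t \<le> cnt J t"
    then have less: "cnt J t < cnt (A \<inter> D) t" by simp
    have "card (J \<inter> {t<..}) > 0"
      using cnt_upper[OF fJ, of t] cnt_le_card[OF fI, of t] less J(2) by linarith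
    then have ne: "J \<inter> {t<..} \<noteq> {}" "finite (J \<inter> {t<..})" by (auto simp: card_gt_0_iff)
    \<comment> \<open>With the least element above \<open>t\<close>, the counts of \<open>J\<close>
      are constant from \<open>t\<close> to just below \<open>y\<close>, which is the range where
      the exchange raises them by one.\<close>
    define y where "y = Min (J \<inter> {t<..})"
    have y: "y \<in> J" "t < y" using Min_in[OF ne(2,1)] unfolding y_def by auto
    have ymin: "J \<inter> {t<..u} = {}" if "u < y" for u
      using that Min_le[OF ne(2)] unfolding y_def by fastforce
    define J' where "J' = insert t (J - {y})"
    have "card J' = card J" unfolding J'_def using t y fJ card_Suc_Diff1[OF fJ y(1)] by simp
    moreover have "cnt J' u \<le> cnt (A \<inter> D) u" for u
    proof (cases "t \<le> u \<and> u < y")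
      case True
      then have "cnt J u = cnt J t" using ymin cnt_gap by metis
      moreover have "cnt (A \<inter> D) t \<le> cnt (A \<inter> D) u" using True by (intro cnt_mono) auto
      ultimately show ?thesis using True less t by (simp add: J'_def cnt_insert cnt_remove)
    next
      case False
      then show ?thesis using J(3)[of u] cnt_pos[of y J u] y t
        by (auto simp: J'_def cnt_insert cnt_remove)
    qed
    moreover have "J' \<subseteq> {1..n} - (A \<union> D)" using J(1) t unfolding J'_def by auto
    ultimately have "admissible_J n A D J'" using admissible_J_iff_cnt[OF A] J(2) by auto
    then have "\<Sum>J \<le> \<Sum>J'" by (rule least)
    moreover have "\<Sum>J' + y = \<Sum>J + t"
      using t y fJ unfolding J'_def by (simp add: sum.remove)
    ultimately show False using y(2) by linarith
  qed
  then have "matched n A D J" unfolding matched_def using J A by blast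
  then show ?thesis ..
qed

lemma cnt_eq_imp_eq:
  assumes "\<And>t. cnt P t = cnt Q t"
  shows "P = Q"
proof -
  have sub: "x \<in> Q" if "x \<in> P" "\<And>t. cnt P t = cnt Q t" for x and P Q :: "nat set"
  proof (rule ccontr)
    assume x: "x \<notin> Q"
    show False
    proof (cases x)
      case 0
      then have "cnt Q x = 0" using x by (simp add: cnt_zero_iff)
      then show ?thesis using that(2)[of x] cnt_pos[OF that(1), of x] by simp
    next
      case (Suc u)
      have "Q \<inter> {u<..x} = {}" using x Suc by (auto simp: le_Suc_eq)
      then have "cnt Q u = cnt Q x" using cnt_gap[of u x Q] Suc by simp
      then have "cnt P u = cnt P x" using that(2) by simp
      then have "P \<inter> {u<..x} = {}" using cnt_gap[of u x P] Suc by simp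
      then show ?thesis using that(1) Suc by auto
    qed
  qed
  show ?thesis
    using sub[OF _ assms] sub[OF _ assms[symmetric]] by (intro equalityI subsetI)
qed

text \<open>\<open>delta\<close> is a definite description; two least admissible sets bound each
  other's counts, and equal counts mean equal sets.\<close>

lemma delta_eq:
  assumes m: "matched n A D J"
  shows "admissible_J n A D J" "delta n A D = J"
proof -
  have AD: "A \<subseteq> {1..n}" "D \<subseteq> {1..n}" using m unfolding matched_def by auto
  show adm: "admissible_J n A D J"
    using m admissible_J_iff_cnt[OF AD] unfolding matched_def by auto
  have fin: "finite J'" if "admissible_J n A D J'" for J'
    using that admissible_J_iff_cnt[OF AD] by (meson finite_Diff finite_atLeastAtMost finite_subset)
  have crd: "card J' = card (A \<inter> D)" if "admissible_J n A D J'" for J'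
    using that unfolding admissible_J_def by blast
  have le: "(\<forall>i<card J1. sorted_list_of_set J1 ! i \<le> sorted_list_of_set J2 ! i)
     \<longleftrightarrow> (\<forall>t. cnt J2 t \<le> cnt J1 t)" if "admissible_J n A D J1" "admissible_J n A D J2" for J1 J2
    using sorted_list_le_iff_cnt[of J1 J2] fin crd that by simp
  show "delta n A D = J"
    unfolding delta_def
  proof (rule the_equality, intro conjI allI impI adm)
    fix J' i assume "admissible_J n A D J'" "i < card J"
    then show "sorted_list_of_set J ! i \<le> sorted_list_of_set J' ! i"
      using le[OF adm] matched_least[OF m] by blast
  next
    fix J1 assume J1: "admissible_J n A D J1 \<and> (\<forall>J'. admissible_J n A D J' \<longrightarrow>
      (\<forall>i<card J1. sorted_list_of_set J1 ! i \<le> sorted_list_of_set J' ! i))"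
    then have "cnt J t \<le> cnt J1 t" for t using le[OF _ adm] adm by blast
    moreover have "cnt J1 t \<le> cnt J t" for t using matched_least[OF m] J1 by blast
    ultimately show "J1 = J" by (intro cnt_eq_imp_eq) (simp add: antisym)
  qed
qed

text \<open>\<open>J\<close> is \<open>B \<inter> C\<close>, which also reveals \<open>A - D\<close>
  and \<open>D - A\<close>; only \<open>A \<inter> D\<close> has to be recovered. At the largest
  letter \<open>t\<close> where two candidates differ, the one omitting \<open>t\<close> sees it as
  available, so nothing waits there. The candidates agree above \<open>t\<close> and have equal
  size, so the other one has just as few letters up to \<open>t\<close>, and before \<open>t\<close>
  it would have fewer than \<open>J\<close>.\<close>

lemma matched_unique:
  assumes m1: "matched n A1 D1 J1" and m2: "matched n A2 D2 J2"
    and B: "(A1 - D1) \<union> J1 = (A2 - D2) \<union> J2" and C: "(D1 - A1) \<union> J1 = (D2 - A2) \<union> J2"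
  shows "A1 = A2 \<and> D1 = D2 \<and> J1 = J2"
proof -
  have no: "t \<notin> I1" if t: "t \<notin> I2" and ab: "I1 \<inter> {t<..} = I2 \<inter> {t<..}"
    and f: "finite I1" "finite I2" "card J = card I1" "card J = card I2"
    and "t \<notin> I2 \<Longrightarrow> t \<in> I1 \<Longrightarrow> cnt I2 t \<le> cnt J t"
    and le: "\<And>t. cnt J t \<le> cnt I1 t"
    and tJ: "t \<in> I1 \<Longrightarrow> t \<notin> J" "t \<in> I1 \<Longrightarrow> 1 \<le> t" for t :: nat and I1 I2 J
  proof
    assume t1: "t \<in> I1"
    have "cnt I1 t = cnt I2 t" using cnt_upper[of I1 t] cnt_upper[of I2 t] ab f by simp
    then have eq: "cnt I1 t \<le> cnt J t" using that(7) t t1 by simp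
    have "{t - 1<..t} = {t}" using tJ(2)[OF t1] by auto
    then have "J \<inter> {t - 1<..t} = {}" using tJ(1)[OF t1] by simp
    then have "cnt J (t - 1) = cnt J t" using cnt_gap[of "t - 1" t J] by simp
    moreover have "cnt I1 (t - 1) < cnt I1 t"
    proof -
      have "I1 \<inter> {t - 1<..t} \<noteq> {}" using tJ t1 by auto
      then have "cnt I1 (t - 1) \<noteq> cnt I1 t" using cnt_gap[of "t - 1" t I1] by simp
      then show ?thesis using cnt_mono[of I1 I1 "t - 1" t] by simp
    qed
    ultimately show False using le[of "t - 1"] eq by simp
  qed
  note d1 = m1[unfolded matched_def] and d2 = m2[unfolded matched_def]
  have J1: "J1 = (A1 - D1 \<union> J1) \<inter> (D1 - A1 \<union> J1)" using d1 by blast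
  have J2: "J2 = (A2 - D2 \<union> J2) \<inter> (D2 - A2 \<union> J2)" using d2 by blast
  have J: "J1 = J2" using J1 J2 B C by simp
  define I1 I2 where "I1 = A1 \<inter> D1" and "I2 = A2 \<inter> D2"
  have ud: "A1 - D1 = A2 - D2" "D1 - A1 = D2 - A2" using B C J d1 d2 by blast+
  have fin: "finite I1" "finite I2" unfolding I1_def I2_def using d1 d2
    by (meson finite_Int finite_atLeastAtMost finite_subset)+
  have "I1 = I2"
  proof (rule ccontr)
    assume "I1 \<noteq> I2"
    define S where "S = (I1 - I2) \<union> (I2 - I1)"
    have S: "finite S" "S \<noteq> {}" unfolding S_def using fin \<open>I1 \<noteq> I2\<close> by auto
    define t where "t = Max S"
    have t: "t \<in> S" unfolding t_def using Max_in S by blast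
    have ab: "I1 \<inter> {t<..} = I2 \<inter> {t<..}"
      using Max_ge[OF S(1)] unfolding t_def S_def by fastforce
    \<comment> \<open>\<open>t\<close> is outside the common \<open>J\<close>, and
      \<open>A2\<close>, \<open>D2\<close> agree with \<open>A1\<close>, \<open>D1\<close> off the
      intersections, so the second column does not use \<open>t\<close> at all.\<close>
    have e1: "t \<in> I1 \<Longrightarrow> t \<notin> I2 \<Longrightarrow> cnt I2 t \<le> cnt J1 t"
      using d1 d2 J ud unfolding I1_def I2_def by blast
    have e2: "t \<in> I2 \<Longrightarrow> t \<notin> I1 \<Longrightarrow> cnt I1 t \<le> cnt J1 t"
      using d1 d2 J ud unfolding I1_def I2_def by blast
    have c: "card J1 = card I1" "card J1 = card I2" "\<And>t. cnt J1 t \<le> cnt I1 t"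
      "\<And>t. cnt J1 t \<le> cnt I2 t"
      using d1 d2 J unfolding I1_def I2_def by auto
    have p: "t \<in> I1 \<Longrightarrow> t \<notin> J1" "t \<in> I2 \<Longrightarrow> t \<notin> J1" "t \<in> I1 \<Longrightarrow> 1 \<le> t" "t \<in> I2 \<Longrightarrow> 1 \<le> t"
      using d1 d2 J unfolding I1_def I2_def by auto
    show False
      using no[of t I2 I1 J1] no[of t I1 I2 J1] t ab fin c p e1 e2 unfolding S_def by auto
  qed
  then show ?thesis using J ud unfolding I1_def I2_def by blast
qed

section \<open>The largest spare letters \<open>K\<close>\<close>

lemma topmost_unique:
  assumes "topmost n F K1" "topmost n F K2" "card K1 = card K2"
  shows "K1 = K2"
proof (rule ccontr)
  assume "K1 \<noteq> K2"
  have f: "finite K1" "finite K2"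
    using assms unfolding topmost_def by (meson finite_Diff finite_atLeastAtMost finite_subset)+
  have "\<not> K1 \<subseteq> K2" "\<not> K2 \<subseteq> K1" using f assms(3) \<open>K1 \<noteq> K2\<close> card_subset_eq by metis+
  then obtain u v where u: "u \<in> K1" "u \<notin> K2" and v: "v \<in> K2" "v \<notin> K1" by blast
  have "u < v" "v < u" using assms u v unfolding topmost_def by blast+
  then show False by simp
qed

lemma topmost_take:
  assumes "k \<le> card ({1..n} - F)"
  defines "K \<equiv> set (take k (rev (sorted_list_of_set ({1..n} - F))))"
  shows "topmost n F K" "card K = k"
proof -
  let ?xs = "rev (sorted_list_of_set ({1..n} - F))"
  have srt: "sorted_wrt (>) ?xs" by (simp add: sorted_wrt_rev)
  have set: "set ?xs = {1..n} - F" by simp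
  have "distinct ?xs" by simp
  then show "card K = k" unfolding K_def using assms(1) by (simp add: distinct_card)
  have "q < z" if "q \<in> {1..n} - F - K" "z \<in> K" for q z
  proof -
    have "q \<in> set (drop k ?xs)"
      using that(1) set unfolding K_def
      by (metis (no_types, lifting) Diff_iff Un_iff append_take_drop_id set_append)
    moreover have "sorted_wrt (>) (take k ?xs @ drop k ?xs)" using srt by simp
    ultimately show ?thesis using that(2) unfolding K_def sorted_wrt_append by blast
  qed
  moreover have "K \<subseteq> {1..n} - F" unfolding K_def using set set_take_subset by metis
  ultimately show "topmost n F K" unfolding topmost_def by blast
qed

text \<open>\<open>J\<close> is disjoint from \<open>A \<union> D\<close> and has as many letters as
  \<open>A \<inter> D\<close>, so it makes up exactly for the letters that a union counts once or a
  difference drops.\<close>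

lemma card_matched:
  assumes "matched n A D J"
  shows "card (A \<union> D \<union> J) = card A + card D"
    "card ((A - D) \<union> J) = card A" "card ((D - A) \<union> J) = card D"
proof -
  note d = assms[unfolded matched_def]
  have f: "finite A" "finite D" "finite J"
    using d by (meson finite_Diff finite_atLeastAtMost finite_subset)+
  have "card (A \<union> D \<union> J) = card (A \<union> D) + card J"
    using d f by (intro card_Un_disjoint) auto
  moreover have "card A + card D = card (A \<union> D) + card (A \<inter> D)"
    using f card_Un_Int by blast
  ultimately show "card (A \<union> D \<union> J) = card A + card D" using d by simp
  have "card ((A - D) \<union> J) = card (A - D) + card J"
    using d f by (intro card_Un_disjoint) auto
  also have "\<dots> = card A" using d f card_Int_Diff[of A D] by (simp)
  finally show "card ((A - D) \<union> J) = card A" .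
  have "card ((D - A) \<union> J) = card (D - A) + card J"
    using d f by (intro card_Un_disjoint) auto
  also have "\<dots> = card D" using d f card_Int_Diff[of D A] by (simp add: Int_commute)
  finally show "card ((D - A) \<union> J) = card D" .
qed

section \<open>Semistandard columns as quadruples \<open>(A, D, J, K)\<close>\<close>

lemma semistd_doubled:
  assumes "semistd n c"
  shows "doubled n (setA c) (setD c) (setJ n c) (setK n c)" "card (setK n c) = zeros c"
proof -
  obtain J where J: "matched n (setA c) (setD c) J"
    using assms matched_exists unfolding semistd_def by blast
  have e: "setJ n c = J" unfolding setJ_def by (rule delta_eq(2)[OF J])
  let ?F = "setA c \<union> setD c \<union> J"
  have F: "?F \<subseteq> {1..n}" using J unfolding matched_def by auto
  then have "card ({1..n} - ?F) = n - card ?F"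
    using card_Diff_subset[OF finite_subset[OF F] F] by simp
  then have k: "zeros c \<le> card ({1..n} - ?F)"
    using assms e unfolding semistd_def by auto
  show "doubled n (setA c) (setD c) (setJ n c) (setK n c)"
    unfolding doubled_def e setK_def using J topmost_take(1)[OF k] by blast
  show "card (setK n c) = zeros c"
    unfolding setK_def e using topmost_take(2)[OF k] .
qed

text \<open>Converse of \<open>semistd_doubled\<close>: every quadruple comes from a column whose
  halves can be read off. A claimed column is thus recognised by exhibiting \<open>J\<close> and
  \<open>K\<close>, without evaluating \<open>delta\<close> or sorting spare letters.\<close>

lemma doubled_column:
  fixes h :: nat and st :: "nat option"
  assumes "doubled n A D J K"
  defines "c \<equiv> Col h st A (card K) D"
  shows "semistd n c" "setJ n c = J" "setK n c = K"
    "setB n c = (A - D) \<union> J" "setC n c = (D - A) \<union> J"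
    "dleft n c = Col h st (A \<union> K) 0 ((D - A) \<union> J)"
    "dright n c = Col h st ((A - D) \<union> J) 0 (D \<union> K)"
proof -
  have m: "matched n A D J" and t: "topmost n (A \<union> D \<union> J) K"
    using assms(1) unfolding doubled_def by auto
  show J: "setJ n c = J" unfolding setJ_def c_def using delta_eq(2)[OF m] by simp
  have F: "A \<union> D \<union> J \<subseteq> {1..n}" using m unfolding matched_def by auto
  have cc: "card ({1..n} - (A \<union> D \<union> J)) = n - card (A \<union> D \<union> J)"
    using card_Diff_subset[OF finite_subset[OF F] F] by simp
  have cF: "card (A \<union> D \<union> J) \<le> n" using card_mono[OF _ F] by simp
  have le: "card K \<le> card ({1..n} - (A \<union> D \<union> J))"
    using t unfolding topmost_def by (intro card_mono) auto
  show "semistd n c"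
    unfolding semistd_def J using delta_eq(1)[OF m] F le cF cc by (auto simp: c_def)
  have "setK n c = set (take (card K) (rev (sorted_list_of_set ({1..n} - (A \<union> D \<union> J)))))"
    unfolding setK_def J by (simp add: c_def)
  then show K: "setK n c = K"
    using topmost_unique[OF topmost_take(1)[OF le] t topmost_take(2)[OF le]] by simp
  have I: "setI c = A \<inter> D" unfolding setI_def c_def by simp
  show B: "setB n c = (A - D) \<union> J" unfolding setB_def I J by (auto simp: c_def)
  show C: "setC n c = (D - A) \<union> J" unfolding setC_def I J by (auto simp: c_def)
  show "dleft n c = Col h st (A \<union> K) 0 ((D - A) \<union> J)"
    unfolding dleft_def C K by (simp add: c_def)
  show "dright n c = Col h st ((A - D) \<union> J) 0 (D \<union> K)"
    unfolding dright_def B K by (simp add: c_def)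
qed

section \<open>Columns differing in one letter\<close>

lemma matchedI:
  assumes "A \<subseteq> {1..n}" "D \<subseteq> {1..n}" "J \<subseteq> {1..n} - (A \<union> D)" "card J = card I" "A \<inter> D = I"
    "\<And>t. cnt J t \<le> cnt I t" "\<And>t. t \<in> {1..n} - (A \<union> D \<union> J) \<Longrightarrow> cnt I t \<le> cnt J t"
  shows "matched n A D J"
  unfolding matched_def using assms by simp

lemma matched_disjoint:
  assumes "P \<subseteq> {1..n}" "Q \<subseteq> {1..n}" "P \<inter> Q = {}"
  shows "matched n P Q {}"
  by (rule matchedI[where I = "{}"]) (use assms in \<open>auto simp: cnt_def\<close>)

text \<open>The element \<open>u\<close> waits exactly on \<open>{u..<v}\<close>. All letters there
  are occupied, so the greedy condition is satisfied with \<open>v\<close> as its partner.\<close>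

lemma matched_single:
  assumes "P \<subseteq> {1..n}" "Q \<subseteq> {1..n}" "P \<inter> Q = {}" "u \<in> {1..n}" "v \<in> {1..n}"
    "u \<notin> P \<union> Q" "v \<notin> P \<union> Q" "u < v" "{u<..<v} \<subseteq> P \<union> Q"
  shows "matched n (insert u P) (insert u Q) {v}"
proof (rule matchedI[where I = "{u}"])
  fix t assume t: "t \<in> {1..n} - (insert u P \<union> insert u Q \<union> {v})"
  have "t \<notin> {u<..<v}" using assms(9) t by blast
  then have "\<not> (u \<le> t \<and> t < v)" using t by auto
  then show "cnt {u} t \<le> cnt {v} t"
    by (auto simp: cnt_insert[where S = "{}"] cnt_zero_iff)
qed (use assms in \<open>auto simp: cnt_insert[where S = "{}"] cnt_zero_iff\<close>)

lemma finite_matched: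
  assumes "matched n A D J" shows "finite A" "finite D" "finite J"
  using assms unfolding matched_def by (meson finite_Diff finite_atLeastAtMost finite_subset)+

lemma topmost_cong:
  assumes "topmost n F K" "F \<inter> {1..n} = F' \<inter> {1..n}" shows "topmost n F' K"
proof -
  have "{1..n} - F = {1..n} - F'" using assms(2) by blast
  then show ?thesis using assms(1) unfolding topmost_def by metis
qed

text \<open>In terms of \<open>f(A,O,D)\<close>, inserting \<open>a\<close> into \<open>B\<close> inserts into \<open>A\<close> the largest \<open>z \<le> a\<close>
  outside \<open>B \<union> D\<close>. If \<open>z\<close> lies in \<open>K\<close>, it is replaced there by the largest spare letter \<open>x\<close>;
  the doubles only see \<open>x\<close>.\<close>

lemma doubled_insert_g:
  assumes d: "doubled n A D J K"
    and a: "a \<in> {1..n}" "a \<notin> (A - D) \<union> J"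
    and x: "x \<le> a" "x \<in> {1..n}" "x \<notin> (A - D) \<union> J \<union> D \<union> K" "{x<..a} \<subseteq> D \<union> K"
      "((A - D) \<union> J) \<inter> {x<..a} = {}"
  obtains A2 D2 J2 K2 where "doubled n A2 D2 J2 K2" "card K2 = card K" "card A2 = Suc (card A)"
    "A2 \<union> K2 = insert x (A \<union> K)" "(A2 - D2) \<union> J2 = insert a ((A - D) \<union> J)"
    "D2 \<union> K2 = insert x (D \<union> K) - {a}" "(D2 - A2) \<union> J2 = (D - A) \<union> J"
proof -
  note m = conjunct1[OF d[unfolded doubled_def]] and tK = conjunct2[OF d[unfolded doubled_def]]
  note m' = m[unfolded matched_def]
  note fin = finite_matched[OF m]
  note tK' = tK[unfolded topmost_def]
  have fK: "finite K" using tK' by (meson finite_Diff finite_atLeastAtMost finite_subset)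
  define z where "z = Max {y \<in> {..a}. y \<notin> (A - D) \<union> J \<union> D}"
  have zin: "z \<in> {y \<in> {..a}. y \<notin> (A - D) \<union> J \<union> D}"
    unfolding z_def by (rule Max_in) (use x in auto)
  have zmax: "y \<le> z" if "y \<le> a" "y \<notin> (A - D) \<union> J \<union> D" for y
    unfolding z_def by (rule Max_ge) (use that in auto)
  have xz: "x \<le> z" using zmax x by auto
  have z: "z \<le> a" "z \<in> {1..n}" "z \<notin> A" "z \<notin> D" "z \<notin> J" using zin a xz x by auto
  have zD: "{z<..a} \<subseteq> D"
  proof
    fix y assume y: "y \<in> {z<..a}"
    then have "y \<in> (A - D) \<union> J \<union> D" using zmax[of y] by auto
    then show "y \<in> D" using x(5) xz y by auto
  qed
  \<comment> \<open>All letters of \<open>{x<..a}\<close> outside \<open>D\<close> belong to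
    \<open>K\<close>, so either \<open>z\<close> is \<open>x\<close> itself or it was used by a
    zero.\<close>
  have xz_eq: "x = z" if "z \<notin> K" using that subsetD[OF x(4), of z] xz z by (cases "x = z") auto
  have Kbig: "q < w" if "q \<in> {1..n}" "q \<notin> A \<union> D \<union> J \<union> K" "w \<in> K" for q w
    using tK' that by blast
  define K2 where "K2 = (if z \<in> K then insert x (K - {z}) else K)"
  have KF: "K \<subseteq> {1..n} - (A \<union> D \<union> J)" using tK' by blast
  have cK: "card K2 = card K" unfolding K2_def using x fK card_Suc_Diff1[OF fK, of z] by auto
  have K2: "topmost n (insert z (A \<union> D \<union> J)) K2"
    unfolding topmost_def
  proof (intro conjI ballI)
    show "K2 \<subseteq> {1..n} - insert z (A \<union> D \<union> J)"
      unfolding K2_def using KF x by auto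
    fix q w assume q: "q \<in> {1..n} - insert z (A \<union> D \<union> J) - K2" and w: "w \<in> K2"
    have qK: "q \<notin> K" using q unfolding K2_def by (auto split: if_splits)
    show "q < w"
    proof (cases "w \<in> K")
      case True
      then show ?thesis using Kbig q qK by auto
    next
      case False
      then have zK: "z \<in> K" and wx: "w = x" using w unfolding K2_def by (auto split: if_splits)
      then have "q < z" using Kbig[of q z] q qK by auto
      moreover have "q \<notin> {x<..a}" using x(4) q qK by auto
      moreover have "q \<noteq> x" using q zK unfolding K2_def by auto
      ultimately show ?thesis using z(1) wx by auto
    qed
  qed
  show ?thesis
  proof (cases "a \<in> D")
    \<comment> \<open>Here \<open>z = a\<close>: the new letter enters \<open>A\<close> alone, and
      the pairing of \<open>A \<inter> D\<close> with \<open>J\<close> stays as it is.\<close>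
    case False
    then have za: "z = a" using subsetD[OF zD, of a] z(1) by (cases "z = a") auto
    have aA: "a \<notin> A" using a False by auto
    have "matched n (insert a A) D J"
      by (rule matchedI[where I = "A \<inter> D"]) (use m' a False in auto)
    moreover have "insert a A \<union> D \<union> J = insert z (A \<union> D \<union> J)" using za by auto
    ultimately have "doubled n (insert a A) D J K2" unfolding doubled_def using K2 by simp
    moreover have "card (insert a A) = Suc (card A)" using aA fin by simp
    moreover have "insert a A \<union> K2 = insert x (A \<union> K)"
      unfolding K2_def using za xz_eq by auto
    moreover have "insert a A - D \<union> J = insert a (A - D \<union> J)" using False by auto
    moreover have "D \<union> K2 = insert x (D \<union> K) - {a}"
      unfolding K2_def using za xz_eq False x by (cases "x = a") auto
    moreover have "D - insert a A \<union> J = D - A \<union> J" using False by auto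
    ultimately show ?thesis using cK by (intro that[of "insert a A" D J K2])
  next
    case True
    then have za: "z < a" using z by (cases "z = a") auto
    let ?A = "insert z A" and ?D = "insert z (D - {a})"
    have cA: "card ?A = Suc (card A)" using fin z by simp
    have AK: "?A \<union> K2 = insert x (A \<union> K)" unfolding K2_def using xz_eq by auto
    have aK: "a \<notin> K" using True KF by auto
    have DK: "?D \<union> K2 = insert x (D \<union> K) - {a}"
      unfolding K2_def using xz_eq aK x True za xz by auto
    show ?thesis
    proof (cases "a \<in> A")
      \<comment> \<open>A doubled \<open>a\<close> becomes single: it leaves \<open>D\<close>, and
        \<open>z\<close> takes its place in the intersection. The letters of \<open>{z<..a}\<close>
        lie in \<open>D\<close>, so no available letter notices the shift.\<close>
      case aA: True
      have I: "?A \<inter> ?D = insert z (A \<inter> D - {a})" using aA True z by auto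
      have "card (insert z (A \<inter> D - {a})) = card (A \<inter> D)"
        using card_Suc_Diff1[of "A \<inter> D" a] fin z aA True by simp
      then have "matched n ?A ?D J"
      proof (intro matchedI[OF _ _ _ _ I])
        fix t
        show "cnt J t \<le> cnt (insert z (A \<inter> D - {a})) t"
          using m' za cnt_pos[of a "A \<inter> D" t] aA True z
          by (auto simp: cnt_insert cnt_remove le_SucI)
        assume t: "t \<in> {1..n} - (?A \<union> ?D \<union> J)"
        then have "t \<notin> A \<union> D \<union> J" using aA by auto
        moreover have "t \<notin> {z<..a}" "t \<noteq> z" using zD calculation t by auto
        moreover have "cnt (A \<inter> D) t \<le> cnt J t" using m' t calculation by auto
        ultimately show "cnt (insert z (A \<inter> D - {a})) t \<le> cnt J t"
          using za cnt_pos[of a "A \<inter> D" t] aA True z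
          by (auto simp: cnt_insert cnt_remove)
      qed (use m' z in auto)
      moreover have "?A \<union> ?D \<union> J = insert z (A \<union> D \<union> J)" using aA by auto
      ultimately have "doubled n ?A ?D J K2" unfolding doubled_def using K2 by simp
      moreover have "?A - ?D \<union> J = insert a (A - D \<union> J)" using aA True z za by auto
      moreover have "?D - ?A \<union> J = D - A \<union> J" using aA True z za by auto
      ultimately show ?thesis using cK cA AK DK by (intro that[of ?A ?D J K2])
    next
      \<comment> \<open>\<open>a\<close> leaves \<open>D\<close> but has to stay in \<open>C\<close>
        and to enter \<open>B\<close>, so it joins \<open>J\<close> as partner for the newly doubled
        \<open>z\<close>.\<close>
      case aA: False
      have I: "?A \<inter> ?D = insert z (A \<inter> D)" using aA True z by auto
      have "card (insert a J) = card (insert z (A \<inter> D))"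
        using fin z a m' by simp
      then have "matched n ?A ?D (insert a J)"
      proof (intro matchedI[OF _ _ _ _ I])
        fix t
        have "cnt J t \<le> cnt (A \<inter> D) t" using m' by auto
        then show "cnt (insert a J) t \<le> cnt (insert z (A \<inter> D)) t"
          using za z a by (auto simp: cnt_insert)
        assume t: "t \<in> {1..n} - (?A \<union> ?D \<union> insert a J)"
        then have "t \<notin> A \<union> D \<union> J" by auto
        moreover have "t \<notin> {z<..a}" "t \<noteq> z" using zD calculation t by auto
        moreover have "cnt (A \<inter> D) t \<le> cnt J t" using m' t calculation by auto
        ultimately show "cnt (insert z (A \<inter> D)) t \<le> cnt (insert a J) t"
          using za z a by (auto simp: cnt_insert)
      qed (use m' z a aA True in auto)
      moreover have "?A \<union> ?D \<union> insert a J = insert z (A \<union> D \<union> J)" using True by auto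
      ultimately have "doubled n ?A ?D (insert a J) K2" unfolding doubled_def using K2 by simp
      moreover have "?A - ?D \<union> insert a J = insert a (A - D \<union> J)" using aA True z za by auto
      moreover have "?D - ?A \<union> insert a J = D - A \<union> J" using aA True z za by auto
      ultimately show ?thesis using cK cA AK DK by (intro that[of ?A ?D "insert a J" K2])
    qed
  qed
qed

text \<open>Equal counts of \<open>B\<close> and \<open>A\<close> at \<open>b\<close> mean that up
  to \<open>b\<close> nothing waits, so removing \<open>a\<close> releases \<open>b\<close>: a
  doubled \<open>a\<close> leaves one partner too many, and a single \<open>a\<close> becomes
  available and replaces \<open>b\<close> in \<open>J\<close> (with no effect on \<open>J\<close> if
  \<open>a = b\<close>). As \<open>K\<close> has no letter up to \<open>b\<close>, it stays on top
  although \<open>b\<close> becomes spare.\<close>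

lemma doubled_remove_f:
  assumes d: "doubled n A D J K"
    and a: "a \<in> A" "b \<in> (A - D) \<union> J" "a \<le> b" "A \<inter> {a<..b} = {}" "K \<inter> {..b} = {}"
    and c: "cnt ((A - D) \<union> J) b = cnt A b"
  obtains J2 where "doubled n (A - {a}) D J2 K"
    "((A - {a}) - D) \<union> J2 = (A - D \<union> J) - {b}"
    "(D - (A - {a})) \<union> J2 = insert a (D - A \<union> J) - {b}"
    "{a<..<b} \<subseteq> D - A \<union> J" "a \<noteq> b \<Longrightarrow> b \<in> J" "a \<notin> D - A \<union> J"
proof -
  note m = conjunct1[OF d[unfolded doubled_def]] and tK = conjunct2[OF d[unfolded doubled_def]]
  note m' = m[unfolded matched_def]
  note fin = finite_matched[OF m]
  have "cnt (A - D) b + cnt J b = cnt A b" using c m' by (subst cnt_Un[symmetric]) auto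
  moreover have "cnt A b = cnt (A - D) b + cnt (A \<inter> D) b"
    by (subst cnt_Un[symmetric]) (auto intro: arg_cong[where f = "\<lambda>S. cnt S b"])
  ultimately have eqb: "cnt J b = cnt (A \<inter> D) b" by simp
  have Kbig: "q < w" if "q \<in> {1..n}" "q \<notin> A \<union> D \<union> J \<union> K" "w \<in> K" for q w
    using tK that unfolding topmost_def by blast
  have Ieq: "cnt (A \<inter> D) t = cnt (A \<inter> D) b" if "a \<le> t" "t \<le> b" for t
    using that a(4) cnt_gap[OF that(2)] by auto
  have Jle: "cnt J t \<le> cnt (A \<inter> D) t" for t using m' by auto
  have Jeq: "cnt (A \<inter> D) t \<le> cnt J t" if "t \<in> {1..n}" "t \<notin> A \<union> D \<union> J" for t using m' that by auto
  have topF: "topmost n F K" if "F \<subseteq> A \<union> D \<union> J" "A \<union> D \<union> J \<subseteq> insert y F" "y \<le> b" for F y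
    unfolding topmost_def
  proof (intro conjI ballI)
    show "K \<subseteq> {1..n} - F" using that tK unfolding topmost_def by auto
    fix q w assume q: "q \<in> {1..n} - F - K" and w: "w \<in> K"
    have "b < w" using w a(5) by (auto simp: not_le[symmetric])
    then show "q < w" using that Kbig[of q w] q w by (cases "q = y") auto
  qed
  \<comment> \<open>At an available letter strictly between \<open>a\<close> and \<open>b\<close>
    nothing waits, so \<open>J\<close> would have as many letters up to it as up to
    \<open>b\<close>; but \<open>b\<close> itself lies in \<open>J\<close>.\<close>
  have gap: "{a<..<b} \<subseteq> D - A \<union> J"
  proof
    fix y assume y: "y \<in> {a<..<b}"
    have yA: "y \<notin> A" using y a(4) by auto
    have bn: "b \<in> {1..n}" and a1: "1 \<le> a" using a m' by auto
    have bJ: "b \<in> J" using a y by auto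
    show "y \<in> D - A \<union> J"
    proof (rule ccontr)
      assume "y \<notin> D - A \<union> J"
      then have "y \<notin> A \<union> D \<union> J" using yA by auto
      then have "cnt (A \<inter> D) y \<le> cnt J y" using Jeq[of y] y bn a1 by auto
      then have "cnt J b \<le> cnt J y" using Ieq[of y] y eqb by auto
      then have "cnt J y = cnt J b" using cnt_mono[of J J y b] y by auto
      then have "J \<inter> {y<..b} = {}" using cnt_gap[of y b J] y by auto
      then show False using bJ y by auto
    qed
  qed
  have aC: "a \<notin> D - A \<union> J" using a m' by auto
  have bJ: "b \<in> J" if "a \<noteq> b" using a that by auto
  show ?thesis
  proof (cases "a \<in> D")
    case aD: True
    have ab: "a \<noteq> b" using aD a m' by auto
    have I: "(A - {a}) \<inter> D = A \<inter> D - {a}" by auto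
    have "card (J - {b}) = card (A \<inter> D - {a})"
      using m' bJ[OF ab] aD a fin by (simp)
    then have "matched n (A - {a}) D (J - {b})"
    proof (intro matchedI[OF _ _ _ _ I])
      fix t
      show "cnt (J - {b}) t \<le> cnt (A \<inter> D - {a}) t"
      proof (cases "a \<le> t \<and> t < b")
        case True
        have "J \<inter> {t<..b} \<noteq> {}" using bJ[OF ab] True by auto
        then have "cnt J t < cnt J b"
          using cnt_gap[of t b J] cnt_mono[of J J t b] True by auto
        then show ?thesis using Ieq[of t] True eqb by (auto simp: cnt_remove)
      next
        case False
        then show ?thesis using Jle[of t] bJ[OF ab] a(3) by (auto simp: cnt_remove)
      qed
      assume t: "t \<in> {1..n} - (A - {a} \<union> D \<union> (J - {b}))"
      show "cnt (A \<inter> D - {a}) t \<le> cnt (J - {b}) t"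
      proof (cases "t = b")
        case True
        then show ?thesis using eqb aD a bJ[OF ab] by (simp add: cnt_remove)
      next
        case False
        then have t': "t \<notin> A \<union> D \<union> J" using t aD by auto
        then have "t \<notin> {a<..<b}" "t \<noteq> a" using gap aD by auto
        then show ?thesis using Jeq[of t] t t' aD a(1,3) bJ[OF ab] False by (auto simp: cnt_remove)
      qed
    qed (use m' in auto)
    moreover have "topmost n (A - {a} \<union> D \<union> (J - {b})) K"
      by (rule topF[where y = b]) (use aD in auto)
    ultimately have "doubled n (A - {a}) D (J - {b}) K" unfolding doubled_def by simp
    moreover have "((A - {a}) - D) \<union> (J - {b}) = (A - D \<union> J) - {b}"
      using aD bJ[OF ab] m' by auto
    moreover have "(D - (A - {a})) \<union> (J - {b}) = insert a (D - A \<union> J) - {b}"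
      using aD bJ[OF ab] m' ab by auto
    ultimately show ?thesis using gap aC bJ by (intro that[of "J - {b}"])
  next
    case aD: False
    have aJ: "a \<notin> J" using a m' by auto
    define J2 where "J2 = insert a J - {b}"
    have I: "(A - {a}) \<inter> D = A \<inter> D" using aD by auto
    have "card J2 = card (A \<inter> D)"
      unfolding J2_def using m' bJ aJ fin card_Suc_Diff1[of J b]
      by (cases "a = b") (auto simp: insert_Diff_if)
    then have "matched n (A - {a}) D J2"
    proof (intro matchedI[OF _ _ _ _ I])
      show "J2 \<subseteq> {1..n} - (A - {a} \<union> D)" unfolding J2_def using m' a aD by auto
      fix t
      show "cnt J2 t \<le> cnt (A \<inter> D) t"
      proof (cases "a \<le> t \<and> t < b")
        case True
        have "J \<inter> {t<..b} \<noteq> {}" using bJ True by auto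
        then have "cnt J t < cnt J b"
          using cnt_gap[of t b J] cnt_mono[of J J t b] True by auto
        then show ?thesis unfolding J2_def using Ieq[of t] True eqb by (auto simp: cnt_remove cnt_insert)
      next
        case False
        then show ?thesis unfolding J2_def using Jle[of t] bJ a(3) aJ
          by (cases "a = b") (auto simp: cnt_remove cnt_insert)
      qed
      assume t: "t \<in> {1..n} - (A - {a} \<union> D \<union> J2)"
      show "cnt (A \<inter> D) t \<le> cnt J2 t"
      proof (cases "t = b")
        case True
        then show ?thesis unfolding J2_def using eqb aJ a bJ by (cases "a = b") (auto simp: cnt_remove cnt_insert)
      next
        case False
        then have ta: "t \<noteq> a" using t unfolding J2_def by auto
        then have t': "t \<notin> A \<union> D \<union> J" using t aD False unfolding J2_def by auto
        then have "t \<notin> {a<..<b}" using gap by auto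
        then show ?thesis unfolding J2_def using Jeq[of t] t t' aJ a(3) bJ False ta
          by (cases "a = b") (auto simp: cnt_remove cnt_insert)
      qed
    qed (use m' in auto)
    moreover have "topmost n (A - {a} \<union> D \<union> J2) K"
      by (rule topmost_cong[OF topF[where y = b and F = "A \<union> D \<union> J - {b}"]])
        (use aD bJ aJ a m' in \<open>auto simp: J2_def\<close>)
    ultimately have "doubled n (A - {a}) D J2 K" unfolding doubled_def by simp
    moreover have "((A - {a}) - D) \<union> J2 = (A - D \<union> J) - {b}"
      unfolding J2_def using aD bJ a m' by auto
    moreover have "(D - (A - {a})) \<union> J2 = insert a (D - A \<union> J) - {b}"
      unfolding J2_def using aD bJ a m' by auto
    ultimately show ?thesis using gap aC bJ by (intro that[of J2])
  qed
qed

text \<open>Putting \<open>c\<close> into \<open>D\<close> makes it doubled if it was in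
  \<open>A\<close>, and expels it from \<open>J\<close> if it was a partner. Either way one doubled
  letter needs a new partner, and this is \<open>y\<close>: all letters from \<open>c\<close> to
  just below \<open>y\<close> are occupied. For \<open>c = y\<close> the letter was in neither set
  and the pairing is unchanged.\<close>

lemma doubled_insert_f:
  assumes d: "doubled n A D J K"
    and c: "c \<in> {1..n}" "c \<notin> D \<union> K"
    and y: "c \<le> y" "y \<in> {1..n}" "y \<notin> (A - D) \<union> J \<union> D \<union> K" "{c..<y} \<subseteq> (A - D) \<union> J"
  obtains J2 where "doubled n A (insert c D) J2 K"
    "(A - insert c D) \<union> J2 = insert y (A - D \<union> J) - {c}"
    "(insert c D - A) \<union> J2 = insert y (D - A \<union> J)"
proof -
  note m = conjunct1[OF d[unfolded doubled_def]] and tK = conjunct2[OF d[unfolded doubled_def]]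
  note m' = m[unfolded matched_def]
  note fin = finite_matched[OF m]
  have Jle: "cnt J t \<le> cnt (A \<inter> D) t" for t using m' by auto
  have Jeq: "cnt (A \<inter> D) t \<le> cnt J t" if "t \<in> {1..n}" "t \<notin> A \<union> D \<union> J" for t using m' that by auto
  define J2 where "J2 = insert y J - {c}"
  define I2 where "I2 = (if c \<in> A then insert c (A \<inter> D) else A \<inter> D)"
  have cB: "c = y \<and> c \<notin> A \<and> c \<notin> J \<or> c < y \<and> c \<in> A \<and> c \<notin> J \<or> c < y \<and> c \<notin> A \<and> c \<in> J"
    using c y m' subsetD[OF y(4), of c] by (cases "c = y") auto
  have yn: "y \<notin> A" "y \<notin> D" "y \<notin> J" using y by auto
  have I: "A \<inter> insert c D = I2" unfolding I2_def by auto
  have J2c: "cnt J2 t = cnt J t + (if y \<le> t then 1 else 0) - (if c \<notin> A \<and> c \<le> t then 1 else 0)" for t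
    unfolding J2_def using cB yn by (auto simp: cnt_insert cnt_remove)
  have I2c: "cnt I2 t = cnt (A \<inter> D) t + (if c \<in> A \<and> c \<le> t then 1 else 0)" for t
    unfolding I2_def using c by (auto simp: cnt_insert)
  have "card J2 = card I2"
  proof -
    have "card J = card (A \<inter> D)" using m' by blast
    then show ?thesis using cB yn fin c card_Suc_Diff1[of J c]
      unfolding J2_def I2_def by (auto simp: insert_Diff_if)
  qed
  then have "matched n A (insert c D) J2"
  proof (intro matchedI[OF _ _ _ _ I])
    fix t
    have "0 < cnt J t" if "c \<le> t" "c \<in> J" using cnt_pos that by blast
    then show "cnt J2 t \<le> cnt I2 t" unfolding J2c I2c using Jle[of t] cB by auto
    assume t: "t \<in> {1..n} - (A \<union> insert c D \<union> J2)"
    then have ty: "t \<noteq> y" "t \<noteq> c" using cB unfolding J2_def by auto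
    then have tF: "t \<notin> A \<union> D \<union> J" using t unfolding J2_def by auto
    then have "t \<notin> {c..<y}" using y by auto
    then show "cnt I2 t \<le> cnt J2 t" unfolding J2c I2c using Jeq[of t] tF t ty cB by auto
  qed (use m' c y yn in \<open>auto simp: J2_def\<close>)
  moreover have "topmost n (A \<union> insert c D \<union> J2) K"
  proof -
    have "A \<union> insert c D \<union> J2 = insert y (A \<union> D \<union> J)" unfolding J2_def using cB by auto
    then show ?thesis using tK y unfolding topmost_def by auto
  qed
  moreover have "(A - insert c D) \<union> J2 = insert y (A - D \<union> J) - {c}"
    unfolding J2_def by auto
  moreover have "(insert c D - A) \<union> J2 = insert y (D - A \<union> J)"
    unfolding J2_def using cB c by auto
  ultimately show ?thesis by (intro that[of J2]) (simp_all add: doubled_def)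
qed

text \<open>The letter actually lost by \<open>D\<close> is \<open>z\<close>, its least element from
  \<open>d\<close> on. If \<open>z\<close> is not \<open>d\<close>, then \<open>d\<close> was in
  \<open>K\<close> and \<open>z\<close> replaces it there; if \<open>z\<close> is not
  \<open>c\<close>, then \<open>z\<close> was doubled and \<open>A\<close> receives \<open>c\<close>
  in its place. The count \<open>cd\<close> forces \<open>K\<close> to lie in \<open>{d..}\<close>
  and all doubled letters below \<open>d\<close> to have their partners below
  \<open>d\<close>.\<close>

lemma doubled_remove_g:
  assumes d: "doubled n A D J K"
    and c: "c \<in> D - A \<union> J" "d \<in> D \<union> K" "d \<le> c" "(D - A \<union> J) \<inter> {d..<c} = {}"
    and cd: "card ((D \<union> K) \<inter> {d..}) = card ((D - A \<union> J) \<inter> {d..}) + card K"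
  obtains A2 D2 J2 K2 where "doubled n A2 D2 J2 K2" "card K2 = card K"
    "card D = Suc (card D2)" "card A2 = card A"
    "A2 \<union> K2 = insert c (A \<union> K) - {d}" "(A2 - D2) \<union> J2 = A - D \<union> J"
    "D2 \<union> K2 = D \<union> K - {d}" "(D2 - A2) \<union> J2 = (D - A \<union> J) - {c}"
    "{d<..<c} \<subseteq> A \<union> K" "d \<noteq> c \<Longrightarrow> d \<in> A \<union> K"
proof -
  note m = conjunct1[OF d[unfolded doubled_def]] and tK = conjunct2[OF d[unfolded doubled_def]]
  note m' = m[unfolded matched_def]
  note fin = finite_matched[OF m]
  have KF: "K \<subseteq> {1..n} - (A \<union> D \<union> J)" using tK unfolding topmost_def by blast
  have fK: "finite K" using KF by (meson finite_Diff finite_atLeastAtMost finite_subset)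
  have Kbig: "q < w" if "q \<in> {1..n}" "q \<notin> A \<union> D \<union> J \<union> K" "w \<in> K" for q w
    using tK that unfolding topmost_def by blast
  have Jle: "cnt J t \<le> cnt (A \<inter> D) t" for t using m' by auto
  have Jeq: "cnt (A \<inter> D) t \<le> cnt J t" if "t \<in> {1..n}" "t \<notin> A \<union> D \<union> J" for t using m' that by auto
  let ?C = "D - A \<union> J" and ?I = "A \<inter> D"
  have d1: "1 \<le> d" using c(2) KF m' by (meson Diff_iff Un_iff atLeastAtMost_iff subsetD)
  have up: "S \<inter> {d..} = S \<inter> {d - 1<..}" for S :: "nat set" using d1 by auto
  have cD: "cnt D t = cnt (D - A) t + cnt ?I t" for t
    by (subst cnt_Un[symmetric]) (auto intro: arg_cong[where f = "\<lambda>S. cnt S t"])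
  have cC: "cnt ?C t = cnt (D - A) t + cnt J t" for t
    using m' by (subst cnt_Un) auto
  \<comment> \<open>\<open>D\<close> and \<open>C\<close> have equal size and \<open>J\<close> is
    nowhere ahead of \<open>A \<inter> D\<close>, so \<open>D\<close> has at most as many letters
    from \<open>d\<close> on. Together with the bound by \<open>card K\<close>, \<open>cd\<close>
    leaves no slack in either inequality.\<close>
  have "card (D \<inter> {d..}) \<le> card (?C \<inter> {d..})"
    using cnt_upper[of D "d - 1"] cnt_upper[of ?C "d - 1"] cD[of "d - 1"] cC[of "d - 1"]
      Jle[of "d - 1"] card_matched(3)[OF m] fin unfolding up by simp
  moreover have "card ((D \<union> K) \<inter> {d..}) = card (D \<inter> {d..}) + card (K \<inter> {d..})"
    using fin fK KF by (subst card_Un_disjoint[symmetric]) (auto intro: arg_cong[where f = card])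
  moreover have "card (K \<inter> {d..}) \<le> card K" using fK by (intro card_mono) auto
  ultimately have Kd: "card (K \<inter> {d..}) = card K" and Dd: "card (D \<inter> {d..}) = card (?C \<inter> {d..})"
    using cd by linarith+
  have Kd: "K \<subseteq> {d..}" using card_subset_eq[OF fK, of "K \<inter> {d..}"] Kd by blast
  have IJ: "cnt ?I (d - 1) = cnt J (d - 1)"
    using cnt_upper[of D "d - 1"] cnt_upper[of ?C "d - 1"] cD[of "d - 1"] cC[of "d - 1"]
      card_matched(3)[OF m] fin Dd unfolding up by simp
  have "{c} \<subseteq> ?C \<inter> {d..}" using c by auto
  then have "card (D \<inter> {d..}) \<noteq> 0" unfolding Dd using fin by auto
  then have ne: "D \<inter> {d..} \<noteq> {}" by auto
  define z where "z = Min (D \<inter> {d..})"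
  have z: "z \<in> D" "d \<le> z" using Min_in[OF _ ne] fin unfolding z_def by auto
  have zmin: "z \<le> t" if "t \<in> D" "d \<le> t" for t using Min_le[of "D \<inter> {d..}"] that fin unfolding z_def by auto
  have zn: "z \<in> {1..n}" "z \<notin> J" "z \<notin> K" using z(1) m' KF by blast+
  have cn: "c \<in> {1..n}" using c(1) m' by blast
  have zc: "z \<le> c"
  proof (rule ccontr)
    assume "\<not> z \<le> c"
    then have "D \<inter> {d - 1<..c} = {}" using zmin d1 by fastforce
    then have e: "cnt D (d - 1) = cnt D c" using cnt_gap[of "d - 1" c D] c by simp
    have "cnt ?C (d - 1) < cnt ?C c"
    proof -
      have "?C \<inter> {d - 1<..c} \<noteq> {}" using c d1 by auto
      moreover have "d - 1 \<le> c" using c(3) by simp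
      ultimately show ?thesis
        using cnt_gap[of "d - 1" c ?C] cnt_mono[of ?C ?C "d - 1" c] by simp
    qed
    then show False using e IJ cD cC Jle[of c] by (metis add_le_cancel_left not_le)
  qed
  have zA: "z \<in> A" if "z \<noteq> c" using that z zc c(4) by auto
  have dK: "d \<in> K" if "d \<noteq> z" using that c(2) zmin[of d] z(2) by auto
  have Jc: "cnt J t = cnt J (d - 1)" if "d \<le> t" "t < c" for t
  proof -
    have "J \<inter> {d - 1<..t} \<subseteq> ?C \<inter> {d..<c}" using that d1 by auto
    then have "J \<inter> {d - 1<..t} = {}" unfolding c(4) by simp
    then show ?thesis using cnt_gap[of "d - 1" t J] that by simp
  qed
  have Iz: "cnt ?I z = cnt J (d - 1) + (if z \<in> A then 1 else 0)"
  proof -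
    have "(?I - {z}) \<inter> {d - 1<..z} = {}" using zmin d1 by fastforce
    then have "cnt (?I - {z}) (d - 1) = cnt (?I - {z}) z"
      using cnt_gap[of "d - 1" z] z by simp
    moreover have "cnt (?I - {z}) (d - 1) = cnt ?I (d - 1)"
    proof -
      have "\<not> z \<le> d - 1" using d1 z(2) by simp
      then show ?thesis by (simp add: cnt_remove)
    qed
    ultimately show ?thesis using IJ z cnt_pos[of z ?I z] by (auto simp: cnt_remove)
  qed
  \<comment> \<open>If \<open>z < c\<close>, the doubled \<open>z\<close> is waiting from
    \<open>z\<close> to just below \<open>c\<close>, so no letter there is available. This protects
    the greedy condition when \<open>z\<close> is given up.\<close>
  have strict: "cnt J t < cnt ?I t" if "z \<le> t" "t < c" for t
    using Jc[of t] Iz zA that z cnt_mono[of ?I ?I z t] by auto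
  define D2 where "D2 = D - {z}"
  define A2 where "A2 = (if z = c then A else insert c (A - {z}))"
  define J2 where "J2 = (if z = c then J else J - {c})"
  define K2 where "K2 = (if z = d then K else insert z (K - {d}))"
  have cA: "c \<notin> A" using c m' by auto
  have cc: "c \<in> D \<and> c \<notin> J \<or> c \<notin> D \<and> c \<in> J" using c m' by auto
  \<comment> \<open>If \<open>z\<close> differs from \<open>c\<close>, a letter \<open>c\<close> of
    \<open>D\<close> becomes doubled in place of \<open>z\<close>, whereas for \<open>c\<close> in
    \<open>J\<close> one doubled letter and one partner disappear.\<close>
  define I2 where "I2 = (if z = c then ?I else if c \<in> D then insert c (?I - {z}) else ?I - {z})"
  have I: "A2 \<inter> D2 = I2" unfolding A2_def D2_def I2_def using z cA by auto
  have "card J2 = card I2"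
  proof -
    have "card J = card ?I" using m' by blast
    then show ?thesis unfolding J2_def I2_def
      using fin card_Suc_Diff1[of ?I z] zA z cA cc by auto
  qed
  then have mm: "matched n A2 D2 J2"
  proof (intro matchedI[OF _ _ _ _ I])
    fix t
    have p: "z \<noteq> c \<Longrightarrow> z \<le> t \<Longrightarrow> 0 < cnt ?I t" using cnt_pos[of z ?I t] z zA by auto
    show "cnt J2 t \<le> cnt I2 t"
      unfolding J2_def I2_def using Jle[of t] strict[of t] p cc cA zc z zA
      by (auto simp: cnt_insert cnt_remove)
    assume t: "t \<in> {1..n} - (A2 \<union> D2 \<union> J2)"
    show "cnt I2 t \<le> cnt J2 t"
    proof (cases "t = z")
      case True
      show ?thesis
      proof (cases "z = c")
        case zeq: True
        then have "z \<notin> A" using cA by simp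
        then have "cnt ?I z \<le> cnt J z" using Iz cnt_mono[of J J "d - 1" z] z by simp
        then show ?thesis unfolding I2_def J2_def using True zeq by simp
      next
        case False
        then show ?thesis unfolding I2_def J2_def
          using Iz zA z zc Jc[of z] True cA by (auto simp: cnt_insert cnt_remove)
      qed
    next
      case False
      then have tF: "t \<notin> A \<union> D \<union> J" using t unfolding A2_def D2_def J2_def by (auto split: if_splits)
      have "cnt ?I t \<le> cnt J t" using Jeq tF t by auto
      then show ?thesis unfolding I2_def J2_def
        using zA z zc cA cc strict[of t] p by (auto simp: cnt_insert cnt_remove)
    qed
  qed (use m' cn zn in \<open>auto simp: A2_def D2_def J2_def split: if_splits\<close>)
  have F2: "A2 \<union> D2 \<union> J2 = (A \<union> D \<union> J) - {z}"
    unfolding A2_def D2_def J2_def using zA z zn cA cc by auto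
  have "topmost n (A2 \<union> D2 \<union> J2) K2"
    unfolding F2 topmost_def
  proof (intro conjI ballI)
    show "K2 \<subseteq> {1..n} - (A \<union> D \<union> J - {z})" unfolding K2_def using KF zn by auto
    fix q w assume q: "q \<in> {1..n} - (A \<union> D \<union> J - {z}) - K2" and w: "w \<in> K2"
    show "q < w"
    proof (cases "z = d")
      case True
      then have wK: "w \<in> K" using w unfolding K2_def by simp
      show ?thesis
      proof (cases "q = z")
        case True
        then show ?thesis using \<open>z = d\<close> wK Kd zn by (metis atLeast_iff le_neq_implies_less subsetD)
      next
        case False
        then show ?thesis using Kbig[of q w] q wK True unfolding K2_def by auto
      qed
    next
      case False
      then have dz: "d < z" "d \<in> K" using dK z by auto
      have "q \<le> d" using q Kbig[of q d] dz False unfolding K2_def by (cases "q = d") auto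
      moreover have "d < w" using w False dz Kd unfolding K2_def
        by (auto simp: subset_iff le_less)
      ultimately show ?thesis by simp
    qed
  qed
  then have dd: "doubled n A2 D2 J2 K2" unfolding doubled_def using mm by simp
  have e1: "card K2 = card K" unfolding K2_def using dK fK zn card_Suc_Diff1[of K d] by auto
  have e2: "card D = Suc (card D2)" unfolding D2_def using card_Suc_Diff1[OF fin(2) z(1)] by simp
  have e3: "card A2 = card A" unfolding A2_def using fin zA cA card_Suc_Diff1[of A z] by auto
  have dn: "d \<in> K \<Longrightarrow> d \<notin> A \<union> D" using KF by auto
  have e4: "A2 \<union> K2 = insert c (A \<union> K) - {d}"
  proof (cases "z = c")
    case True
    then show ?thesis unfolding A2_def K2_def using dK dn cA zn z by (cases "z = d") auto
  next
    case False
    then show ?thesis unfolding A2_def K2_def using dK dn cA zn z zA zc by (cases "z = d") auto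
  qed
  have e5: "(A2 - D2) \<union> J2 = A - D \<union> J"
    unfolding A2_def D2_def J2_def using zA z zn cA cc by auto
  have e6: "D2 \<union> K2 = D \<union> K - {d}"
    unfolding D2_def K2_def using dK dn zn z by auto
  have e7: "(D2 - A2) \<union> J2 = (D - A \<union> J) - {c}"
    unfolding A2_def D2_def J2_def using zA z zn cA cc by auto
  have e8: "{d<..<c} \<subseteq> A \<union> K"
  proof
    fix t assume t: "t \<in> {d<..<c}"
    then have tC: "t \<notin> ?C" using c(4) by auto
    show "t \<in> A \<union> K"
    proof (rule ccontr)
      assume tn: "t \<notin> A \<union> K"
      then have tF: "t \<notin> A \<union> D \<union> J \<union> K" using tC by auto
      have tn': "t \<in> {1..n}" using t cn by auto
      show False
      proof (cases "z = d")
        case True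
        then show False using strict[of t] Jeq[of t] tF tn' t by auto
      next
        case False
        then show False using Kbig[OF tn' tF, of d] dK t by auto
      qed
    qed
  qed
  have e9: "d \<noteq> c \<Longrightarrow> d \<in> A \<union> K" using dK zA by (cases "d = z") auto
  show ?thesis using that[OF dd e1 e2 e3 e4 e5 e6 e7 e8 e9] .
qed

lemma doubled_insert_zero:
  assumes "doubled n A D J K" "x \<in> {1..n}" "x \<notin> A \<union> D \<union> J \<union> K"
    "\<And>q. q \<in> {1..n} \<Longrightarrow> q \<notin> A \<union> D \<union> J \<union> K \<Longrightarrow> q \<le> x"
  shows "doubled n A D J (insert x K)"
proof -
  have "q < x" if "q \<in> {1..n}" "q \<notin> A \<union> D \<union> J \<union> K" "q \<noteq> x" for q
    using assms(4)[of q] that by auto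
  then show ?thesis using assms(1-3) unfolding doubled_def topmost_def by auto
qed

lemma doubled_remove_zero:
  assumes "doubled n A D J K" "e \<in> K" "K \<subseteq> {e..}"
  shows "doubled n A D J (K - {e})"
proof -
  have t: "topmost n (A \<union> D \<union> J) K" using assms(1) unfolding doubled_def by simp
  have "q < w" if "q \<in> {1..n} - (A \<union> D \<union> J) - (K - {e})" "w \<in> K - {e}" for q w
  proof (cases "q = e")
    case True
    then show ?thesis using that assms(3) by (auto simp: subset_iff le_less)
  next
    case False
    then show ?thesis using that t unfolding topmost_def by blast
  qed
  then show ?thesis using assms(1) t unfolding doubled_def topmost_def by blast
qed

section \<open>Entries of a column\<close>

lemma nth_sorted_list_eq_iff:
  assumes "finite P" "i < card P"
  shows "sorted_list_of_set P ! i = a \<longleftrightarrow> a \<in> P \<and> cnt P a = Suc i"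
proof -
  have 1: "sorted_list_of_set P ! j \<in> P \<and> cnt P (sorted_list_of_set P ! j) = Suc j"
    if j: "j < card P" for j
  proof -
    have mem: "sorted_list_of_set P ! j \<in> P" using nth_mem[of j "sorted_list_of_set P"] j assms(1) by simp
    have "j < cnt P (sorted_list_of_set P ! j)"
      using nth_sorted_list_le_iff[OF assms(1) j, of "sorted_list_of_set P ! j"] by blast
    moreover have "\<not> Suc j < cnt P (sorted_list_of_set P ! j)"
    proof
      assume h: "Suc j < cnt P (sorted_list_of_set P ! j)"
      then have j': "Suc j < card P" using cnt_le_card[OF assms(1)] less_le_trans by blast
      then have "sorted_list_of_set P ! Suc j \<le> sorted_list_of_set P ! j"
        using nth_sorted_list_le_iff[OF assms(1) j'] h by blast
      moreover have "sorted_list_of_set P ! j < sorted_list_of_set P ! Suc j"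
        using j' by (intro sorted_wrt_nth_less[OF strict_sorted_list_of_set]) auto
      ultimately show False by simp
    qed
    ultimately show ?thesis using mem by simp
  qed
  show ?thesis
  proof
    assume "sorted_list_of_set P ! i = a"
    then show "a \<in> P \<and> cnt P a = Suc i" using 1[OF assms(2)] by blast
  next
    assume a: "a \<in> P \<and> cnt P a = Suc i"
    then obtain j where "j < card P" "sorted_list_of_set P ! j = a"
      using assms(1) by (metis in_set_conv_nth length_sorted_list_of_set set_sorted_list_of_set)
    then show "sorted_list_of_set P ! i = a" using 1[of j] a by auto
  qed
qed

lemma card_atLeast:
  assumes "finite D" "d \<in> D"
  shows "card (D \<inter> {d..}) + cnt D d = Suc (card D)"
proof -
  have "D \<inter> {d..} = insert d (D \<inter> {d<..})" using assms by auto
  then have "card (D \<inter> {d..}) = Suc (card (D \<inter> {d<..}))" using assms by simp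
  then show ?thesis using cnt_upper[OF assms(1), of d] by simp
qed

lemma length_letters: "length (letters (Col h st A k D)) = card A + k + card D"
  by (simp add: letters_def)

lemma letters_nth:
  fixes h :: nat and st :: "nat option"
  assumes "finite A" "finite D" "i < card A + k + card D"
  defines "x \<equiv> letters (Col h st A k D) ! i"
  shows "x = Unbarred a \<longleftrightarrow> a \<in> A \<and> cnt A a = Suc i"
    "x = Zero \<longleftrightarrow> card A \<le> i \<and> i < card A + k"
    "x = Barred d \<longleftrightarrow> d \<in> D \<and> card A + k + card (D \<inter> {d..}) = Suc i"
proof -
  have le: "a \<in> A \<Longrightarrow> cnt A a \<le> card A" using cnt_le_card[OF assms(1)] .
  have pos: "d \<in> D \<Longrightarrow> 0 < card (D \<inter> {d..})" using assms(2) by (auto simp: card_gt_0_iff)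
  consider "i < card A" | "card A \<le> i" "i < card A + k" | q where "i = card A + k + q" "q < card D"
    using assms(3) by (metis add_less_cancel_left le_add_diff_inverse not_le)
  then have "(x = Unbarred a \<longleftrightarrow> a \<in> A \<and> cnt A a = Suc i) \<and>
    (x = Zero \<longleftrightarrow> card A \<le> i \<and> i < card A + k) \<and>
    (x = Barred d \<longleftrightarrow> d \<in> D \<and> card A + k + card (D \<inter> {d..}) = Suc i)"
  proof cases
    case 1
    have "x = Unbarred (sorted_list_of_set A ! i)" unfolding x_def letters_def using 1 by (simp add: nth_append)
    then show ?thesis using 1 nth_sorted_list_eq_iff[OF assms(1) 1, of a] pos by auto
  next
    case 2
    have "x = Zero" unfolding x_def letters_def using 2 by (auto simp: nth_append)
    then show ?thesis using 2 le pos by auto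
  next
    case 3
    have "x = Barred (rev (sorted_list_of_set D) ! q)"
      unfolding x_def letters_def using 3 by (simp add: nth_append)
    then have x: "x = Barred (sorted_list_of_set D ! (card D - Suc q))"
      using 3 by (simp add: rev_nth)
    have "x = Barred d \<longleftrightarrow> d \<in> D \<and> cnt D d = Suc (card D - Suc q)"
      unfolding x using nth_sorted_list_eq_iff[OF assms(2), of "card D - Suc q" d] 3 by auto
    also have "\<dots> \<longleftrightarrow> d \<in> D \<and> card (D \<inter> {d..}) = Suc q"
      using card_atLeast[OF assms(2), of d] 3 by auto
    finally show ?thesis using 3 x le by auto
  qed
  then show "x = Unbarred a \<longleftrightarrow> a \<in> A \<and> cnt A a = Suc i"
    "x = Zero \<longleftrightarrow> card A \<le> i \<and> i < card A + k"
    "x = Barred d \<longleftrightarrow> d \<in> D \<and> card A + k + card (D \<inter> {d..}) = Suc i" by blast+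
qed

lemma height_None: "height (Col h None A k D) = h + card A + k + card D"
  by (simp add: height_def column_boxes_def length_letters)

lemma height_Some: "height (Col h (Some s) A k D) = Suc (h + card A + k + card D)"
  by (simp add: height_def column_boxes_def length_letters Let_def)

lemma entry_None:
  "entry (Col h None A k D) i = (if h < i \<and> i \<le> h + card A + k + card D
     then Some (letters (Col h None A k D) ! (i - Suc h)) else None)"
  unfolding entry_def height_None by (auto simp: column_boxes_def nth_append length_letters)

text \<open>Moves the entry beneath the star to a column without star, where rows are found by
  counting.\<close>

lemma entry_below_star:
  assumes "h < s" "s \<le> Suc (h + card A + k + card D)"
  shows "entry (Col h (Some s) A k D) (Suc s) = entry (Col h None A k D) s"
proof -
  have l: "letters (Col h (Some s) A k D) = letters (Col h None A k D)" by (simp add: letters_def)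
  show ?thesis
    unfolding entry_None
    using assms by (auto simp: entry_def height_Some column_boxes_def Let_def nth_append
        length_letters nth_Cons' l min_def)
qed

lemma entry_star_top:
  assumes "1 \<le> s"
  shows "entry (Col (s - 1) (Some s) A k D) i = entry (Col s None A k D) i"
proof -
  have l: "letters (Col (s - Suc 0) (Some s) A k D) = letters (Col s None A k D)" by (simp add: letters_def)
  show ?thesis
    unfolding entry_None
    using assms by (auto simp: entry_def height_Some column_boxes_def Let_def nth_append
        length_letters nth_Cons' l)
qed

text \<open>A letter stands in the row given by the number of boxes up to and including its own, so
  statements about rows become equations between cardinalities. Barred letters are counted by
  \<open>{d..}\<close> because the bar reverses the order.\<close>

lemma entry_iff:
  assumes "finite A" "finite D"
  shows "entry (Col h None A k D) i = Some (Unbarred a) \<longleftrightarrow> a \<in> A \<and> i = h + cnt A a"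
    "entry (Col h None A k D) i = Some Zero \<longleftrightarrow> h + card A < i \<and> i \<le> h + card A + k"
    "entry (Col h None A k D) i = Some (Barred d) \<longleftrightarrow>
      d \<in> D \<and> i = h + card A + k + card (D \<inter> {d..})"
    "entry (Col h None A k D) i = None \<longleftrightarrow> \<not> (h < i \<and> i \<le> h + card A + k + card D)"
proof -
  have pA: "0 < cnt A a \<and> cnt A a \<le> card A" if "a \<in> A" using that cnt_pos cnt_le_card[OF assms(1)] by blast
  have pD: "0 < card (D \<inter> {d..}) \<and> card (D \<inter> {d..}) \<le> card D" if "d \<in> D"
    using that assms(2) by (auto simp: card_gt_0_iff intro: card_mono)
  show "entry (Col h None A k D) i = Some (Unbarred a) \<longleftrightarrow> a \<in> A \<and> i = h + cnt A a"
  proof (cases "h < i \<and> i \<le> h + card A + k + card D")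
    case True
    then have "i - Suc h < card A + k + card D" by auto
    then show ?thesis using True letters_nth(1)[OF assms, of "i - Suc h" k h None a]
      unfolding entry_None by auto
  next
    case False
    then show ?thesis unfolding entry_None using pA by auto
  qed
  show "entry (Col h None A k D) i = Some Zero \<longleftrightarrow> h + card A < i \<and> i \<le> h + card A + k"
  proof (cases "h < i \<and> i \<le> h + card A + k + card D")
    case True
    then have "i - Suc h < card A + k + card D" by auto
    then show ?thesis using True letters_nth(2)[OF assms, of "i - Suc h" k h None]
      unfolding entry_None by auto
  next
    case False
    then show ?thesis unfolding entry_None by auto
  qed
  show "entry (Col h None A k D) i = Some (Barred d) \<longleftrightarrow>
      d \<in> D \<and> i = h + card A + k + card (D \<inter> {d..})"
  proof (cases "h < i \<and> i \<le> h + card A + k + card D")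
    case True
    then have "i - Suc h < card A + k + card D" by auto
    then show ?thesis using True letters_nth(3)[OF assms, of "i - Suc h" k h None d]
      unfolding entry_None by auto
  next
    case False
    then show ?thesis unfolding entry_None using pD by auto
  qed
  show "entry (Col h None A k D) i = None \<longleftrightarrow> \<not> (h < i \<and> i \<le> h + card A + k + card D)"
    unfolding entry_None by auto
qed

lemma less_letter_simps [simp]:
  "Unbarred a < Unbarred b \<longleftrightarrow> a < b" "Unbarred a < Zero" "Unbarred a < Barred b"
  "\<not> Zero < Unbarred b" "Zero < Barred b" "\<not> Barred a < Unbarred b" "\<not> Barred a < Zero"
  "Barred a < Barred b \<longleftrightarrow> b < a"
  by (auto simp: less_letter_def)

text \<open>The letters not exceeding \<open>a\<close> fill the rows \<open>h + 1\<close> to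
  \<open>h + cnt A a\<close>. A missing entry counts as larger, as in the rightward rules of
  \<open>sjdt_step\<close>.\<close>

lemma entry_greater_Unbarred:
  assumes "finite A" "finite D" "h < i"
  shows "(\<forall>q. entry (Col h None A k D) i = Some q \<longrightarrow> Unbarred a < q) \<longleftrightarrow> h + cnt A a < i"
proof (cases "entry (Col h None A k D) i")
  case None
  then show ?thesis using entry_iff(4)[OF assms(1,2), of h k i] cnt_le_card[OF assms(1), of a] assms(3) by auto
next
  case (Some q)
  show ?thesis
  proof (cases q)
    case (Unbarred u)
    then have u: "u \<in> A" "i = h + cnt A u" using Some entry_iff(1)[OF assms(1,2)] by auto
    have "a < u \<longleftrightarrow> cnt A a < cnt A u"
    proof
      assume "a < u"
      moreover have "A \<inter> {a<..u} \<noteq> {}" using u calculation by auto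
      ultimately show "cnt A a < cnt A u"
        using cnt_gap[of a u A] cnt_mono[of A A a u] by auto
    next
      assume "cnt A a < cnt A u"
      then show "a < u" using cnt_mono[of A A u a] by (auto simp: not_le[symmetric])
    qed
    then show ?thesis using Some Unbarred u by auto
  next
    case Zero
    then show ?thesis using Some entry_iff(2)[OF assms(1,2)] cnt_le_card[OF assms(1), of a]
      by (metis less_letter_simps(2) le_less_trans add_left_mono option.inject)
  next
    case (Barred d)
    then have "i = h + card A + k + card (D \<inter> {d..})" "d \<in> D" using Some entry_iff(3)[OF assms(1,2)] by auto
    moreover have "0 < card (D \<inter> {d..})" using calculation assms(2) by (auto simp: card_gt_0_iff)
    ultimately show ?thesis using Some Barred cnt_le_card[OF assms(1), of a] by auto
  qed
qed

lemma entry_greater_Barred: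
  assumes "finite A" "finite D" "h < i"
  shows "(\<forall>q. entry (Col h None A k D) i = Some q \<longrightarrow> Barred c < q) \<longleftrightarrow>
    h + card A + k + card (D \<inter> {c..}) < i"
proof (cases "entry (Col h None A k D) i")
  case None
  moreover have "card (D \<inter> {c..}) \<le> card D" using assms by (auto intro: card_mono)
  ultimately show ?thesis using entry_iff(4)[OF assms(1,2), of h k i] assms(3) by auto
next
  case (Some q)
  show ?thesis
  proof (cases q)
    case (Unbarred u)
    then have u: "u \<in> A" "i = h + cnt A u" using Some entry_iff(1)[OF assms(1,2)] by auto
    then show ?thesis using Some Unbarred cnt_le_card[OF assms(1), of u] by auto
  next
    case Zero
    then have "i \<le> h + card A + k" using Some entry_iff(2)[OF assms(1,2)] by auto
    then have "\<not> h + card A + k + card (D \<inter> {c..}) < i" by simp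
    moreover have "\<not> Barred c < q" using Zero by simp
    ultimately show ?thesis using Some by blast
  next
    case (Barred d)
    then have d: "i = h + card A + k + card (D \<inter> {d..})" "d \<in> D" using Some entry_iff(3)[OF assms(1,2)] by auto
    have "d < c \<longleftrightarrow> card (D \<inter> {c..}) < card (D \<inter> {d..})"
    proof
      assume "d < c"
      then have "D \<inter> {c..} \<subseteq> D \<inter> {d..}" "d \<in> D \<inter> {d..}" "d \<notin> D \<inter> {c..}"
        using d by auto
      then have "D \<inter> {c..} \<subset> D \<inter> {d..}" by blast
      then show "card (D \<inter> {c..}) < card (D \<inter> {d..})" using assms by (intro psubset_card_mono) auto
    next
      assume l: "card (D \<inter> {c..}) < card (D \<inter> {d..})"
      show "d < c"
      proof (rule ccontr)
        assume "\<not> d < c"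
        then have "D \<inter> {d..} \<subseteq> D \<inter> {c..}" by auto
        then have "card (D \<inter> {d..}) \<le> card (D \<inter> {c..})" using assms by (intro card_mono) auto
        then show False using l by simp
      qed
    qed
    then show ?thesis using Some Barred d by auto
  qed
qed

section \<open>Horizontal steps of \<open>sjdt\<close>\<close>

lemma matched_sym: "matched n A D J \<Longrightarrow> matched n D A J"
  unfolding matched_def by (simp add: Int_commute Un_commute)

text \<open>Covers both shapes of a column met during the slides: disjoint parts for
  \<open>u = v\<close>, a single doubled \<open>u\<close> with partner \<open>v\<close> for
  \<open>u < v\<close>. The \<open>f\<close> and the \<open>g\<close> description are needed
  together, since a column written by one star in one of them is read by the other star in the
  other.\<close>

lemma matched_bump:
  assumes "P \<subseteq> {1..n}" "Q \<subseteq> {1..n}" "P \<inter> Q = {}" "u \<in> {1..n}" "v \<in> {1..n}"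
    "u \<notin> P" "v \<notin> P" "u = v \<and> v \<notin> Q \<or> u < v \<and> u \<notin> Q \<and> v \<in> Q" "{u<..<v} \<subseteq> P \<union> Q"
  obtains J where "matched n (insert u P) (insert u Q - {v}) J"
    "insert u P - (insert u Q - {v}) \<union> J = insert v P"
    "(insert u Q - {v}) - insert u P \<union> J = Q"
proof (cases "u = v")
  case True
  have "matched n (insert u P) (insert u Q - {v}) {}"
    by (rule matched_disjoint) (use assms True in auto)
  then show ?thesis by (rule that) (use assms True in auto)
next
  case False
  then have e: "insert u Q - {v} = insert u (Q - {v})" by auto
  have "matched n (insert u P) (insert u (Q - {v})) {v}"
    by (rule matched_single) (use assms False in auto)
  then have "matched n (insert u P) (insert u Q - {v}) {v}" using e by simp
  then show ?thesis by (rule that) (use assms False in auto)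
qed

lemma symplectic_column:
  fixes h :: nat and st :: "nat option"
  assumes "matched n A D J"
  defines "c \<equiv> Col h st A 0 D"
  shows "semistd n c" "setB n c = (A - D) \<union> J" "setC n c = (D - A) \<union> J"
    "dleft n c = Col h st A 0 ((D - A) \<union> J)" "dright n c = Col h st ((A - D) \<union> J) 0 D"
proof -
  have "doubled n A D J {}" using assms(1) unfolding doubled_def topmost_def by simp
  from doubled_column[OF this, of h st]
  show "semistd n c" "setB n c = (A - D) \<union> J" "setC n c = (D - A) \<union> J"
    "dleft n c = Col h st A 0 ((D - A) \<union> J)" "dright n c = Col h st ((A - D) \<union> J) 0 D"
    unfolding c_def by simp_all
qed

lemma disjoint_column:
  fixes h :: nat and st :: "nat option"
  assumes "P \<subseteq> {1..n}" "Q \<subseteq> {1..n}" "P \<inter> Q = {}"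
  defines "c \<equiv> Col h st P 0 Q"
  shows "semistd n c" "setB n c = P" "setC n c = Q" "dleft n c = c" "dright n c = c"
proof -
  have e: "P - Q \<union> {} = P" "Q - P \<union> {} = Q" using assms by auto
  from symplectic_column[OF matched_disjoint[OF assms(1-3)], of h st, unfolded e]
  show "semistd n c" "setB n c = P" "setC n c = Q" "dleft n c = c" "dright n c = c"
    unfolding c_def by simp_all
qed

text \<open>The two rightward rules of \<open>sjdt_step\<close>, restricted to the columns they change.\<close>

definition hstep :: "nat \<Rightarrow> nat \<Rightarrow> col \<Rightarrow> col \<Rightarrow> col \<Rightarrow> col \<Rightarrow> bool" where
  "hstep n s c d c1 d1 \<longleftrightarrow>
    (\<exists>a h B C h' A' D'. entry (dleft n d) s = Some (Unbarred a) \<and>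
       (\<forall>q. entry (dright n c) (Suc s) = Some q \<longrightarrow> Unbarred a < q) \<and>
       is_g n c h (Some s) B 0 C \<and> is_f n d h' None A' 0 D' \<and>
       is_g n c1 h None (B \<union> {a}) 0 C \<and> is_f n d1 h' (Some s) (A' - {a}) 0 D') \<or>
    (\<exists>b h A D h' B' C'. entry (dleft n d) s = Some (Barred b) \<and>
       (\<forall>q. entry (dright n c) (Suc s) = Some q \<longrightarrow> Barred b < q) \<and>
       is_f n c h (Some s) A 0 D \<and> is_g n d h' None B' 0 C' \<and>
       is_f n c1 h None A 0 (D \<union> {b}) \<and> is_g n d1 h' (Some s) B' 0 (C' - {b}))"

text \<open>\<open>s = h' + cnt A' a\<close> says that \<open>a\<close> faces the star in row
  \<open>s\<close>, and \<open>h + cnt P a < s\<close> that whatever stands below the star exceeds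
  \<open>a\<close>. The receiving column has disjoint parts, hence is its own double.\<close>

lemma hstep_Unbarred:
  assumes P: "P \<subseteq> {1..n}" "Q \<subseteq> {1..n}" "P \<inter> Q = {}"
    and d: "matched n A' D' J'" "a \<in> A'" "s = h' + cnt A' a"
    and s: "h < s" "h + cnt P a < s" "s \<le> Suc (h + card P + card Q)"
    and c1: "matched n A1 D1 J1" "A1 - D1 \<union> J1 = insert a P" "D1 - A1 \<union> J1 = Q"
    and d1: "A2 = A' - {a}" "A2 \<inter> D' = {}"
  shows "hstep n s (Col h (Some s) P 0 Q) (Col h' None A' 0 D')
    (Col h None A1 0 D1) (Col h' (Some s) A2 0 D')"
proof -
  note c = disjoint_column[OF P, of h "Some s"]
  note fin = finite_matched[OF d(1)]
  have fP: "finite P" "finite Q" using P by (meson finite_atLeastAtMost finite_subset)+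
  have AD: "A2 \<subseteq> {1..n}" "D' \<subseteq> {1..n}" using d(1) d1 unfolding matched_def by auto
  have e1: "entry (dleft n (Col h' None A' 0 D')) s = Some (Unbarred a)"
    unfolding symplectic_column(4)[OF d(1)] using fin d(2,3) by (subst entry_iff(1)) auto
  have e2: "\<forall>q. entry (dright n (Col h (Some s) P 0 Q)) (Suc s) = Some q \<longrightarrow> Unbarred a < q"
    unfolding c(5) using entry_below_star[of h s P 0 Q] s
      entry_greater_Unbarred[OF fP s(1), of 0 a] by simp
  have "is_g n (Col h (Some s) P 0 Q) h (Some s) P 0 Q" "is_f n (Col h' None A' 0 D') h' None A' 0 D'"
    "is_g n (Col h None A1 0 D1) h None (P \<union> {a}) 0 Q"
    "is_f n (Col h' (Some s) A2 0 D') h' (Some s) (A' - {a}) 0 D'"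
    unfolding is_g_def is_f_def d1(1)[symmetric]
    using c symplectic_column(1)[OF d(1)] symplectic_column(1-3)[OF c1(1)] c1(2,3)
      disjoint_column(1)[OF AD d1(2)] by simp_all
  then show ?thesis unfolding hstep_def using e1 e2 by blast
qed

text \<open>Compared with the unbarred rule the descriptions are exchanged: the receiving column is
  changed in its \<open>f\<close> form, the one losing \<open>b\<close> in its \<open>g\<close>
  form.\<close>

lemma hstep_Barred:
  assumes P: "P \<subseteq> {1..n}" "Q \<subseteq> {1..n}" "P \<inter> Q = {}"
    and d: "matched n A' D' J'" "A' - D' \<union> J' = B'" "D' - A' \<union> J' = C'" "b \<in> C'"
      "s = h' + card A' + card (C' \<inter> {b..})"
    and s: "h < s" "h + card P + card (Q \<inter> {b..}) < s" "s \<le> Suc (h + card P + card Q)"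
    and c1: "matched n P D1 J1" "D1 = insert b Q"
    and d1: "C2 = C' - {b}" "B' \<inter> C2 = {}"
  shows "hstep n s (Col h (Some s) P 0 Q) (Col h' None A' 0 D')
    (Col h None P 0 D1) (Col h' (Some s) B' 0 C2)"
proof -
  note c = disjoint_column[OF P, of h "Some s"]
  note fin = finite_matched[OF d(1)]
  have fP: "finite P" "finite Q" using P by (meson finite_atLeastAtMost finite_subset)+
  have BC: "B' \<subseteq> {1..n}" "C2 \<subseteq> {1..n}"
    using d(1-3) d1 unfolding matched_def by auto
  have e1: "entry (dleft n (Col h' None A' 0 D')) s = Some (Barred b)"
    unfolding symplectic_column(4)[OF d(1)] d(3) using fin d(3-5)
    by (subst entry_iff(3)) auto
  have e2: "\<forall>q. entry (dright n (Col h (Some s) P 0 Q)) (Suc s) = Some q \<longrightarrow> Barred b < q"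
    unfolding c(5) using entry_below_star[of h s P 0 Q] s
      entry_greater_Barred[OF fP s(1), of 0 b] by simp
  have "is_f n (Col h (Some s) P 0 Q) h (Some s) P 0 Q" "is_g n (Col h' None A' 0 D') h' None B' 0 C'"
    "is_f n (Col h None P 0 D1) h None P 0 (Q \<union> {b})"
    "is_g n (Col h' (Some s) B' 0 C2) h' (Some s) B' 0 (C' - {b})"
    unfolding is_g_def is_f_def d1(1)[symmetric]
    using c(1) symplectic_column(1-3)[OF d(1)] d(2,3) symplectic_column(1)[OF c1(1)] c1(2)
      disjoint_column(1-3)[OF BC d1(2)] by simp_all
  then show ?thesis unfolding hstep_def using e1 e2 by blast
qed

section \<open>Determinism of the slides\<close>

lemma is_g_unique:
  assumes "is_g n c1 h st B k C" "is_g n c2 h st B k C"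
  shows "c1 = c2"
proof -
  have "setA c1 = setA c2 \<and> setD c1 = setD c2 \<and> setJ n c1 = setJ n c2"
  proof (rule matched_unique)
    show "matched n (setA c1) (setD c1) (setJ n c1)" "matched n (setA c2) (setD c2) (setJ n c2)"
      using assms semistd_doubled(1) unfolding is_g_def doubled_def by blast+
    show "setA c1 - setD c1 \<union> setJ n c1 = setA c2 - setD c2 \<union> setJ n c2"
      "setD c1 - setA c1 \<union> setJ n c1 = setD c2 - setA c2 \<union> setJ n c2"
      using assms unfolding is_g_def setB_def setC_def setI_def by auto
  qed
  then show ?thesis using assms unfolding is_g_def by (cases c1; cases c2) auto
qed

lemma is_f_unique: "is_f n c1 h st A k D \<Longrightarrow> is_f n c2 h st A k D \<Longrightarrow> c1 = c2"
  unfolding is_f_def by (cases c1; cases c2) auto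

text \<open>\<open>down\<close> requires \<open>q \<le> r\<close> and the other rules
  \<open>q > r\<close>; the latter are told apart by the bar of \<open>r\<close>. Their new columns
  are specified only through \<open>is_f\<close> and \<open>is_g\<close>, so the uniqueness of those
  columns has to be used.\<close>

lemma sjdt_step_deterministic:
  assumes "sjdt_step n st st1" "sjdt_step n st st2"
  shows "st1 = st2"
  using assms(1)
proof cases
  case (down U i j q h A D)
  note d1 = this
  from assms(2) show ?thesis
  proof cases
    case (down U i j q h A D)
    then show ?thesis using d1 by auto
  next
    case (right_unbarred U i j a h B C h' A' D' c1 c2)
    then show ?thesis using d1 by (auto simp: less_le_not_le)
  next
    case (right_barred U i j a h B C h' A' D' c1 c2)
    then show ?thesis using d1 by (auto simp: less_le_not_le)
  qed
next
  case (right_unbarred U i j a h B C h' A' D' c1 c2)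
  note d1 = this
  from assms(2) show ?thesis
  proof cases
    case (down U i j q h A D)
    then show ?thesis using d1 by (auto simp: less_le_not_le)
  next
    case (right_unbarred U' i' j' a' h2 B2 C2 h2' A2' D2' c1' c2')
    then have "c1 = c1'" "c2 = c2'" using d1 is_g_unique[of n c1] is_f_unique[of n c2]
      by (auto simp: is_g_def is_f_def)
    then show ?thesis using right_unbarred d1 by auto
  next
    case (right_barred U i j a h B C h' A' D' c1 c2)
    then show ?thesis using d1 by auto
  qed
next
  case (right_barred U i j a h B C h' A' D' c1 c2)
  note d1 = this
  from assms(2) show ?thesis
  proof cases
    case (down U i j q h A D)
    then show ?thesis using d1 by (auto simp: less_le_not_le)
  next
    case (right_barred U' i' j' a' h2 B2 C2 h2' A2' D2' c1' c2')
    then have "c1 = c1'" "c2 = c2'" using d1 is_g_unique[of n c2] is_f_unique[of n c1]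
      by (auto simp: is_g_def is_f_def)
    then show ?thesis using right_barred d1 by auto
  next
    case (right_unbarred U i j a h B C h' A' D' c1 c2)
    then show ?thesis using d1 by auto
  qed
qed

lemma sjdt_deterministic:
  assumes "sjdt n st sts V" "sjdt n st sts' V'"
  shows "sts = sts' \<and> V = V'"
  using assms
proof (induction arbitrary: sts' V')
  case (delete U i j h A D)
  from delete.prems show ?case
  proof cases
    case (move st' sts)
    \<comment> \<open>A step needs an entry below or beside the star, which deletion
      excludes.\<close>
    from move(2) show ?thesis by cases (use delete in auto)
  qed (use delete in auto)
next
  case (move st st' sts V)
  from move.prems show ?case
  proof cases
    case (delete U i j h A D)
    from move.hyps(1) show ?thesis by cases (use delete in auto)
  next
    case (move st2 sts2)
    then show ?thesis using sjdt_step_deterministic move.hyps(1) move.IH by blast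
  qed
qed

section \<open>Complete slides to the right\<close>

lemma length_dble: "length (dble n U) = 2 * length U"
  by (induction U) (auto simp: dble_def)

lemma nth_dble:
  assumes "1 \<le> j" "j \<le> length U"
  shows "tcol (dble n U) (2 * j - 1) = dleft n (tcol U j)"
    "tcol (dble n U) (2 * j) = dright n (tcol U j)"
proof -
  have "dble n U ! (2 * i) = dleft n (U ! i) \<and> dble n U ! Suc (2 * i) = dright n (U ! i)"
    if "i < length U" for i
    using that
  proof (induction U arbitrary: i)
    case (Cons c U)
    then show ?case by (cases i) (auto simp: dble_def)
  qed simp
  from this[of "j - 1"] assms
  show "tcol (dble n U) (2 * j - 1) = dleft n (tcol U j)"
    "tcol (dble n U) (2 * j) = dright n (tcol U j)"
    by (cases j; simp)+
qed

lemma tentry_dble: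
  assumes "1 \<le> j" "j \<le> length U"
  shows "tentry (dble n U) i (2 * j - 1) = entry (dleft n (tcol U j)) i"
    "tentry (dble n U) i (2 * j) = entry (dright n (tcol U j)) i"
  unfolding tentry_def length_dble nth_dble[OF assms] using assms by auto

lemma hstep_sjdt_step:
  assumes "hstep n s (tcol U j) (tcol U (Suc j)) c d" "1 \<le> j" "Suc j \<le> length U"
  shows "sjdt_step n (U, s, j) (U[j - 1 := c, j := d], s, Suc j)"
proof -
  have be: "beside n (U, s, j) = entry (dleft n (tcol U (Suc j))) s"
    unfolding beside_def using tentry_dble(1)[of "Suc j" U n s] assms by simp
  have bl: "below n (U, s, j) = entry (dright n (tcol U j)) (Suc s)"
    unfolding below_def using tentry_dble(2)[of "j" U n "Suc s"] assms by simp
  from assms(1) show ?thesis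
    unfolding hstep_def
  proof (elim disjE exE conjE)
    fix a h B C h' A' D'
    assume a: "entry (dleft n (tcol U (Suc j))) s = Some (Unbarred a)"
      "\<forall>q. entry (dright n (tcol U j)) (Suc s) = Some q \<longrightarrow> Unbarred a < q"
      "is_g n (tcol U j) h (Some s) B 0 C" "is_f n (tcol U (Suc j)) h' None A' 0 D'"
      "is_g n c h None (B \<union> {a}) 0 C" "is_f n d h' (Some s) (A' - {a}) 0 D'"
    show ?thesis
      using sjdt_step.right_unbarred[of n U s j a h B C h' A' D' c d] a be bl by simp
  next
    fix a h B C h' A' D'
    assume a: "entry (dleft n (tcol U (Suc j))) s = Some (Barred a)"
      "\<forall>q. entry (dright n (tcol U j)) (Suc s) = Some q \<longrightarrow> Barred a < q"
      "is_f n (tcol U j) h (Some s) B 0 C" "is_g n (tcol U (Suc j)) h' None A' 0 D'"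
      "is_f n c h None B 0 (C \<union> {a})" "is_g n d h' (Some s) A' 0 (D' - {a})"
    show ?thesis
      using sjdt_step.right_barred[of n U s j a h B C h' A' D' c d] a be bl by simp
  qed
qed

text \<open>The snapshot with the star in column \<open>k\<close>: the columns \<open>New\<close>
  have been left behind, the columns \<open>Old\<close> lie ahead. One formula for all times lets
  successive states be compared column by column.\<close>

definition slide_tableau ::
  "nat \<Rightarrow> nat \<Rightarrow> (nat \<Rightarrow> col) \<Rightarrow> (nat \<Rightarrow> col) \<Rightarrow> (nat \<Rightarrow> col) \<Rightarrow> nat \<Rightarrow> tableau" where
  "slide_tableau N a Old St New k =
     map (\<lambda>i. if a \<le> i \<and> i < k then New i else if i = k then St i else Old i) [1..<Suc N]"

lemma length_slide [simp]: "length (slide_tableau N a Old St New k) = N"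
  by (simp add: slide_tableau_def)

lemma nth_slide:
  assumes "1 \<le> i" "i \<le> N"
  shows "tcol (slide_tableau N a Old St New k) i =
    (if a \<le> i \<and> i < k then New i else if i = k then St i else Old i)"
  using assms unfolding slide_tableau_def by (simp del: upt_Suc)

definition unstar :: "col \<Rightarrow> col" where
  "unstar c = Col (empties c) None (setA c) (zeros c) (setD c)"

text \<open>The induction runs backwards from column \<open>b\<close>, because \<open>sjdt\<close>
  is generated from the final deletion. In column \<open>b\<close> nothing is below or beside the
  star, so the slide ends there.\<close>

lemma sjdt_slide:
  assumes a: "1 \<le> a" "a \<le> b" "b \<le> N"
    and step: "\<And>k. a \<le> k \<Longrightarrow> k < b \<Longrightarrow> hstep n s (St k) (Old (Suc k)) (New k) (St (Suc k))"
    and fin: "entry (dright n (St b)) (Suc s) = None"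
      "b < N \<Longrightarrow> entry (dleft n (Old (Suc b))) s = None" "star (St b) = Some s" "zeros (St b) = 0"
  defines "U \<equiv> slide_tableau N a Old St New"
  shows "sjdt n (U a, s, a) (map (\<lambda>k. (U k, s, k)) [a..<Suc b])
    (slide_tableau N a Old (\<lambda>i. unstar (St i)) New b)"
proof -
  let ?V = "slide_tableau N a Old (\<lambda>i. unstar (St i)) New b"
  have "sjdt n (U k, s, k) (map (\<lambda>k. (U k, s, k)) [k..<Suc b]) ?V" if "a \<le> k" "k \<le> b" for k
    using that(2,1)
  proof (induction k rule: inc_induct)
    case base
    have tb: "tcol (U b) b = St b" unfolding U_def using nth_slide[of b N] a by simp
    have "below n (U b, s, b) = None"
      unfolding below_def using tentry_dble(2)[of b "U b" n "Suc s"] tb fin(1) a by (simp add: U_def)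
    moreover have "beside n (U b, s, b) = None"
    proof (cases "b < N")
      case True
      then have "tcol (U b) (Suc b) = Old (Suc b)" unfolding U_def using nth_slide[of "Suc b" N] by simp
      then show ?thesis unfolding beside_def
        using tentry_dble(1)[of "Suc b" "U b" n s] fin(2) True by (simp add: U_def)
    next
      case False
      then show ?thesis using a unfolding beside_def by (simp add: tentry_def length_dble U_def)
    qed
    moreover have "tcol (U b) b = Col (empties (St b)) (Some s) (setA (St b)) 0 (setD (St b))"
      unfolding tb using fin(3,4) by (cases "St b") auto
    ultimately have "sjdt n (U b, s, b) [(U b, s, b)]
      ((U b)[b - 1 := Col (empties (St b)) None (setA (St b)) 0 (setD (St b))])"
      by (rule sjdt.delete)
    moreover have "(U b)[b - 1 := Col (empties (St b)) None (setA (St b)) 0 (setD (St b))] = ?V"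
    proof (rule nth_equalityI)
      fix i assume "i < length ((U b)[b - 1 := Col (empties (St b)) None (setA (St b)) 0 (setD (St b))])"
      then have i: "i < N" by (simp add: U_def)
      then show "(U b)[b - 1 := Col (empties (St b)) None (setA (St b)) 0 (setD (St b))] ! i = ?V ! i"
        using nth_slide[of "Suc i" N a Old _ New b] a fin(4)
        by (auto simp: nth_list_update U_def unstar_def)
    qed (simp add: U_def)
    ultimately show ?case by simp
  next
    case (step k)
    have t: "tcol (U k) k = St k" "tcol (U k) (Suc k) = Old (Suc k)"
      unfolding U_def using nth_slide[of k N] nth_slide[of "Suc k" N] a step.hyps step.prems by auto
    have "hstep n s (tcol (U k) k) (tcol (U k) (Suc k)) (New k) (St (Suc k))"
      unfolding t using assms(4) step.hyps step.prems by simp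
    then have "sjdt_step n (U k, s, k) ((U k)[k - 1 := New k, k := St (Suc k)], s, Suc k)"
      by (rule hstep_sjdt_step) (use a step.hyps step.prems in \<open>auto simp: U_def\<close>)
    moreover have "(U k)[k - 1 := New k, k := St (Suc k)] = U (Suc k)"
    proof (rule nth_equalityI)
      fix i assume "i < length ((U k)[k - 1 := New k, k := St (Suc k)])"
      then have i: "i < N" by (simp add: U_def)
      then show "(U k)[k - 1 := New k, k := St (Suc k)] ! i = U (Suc k) ! i"
        using nth_slide[of "Suc i" N a Old St New k] nth_slide[of "Suc i" N a Old St New "Suc k"]
          a step.hyps step.prems
        by (auto simp: nth_list_update U_def)
    qed (simp add: U_def)
    moreover have "sjdt n (U (Suc k), s, Suc k) (map (\<lambda>k. (U k, s, k)) [Suc k..<Suc b]) ?V"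
      using step by simp
    moreover have "[k..<Suc b] = k # [Suc k..<Suc b]" using step.hyps by (simp add: upt_conv_Cons)
    ultimately show ?case using sjdt.move by simp
  qed
  then show ?thesis using a by simp
qed

section \<open>Elementary moves between two columns\<close>

text \<open>The stars of both halves pass from \<open>X\<close> to \<open>Y\<close>. \<open>M\<close> and \<open>N\<close> are the columns left behind by the
  right star and met later by the left one; \<open>L\<close> and \<open>R\<close> are the columns which hold a star only
  in between.\<close>

definition pair_step ::
  "nat \<Rightarrow> nat \<Rightarrow> col \<Rightarrow> col \<Rightarrow> col \<Rightarrow> col \<Rightarrow> col \<Rightarrow> col \<Rightarrow> col \<Rightarrow> col \<Rightarrow> bool" where
  "pair_step n s X Y X' Y' M L N R \<longleftrightarrow>
     hstep n s (dright n X) (dleft n Y) M L \<and> hstep n s L (dright n Y) N (dright n Y') \<and>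
     hstep n s (dleft n X) M (dleft n X') R \<and> hstep n s R N (dright n X') (dleft n Y')"

text \<open>The memory passed on along the row: when the star arrives in a column, its right half
  has lost the letter of row \<open>s\<close>. The next letter to enter that half is compared with
  the lost one through the rows of the original double.\<close>

definition removed :: "nat \<Rightarrow> nat \<Rightarrow> col \<Rightarrow> col \<Rightarrow> bool" where
  "removed n s Y Y' \<longleftrightarrow>
     (\<exists>b. entry (dright n Y) s = Some (Unbarred b) \<and> setB n Y' = setB n Y - {b} \<and>
        setD Y' \<union> setK n Y' = setD Y \<union> setK n Y) \<or>
     (\<exists>d. entry (dright n Y) s = Some (Barred d) \<and> setB n Y' = setB n Y \<and>
        setD Y' \<union> setK n Y' = setD Y \<union> setK n Y - {d})"

text \<open>The letter pushed into row \<open>s\<close> of the right half fits there, and \<open>x0\<close> (respectively \<open>y0\<close>)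
  guarantees that the pairing of the letters can be repaired afterwards.\<close>

definition fits_unbarred ::
  "nat \<Rightarrow> nat \<Rightarrow> nat \<Rightarrow> nat set \<Rightarrow> nat set \<Rightarrow> nat set \<Rightarrow> nat set \<Rightarrow> nat \<Rightarrow> bool" where
  "fits_unbarred n h s A D J K a \<longleftrightarrow> a \<notin> A - D \<union> J \<and> cnt (A - D \<union> J) a = s - 1 - h \<and>
     (\<exists>x0 \<in> {1..n}. x0 \<le> a \<and> x0 \<notin> (A - D \<union> J) \<union> (D \<union> K) \<and> (A - D \<union> J) \<inter> {x0..a} = {})"

definition fits_barred ::
  "nat \<Rightarrow> nat \<Rightarrow> nat \<Rightarrow> nat set \<Rightarrow> nat set \<Rightarrow> nat set \<Rightarrow> nat set \<Rightarrow> nat \<Rightarrow> bool" where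
  "fits_barred n h s A D J K c \<longleftrightarrow> c \<notin> D \<union> K \<and> h + card A + card ((D \<union> K) \<inter> {c..}) = s - 1 \<and>
     h + card A + card K < s \<and>
     (\<exists>y0 \<in> {1..n}. c \<le> y0 \<and> y0 \<notin> (A - D \<union> J) \<union> (D \<union> K) \<and> (D \<union> K) \<inter> {c..y0} = {})"

text \<open>The last three statements compare the halves: \<open>B\<close> never has more letters up
  to \<open>t\<close> than \<open>A\<close>, and at a letter outside
  \<open>A \<union> D \<union> J\<close>, where nothing waits, equality holds, as it does for
  \<open>C\<close> and \<open>D\<close>. This transfers row positions from the right half to the
  left one.\<close>

lemma doubled_facts:
  assumes "doubled n A D J K"
  shows "matched n A D J" "A \<subseteq> {1..n}" "D \<subseteq> {1..n}" "J \<subseteq> {1..n}" "K \<subseteq> {1..n}"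
    "J \<inter> A = {}" "J \<inter> D = {}" "K \<inter> A = {}" "K \<inter> D = {}" "K \<inter> J = {}"
    "\<And>t. cnt J t \<le> cnt (A \<inter> D) t"
    "\<And>t. t \<in> {1..n} \<Longrightarrow> t \<notin> A \<union> D \<union> J \<Longrightarrow> cnt (A \<inter> D) t = cnt J t"
    "\<And>q w. q \<in> {1..n} \<Longrightarrow> q \<notin> A \<union> D \<union> J \<union> K \<Longrightarrow> w \<in> K \<Longrightarrow> q < w"
    "finite A" "finite D" "finite J" "finite K" "card (A - D \<union> J) = card A" "card (D - A \<union> J) = card D"
    "card (A \<union> K) = card A + card K" "card (D \<union> K) = card D + card K"
    "(A \<union> K) \<inter> (D - A \<union> J) = {}" "(A - D \<union> J) \<inter> (D \<union> K) = {}"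
    "A \<union> K \<subseteq> {1..n}" "D - A \<union> J \<subseteq> {1..n}" "A - D \<union> J \<subseteq> {1..n}" "D \<union> K \<subseteq> {1..n}"
    "\<And>t. cnt (A - D \<union> J) t \<le> cnt A t"
    "\<And>t. t \<in> {1..n} \<Longrightarrow> t \<notin> A \<union> D \<union> J \<Longrightarrow> cnt (A - D \<union> J) t = cnt A t"
    "\<And>t. t \<in> {1..n} \<Longrightarrow> t \<notin> A \<union> D \<union> J \<Longrightarrow> cnt (D - A \<union> J) t = cnt D t"
proof -
  show m: "matched n A D J" using assms unfolding doubled_def by simp
  note m' = m[unfolded matched_def]
  have t: "topmost n (A \<union> D \<union> J) K" using assms unfolding doubled_def by simp
  show s: "A \<subseteq> {1..n}" "D \<subseteq> {1..n}" "J \<subseteq> {1..n}" "K \<subseteq> {1..n}"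
    using m' t unfolding topmost_def by blast+
  show d: "J \<inter> A = {}" "J \<inter> D = {}" "K \<inter> A = {}" "K \<inter> D = {}" "K \<inter> J = {}"
    using m' t unfolding topmost_def by blast+
  show le: "\<And>t. cnt J t \<le> cnt (A \<inter> D) t" using m' by auto
  show eq: "cnt (A \<inter> D) t = cnt J t" if "t \<in> {1..n}" "t \<notin> A \<union> D \<union> J" for t
    using m' that le by (intro antisym) auto
  show "\<And>q w. q \<in> {1..n} \<Longrightarrow> q \<notin> A \<union> D \<union> J \<union> K \<Longrightarrow> w \<in> K \<Longrightarrow> q < w"
    using t unfolding topmost_def by blast
  show f: "finite A" "finite D" "finite J" using finite_matched[OF m] .
  show fK: "finite K" using s(4) by (meson finite_atLeastAtMost finite_subset)
  show "card (A - D \<union> J) = card A" "card (D - A \<union> J) = card D" using card_matched[OF m] by auto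
  show "card (A \<union> K) = card A + card K" "card (D \<union> K) = card D + card K"
    using f fK d by (auto intro!: card_Un_disjoint)
  show "(A \<union> K) \<inter> (D - A \<union> J) = {}" "(A - D \<union> J) \<inter> (D \<union> K) = {}" using d by blast+
  show "A \<union> K \<subseteq> {1..n}" "D - A \<union> J \<subseteq> {1..n}" "A - D \<union> J \<subseteq> {1..n}" "D \<union> K \<subseteq> {1..n}" using s by blast+
  have a: "cnt (A - D \<union> J) t = cnt (A - D) t + cnt J t" for t using d by (intro cnt_Un) auto
  have b: "cnt A t = cnt (A - D) t + cnt (A \<inter> D) t" for t
    by (subst cnt_Un[symmetric]) (auto intro: arg_cong[where f = "\<lambda>S. cnt S t"])
  have c: "cnt (D - A \<union> J) t = cnt (D - A) t + cnt J t" for t using d by (intro cnt_Un) auto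
  have e: "cnt D t = cnt (D - A) t + cnt (A \<inter> D) t" for t
    by (subst cnt_Un[symmetric]) (auto intro: arg_cong[where f = "\<lambda>S. cnt S t"])
  show "\<And>t. cnt (A - D \<union> J) t \<le> cnt A t" unfolding a b using le by simp
  show "\<And>t. t \<in> {1..n} \<Longrightarrow> t \<notin> A \<union> D \<union> J \<Longrightarrow> cnt (A - D \<union> J) t = cnt A t" unfolding a b using eq by simp
  show "\<And>t. t \<in> {1..n} \<Longrightarrow> t \<notin> A \<union> D \<union> J \<Longrightarrow> cnt (D - A \<union> J) t = cnt D t" unfolding c e using eq by simp
qed

text \<open>The letter \<open>a\<close> enters the right half through \<open>g\<close>, so the
  \<open>f\<close> form of the column left behind shows \<open>x\<close>, the largest letter up to
  \<open>a\<close> outside \<open>B \<union> D \<union> K\<close>. The left star finds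
  \<open>x\<close> in row \<open>s\<close> and takes it into the left half. The column supplying
  \<open>a\<close> is left arbitrary, as \<open>x\<close> depends only on \<open>a\<close> and the
  receiving column.\<close>

lemma left_unbarred:
  assumes X: "doubled n A D J K" and h: "h < s"
    and an: "a \<in> {1..n}" and fit: "fits_unbarred n h s A D J K a"
  obtains x where "x \<in> {1..n}" "x \<le> a" "x \<notin> (A - D \<union> J) \<union> (D \<union> K)" "{x<..a} \<subseteq> D \<union> K"
    "(A - D \<union> J) \<inter> {x<..a} = {}"
    "\<forall>A' C' h'. A' \<subseteq> {1..n} \<longrightarrow> C' \<subseteq> {1..n} \<longrightarrow> A' \<inter> C' = {} \<longrightarrow> a \<in> A' \<longrightarrow> s = h' + cnt A' a \<longrightarrow>
       hstep n s (Col h (Some s) (A - D \<union> J) 0 (D \<union> K)) (Col h' None A' 0 C')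
        (Col h None (insert x (A - D \<union> J)) 0 (insert x (D \<union> K) - {a}))
        (Col h' (Some s) (A' - {a}) 0 C')"
    "hstep n s (Col h (Some s) (A \<union> K) 0 (D - A \<union> J))
        (Col h None (insert x (A - D \<union> J)) 0 (insert x (D \<union> K) - {a}))
        (Col h None (insert x (A \<union> K)) 0 (D - A \<union> J))
        (Col h (Some s) (A - D \<union> J) 0 (insert x (D \<union> K) - {a}))"
proof -
  note f = doubled_facts[OF X]
  let ?B = "A - D \<union> J" and ?E = "D \<union> K"
  have a: "a \<in> {1..n}" "a \<notin> ?B" "cnt ?B a = s - 1 - h" using an fit unfolding fits_unbarred_def by blast+
  obtain x0 where x0: "x0 \<in> {1..n}" "x0 \<le> a" "x0 \<notin> ?B \<union> ?E" "?B \<inter> {x0..a} = {}"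
    using fit unfolding fits_unbarred_def by blast
  define x where "x = Max {y \<in> {..a}. y \<notin> ?B \<union> ?E}"
  have xin: "x \<in> {y \<in> {..a}. y \<notin> ?B \<union> ?E}"
    unfolding x_def by (rule Max_in) (use x0 in auto)
  have xmax: "y \<le> x" if "y \<le> a" "y \<notin> ?B \<union> ?E" for y
    unfolding x_def by (rule Max_ge) (use that in auto)
  have x0x: "x0 \<le> x" using xmax x0 by auto
  have x: "x \<in> {1..n}" "x \<le> a" "x \<notin> ?B \<union> ?E" using xin x0x x0(1) a(1) by auto
  have Bx: "?B \<inter> {x<..a} = {}" using x0(4) x0x by auto
  have xE: "{x<..a} \<subseteq> ?E"
  proof
    fix y assume y: "y \<in> {x<..a}"
    then have "y \<in> ?B \<union> ?E" using xmax[of y] by auto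
    then show "y \<in> ?E" using Bx y by blast
  qed
  have cB: "cnt ?B x = s - 1 - h" using cnt_gap[OF x(2), of ?B] Bx a(3) by simp
  have xF: "x \<notin> A \<union> D \<union> J" "x \<notin> K" using x by auto
  \<comment> \<open>A spare letter lies below all of \<open>K\<close>, so \<open>K\<close> does not
    contribute to the row of \<open>x\<close> in the left half.\<close>
  have "x < w" if "w \<in> K" for w using f(13)[OF x(1) _ that] xF by blast
  then have "cnt K x = 0" by (force simp: cnt_zero_iff)
  then have cA: "cnt (A \<union> K) x = s - 1 - h"
    using cB f(29)[OF x(1) xF(1)] cnt_Un[of A K x] f(8) by (simp add: Int_commute)
  obtain J1 where M: "matched n (insert x ?B) (insert x ?E - {a}) J1"
    "insert x ?B - (insert x ?E - {a}) \<union> J1 = insert a ?B" "(insert x ?E - {a}) - insert x ?B \<union> J1 = ?E"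
  proof (rule matched_bump[of ?B n ?E x a])
    show "x = a \<and> a \<notin> ?E \<or> x < a \<and> x \<notin> ?E \<and> a \<in> ?E"
      using x subsetD[OF xE, of a] by (cases "x = a") auto
    have "{x<..<a} \<subseteq> {x<..a}" by auto
    then show "{x<..<a} \<subseteq> ?B \<union> ?E" using xE by blast
    show "?B \<subseteq> {1..n}" "?E \<subseteq> {1..n}" "?B \<inter> ?E = {}" using f(23,26,27) by blast+
    show "x \<in> {1..n}" "a \<in> {1..n}" "x \<notin> ?B" "a \<notin> ?B" using x a by blast+
  qed
  show ?thesis
  proof (rule that[OF x xE Bx], intro allI impI)
    fix A' C' h' assume Y: "A' \<subseteq> {1..n}" "C' \<subseteq> {1..n}" "A' \<inter> C' = {}" "a \<in> A'" "s = h' + cnt A' a"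
    have "cnt ?B a \<le> card ?B" using cnt_le_card[of ?B a] f(14,16) by simp
    then have "s \<le> Suc (h + card ?B + card ?E)" "h + cnt ?B a < s" using a(3) h by linarith+
    moreover have "(A' - {a}) \<inter> C' = {}" using Y(3) by blast
    ultimately show "hstep n s (Col h (Some s) ?B 0 ?E) (Col h' None A' 0 C')
        (Col h None (insert x ?B) 0 (insert x ?E - {a})) (Col h' (Some s) (A' - {a}) 0 C')"
      by (intro hstep_Unbarred[OF f(26,27,23) matched_disjoint[OF Y(1-3)] Y(4,5) h _ _ M refl])
  next
    have xC: "x \<notin> D - A \<union> J" using xF(1) by blast
    have xB: "x \<notin> ?B" using x(3) by blast
    show "hstep n s (Col h (Some s) (A \<union> K) 0 (D - A \<union> J))
        (Col h None (insert x ?B) 0 (insert x ?E - {a}))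
        (Col h None (insert x (A \<union> K)) 0 (D - A \<union> J))
        (Col h (Some s) ?B 0 (insert x ?E - {a}))"
    proof (rule hstep_Unbarred[OF f(24,25,22) M(1) _ _ h])
      show "matched n (insert x (A \<union> K)) (D - A \<union> J) {}"
        by (rule matched_disjoint) (use f(22,24,25) x(1) xC in blast)+
      show "insert x (A \<union> K) - (D - A \<union> J) \<union> {} = insert x (A \<union> K)"
        "(D - A \<union> J) - insert x (A \<union> K) \<union> {} = D - A \<union> J" using f(22) xC by blast+
      show "s = h + cnt (insert x ?B) x" using cB h xB by (simp add: cnt_insert del: Un_iff)
      show "h + cnt (A \<union> K) x < s" using cA h by linarith
      have "cnt (A \<union> K) x \<le> card (A \<union> K)" using cnt_le_card f(14,17) by blast
      then show "s \<le> Suc (h + card (A \<union> K) + card (D - A \<union> J))" using cA by linarith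
      show "?B = insert x ?B - {x}" "?B \<inter> (insert x ?E - {a}) = {}" using xB f(23) by blast+
    qed simp
  qed
qed

text \<open>Both stars bring the same \<open>a\<close> out of \<open>Y\<close>. Inside the double of
  \<open>Y\<close> the right star shifts \<open>b\<close> from the right half to the left one; the
  column \<open>N\<close> obtained shows \<open>b\<close> in its \<open>g\<close> form but
  \<open>a\<close> in its \<open>f\<close> form, so the left star finds \<open>a\<close> again in
  row \<open>s\<close>. \<open>R1'\<close> and \<open>R2\<close> are steps of the right star,
  \<open>L1\<close> and \<open>L2\<close> of the left one.\<close>

lemma pair_unbarred:
  assumes X: "doubled n A D J K" "h < s" "card A + card D + card K < n"
    and Y: "doubled n A' D' J' K'" "h' < s"
    and t: "a \<in> A'" "s = h' + cnt A' a"
    and b: "b \<in> A' - D' \<union> J'" "s = h' + cnt (A' - D' \<union> J') b"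
    and ab: "a \<le> b" and e: "cnt A' b = cnt A' a" "cnt K' b = 0"
    and fit: "fits_unbarred n h s A D J K a"
  defines "X \<equiv> Col h (Some s) A (card K) D" and "Y \<equiv> Col h' None A' (card K') D'"
  shows "\<exists>X' Y' M L N R. pair_step n s X Y X' Y' M L N R \<and> move1 n s a X Y X' Y' \<and> removed n s Y Y'"
proof -
  note fX = doubled_facts[OF X(1)] and fY = doubled_facts[OF Y(1)]
  note cX = doubled_column[OF X(1), of h "Some s", folded X_def]
  note cY = doubled_column[OF Y(1), of h' None, folded Y_def]
  have an: "a \<in> {1..n}" using t(1) fY(2) by blast
  let ?B = "A - D \<union> J" and ?E = "D \<union> K" and ?B' = "A' - D' \<union> J'" and ?C' = "D' - A' \<union> J'"
  have aX: "a \<notin> ?B" "cnt ?B a = s - 1 - h" using fit unfolding fits_unbarred_def by blast+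
  have KA: "cnt (A' \<union> K') b = cnt A' b + cnt K' b" using fY(8) by (intro cnt_Un) auto
  have eB: "cnt ?B' b = cnt A' b" using b(2) t(2) e(1) by linarith
  have gapA: "A' \<inter> {a<..b} = {}" using cnt_gap[OF ab] e(1) by metis
  have K0: "K' \<inter> {..b} = {}" using e(2) by (simp add: cnt_zero_iff)
  obtain J2 where Y2: "doubled n (A' - {a}) D' J2 K'"
    "((A' - {a}) - D') \<union> J2 = ?B' - {b}"
    "(D' - (A' - {a})) \<union> J2 = insert a ?C' - {b}"
    "{a<..<b} \<subseteq> ?C'" "a \<noteq> b \<Longrightarrow> b \<in> J'" "a \<notin> ?C'"
    using doubled_remove_f[OF Y(1) t(1) b(1) ab gapA K0 eB] by metis
  define Y' where "Y' = Col h' (Some s) (A' - {a}) (card K') D'"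
  note cY' = doubled_column[OF Y2(1), of h' "Some s", folded Y'_def]
  obtain x where x: "x \<in> {1..n}" "x \<le> a" "x \<notin> ?B \<union> ?E" "{x<..a} \<subseteq> ?E" "?B \<inter> {x<..a} = {}"
    and R1: "\<forall>A' C' h'. A' \<subseteq> {1..n} \<longrightarrow> C' \<subseteq> {1..n} \<longrightarrow> A' \<inter> C' = {} \<longrightarrow> a \<in> A' \<longrightarrow> s = h' + cnt A' a \<longrightarrow>
       hstep n s (Col h (Some s) ?B 0 ?E) (Col h' None A' 0 C')
        (Col h None (insert x ?B) 0 (insert x ?E - {a}))
        (Col h' (Some s) (A' - {a}) 0 C')"
    and L1: "hstep n s (Col h (Some s) (A \<union> K) 0 (D - A \<union> J))
        (Col h None (insert x ?B) 0 (insert x ?E - {a}))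
        (Col h None (insert x (A \<union> K)) 0 (D - A \<union> J))
        (Col h (Some s) ?B 0 (insert x ?E - {a}))"
    by (rule left_unbarred[OF X(1,2) an fit])
  have s_cnt: "s = h' + cnt (A' \<union> K') a"
    using t(2) cnt_Un[of A' K' a] fY(8) cnt_mono[of K' K' a b] ab e(2) by (simp add: Int_commute)
  have R1': "hstep n s (Col h (Some s) ?B 0 ?E) (Col h' None (A' \<union> K') 0 ?C')
        (Col h None (insert x ?B) 0 (insert x ?E - {a})) (Col h' (Some s) (A' \<union> K' - {a}) 0 ?C')"
    using R1 fY(22,24,25) t(1) s_cnt by blast
  have aK: "a \<notin> K'" using t fY(8) by blast
  obtain JN where N: "matched n (A' \<union> K') (insert a ?C' - {b}) JN"
    "A' \<union> K' - (insert a ?C' - {b}) \<union> JN = insert b (A' \<union> K' - {a})"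
    "(insert a ?C' - {b}) - (A' \<union> K') \<union> JN = ?C'"
  proof (rule matched_bump[of "A' \<union> K' - {a}" n ?C' a b])
    show "a = b \<and> b \<notin> ?C' \<or> a < b \<and> a \<notin> ?C' \<and> b \<in> ?C'" using Y2(5,6) ab by (cases "a = b") auto
    show "b \<notin> A' \<union> K' - {a}" using gapA K0 ab by (cases "a = b") auto
    have i: "insert a (A' \<union> K' - {a}) = A' \<union> K'" using t by auto
    show thesis if "matched n (insert a (A' \<union> K' - {a})) (insert a ?C' - {b}) J"
      "insert a (A' \<union> K' - {a}) - (insert a ?C' - {b}) \<union> J = insert b (A' \<union> K' - {a})"
      "insert a ?C' - {b} - insert a (A' \<union> K' - {a}) \<union> J = ?C'" for J
      using that \<open>\<And>J. matched n (A' \<union> K') (insert a ?C' - {b}) J \<Longrightarrow> _ \<Longrightarrow> _ \<Longrightarrow> thesis\<close>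
      unfolding i by blast
    show "A' \<union> K' - {a} \<subseteq> {1..n}" "?C' \<subseteq> {1..n}" "(A' \<union> K' - {a}) \<inter> ?C' = {}"
      using fY(24,25,22) by blast+
    show "a \<in> {1..n}" "b \<in> {1..n}" "a \<notin> A' \<union> K' - {a}" using an b(1) fY(26) by blast+
    show "{a<..<b} \<subseteq> A' \<union> K' - {a} \<union> ?C'" using Y2(4) by blast
  qed
  have c1: "cnt (A' \<union> K' - {a}) b < s - h'"
    using KA e t ab cnt_pos[of a "A' \<union> K'" b] by (simp add: cnt_remove)
  have R2: "hstep n s (Col h' (Some s) (A' \<union> K' - {a}) 0 ?C') (Col h' None ?B' 0 (D' \<union> K'))
     (Col h' None (A' \<union> K') 0 (insert a ?C' - {b})) (Col h' (Some s) (?B' - {b}) 0 (D' \<union> K'))"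
  proof (rule hstep_Unbarred[OF _ _ _ matched_disjoint[OF fY(26,27,23)] b(1,2) Y(2) _ _ N])
    have "card (A' \<union> K' - {a}) = card (A' \<union> K') - 1" using t by simp
    moreover have "cnt (A' \<union> K') a \<le> card (A' \<union> K')" using cnt_le_card[of "A' \<union> K'"] fY(14,17) by simp
    ultimately show "s \<le> Suc (h' + card (A' \<union> K' - {a}) + card ?C')" using s_cnt by linarith
    show "h' + cnt (A' \<union> K' - {a}) b < s" using c1 by linarith
    show "A' \<union> K' - {a} \<subseteq> {1..n}" "?C' \<subseteq> {1..n}" "(A' \<union> K' - {a}) \<inter> ?C' = {}"
      using fY(24,25,22) by blast+
    show "(?B' - {b}) \<inter> (D' \<union> K') = {}" using fY(23) by blast
  qed simp
  have L2: "hstep n s (Col h (Some s) ?B 0 (insert x ?E - {a})) (Col h' None (A' \<union> K') 0 (insert a ?C' - {b}))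
     (Col h None (insert a ?B) 0 (insert x ?E - {a})) (Col h' (Some s) (A' \<union> K' - {a}) 0 (insert a ?C' - {b}))"
  proof (rule hstep_Unbarred[OF _ _ _ N(1) _ s_cnt X(2)])
    show "matched n (insert a ?B) (insert x ?E - {a}) {}"
      by (rule matched_disjoint) (use fX(22-27) x(1,3) an in blast)+
    have "cnt ?B a \<le> card ?B" using cnt_le_card[of ?B a] fX(14,16) by simp
    then show "s \<le> Suc (h + card ?B + card (insert x ?E - {a}))" using aX(2) by linarith
    show "h + cnt ?B a < s" using aX(2) X(2) by linarith
    show "?B \<subseteq> {1..n}" "insert x ?E - {a} \<subseteq> {1..n}" "?B \<inter> (insert x ?E - {a}) = {}"
      using fX(23,26,27) x(1,3) by blast+
    then show "insert a ?B - (insert x ?E - {a}) \<union> {} = insert a ?B"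
      "insert x ?E - {a} - insert a ?B \<union> {} = insert x ?E - {a}" by blast+
    show "a \<in> A' \<union> K'" using t(1) by blast
    show "(A' \<union> K' - {a}) \<inter> (insert a ?C' - {b}) = {}" using fY(22) by blast
  qed simp
  \<comment> \<open>The left half has received \<open>x\<close> and the right half \<open>a\<close>,
    which is just what inserting \<open>a\<close> into \<open>B\<close> does to a double.\<close>
  obtain A2 D2 JX K2 where X2: "doubled n A2 D2 JX K2" "card K2 = card K" "card A2 = Suc (card A)"
    "A2 \<union> K2 = insert x (A \<union> K)" "(A2 - D2) \<union> JX = insert a ?B"
    "D2 \<union> K2 = insert x ?E - {a}" "(D2 - A2) \<union> JX = D - A \<union> J"
    by (rule doubled_insert_g[OF X(1) an aX(1) x(2,1) _ x(4,5)]) (use x(3) in auto)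
  define X' where "X' = Col h None A2 (card K) D2"
  note cX' = doubled_column[OF X2(1), of h None, unfolded X2(2), folded X'_def]
  have i: "A' - {a} \<union> K' = A' \<union> K' - {a}" using aK by auto
  have "pair_step n s X Y X' Y' (Col h None (insert x ?B) 0 (insert x ?E - {a}))
    (Col h' (Some s) (A' \<union> K' - {a}) 0 ?C') (Col h' None (A' \<union> K') 0 (insert a ?C' - {b}))
    (Col h (Some s) ?B 0 (insert x ?E - {a}))"
    unfolding pair_step_def cX(6,7) cY(6,7) cX'(6,7) cY'(6,7) X2 Y2(2,3) i
    using R1' R2 L1 L2 by blast
  moreover have "move1 n s a X Y X' Y'"
    unfolding move1_def
  proof (intro exI conjI)
    show "is_g n X h (Some s) ?B (card K) (D - A \<union> J)" unfolding is_g_def cX by (simp add: X_def cX(1)[unfolded X_def])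
    show "is_f n Y h' None ((A' - {a}) \<union> {a}) (card K') D'"
      unfolding is_f_def using cY(1) t by (auto simp: Y_def)
    show "is_g n X' h None (?B \<union> {a}) (card K) (D - A \<union> J)"
      unfolding is_g_def cX' X2 using cX'(1) by (simp add: X'_def)
    show "is_f n Y' h' (Some s) (A' - {a}) (card K') D'" unfolding is_f_def using cY'(1) by (simp add: Y'_def)
    show "a \<notin> ?B" "a \<notin> A' - {a}" using aX by auto
    have "cnt ?B a \<le> card A" using cnt_le_card[of ?B a] fX(14,16,18) by simp
    then show "star_among_unbarred X" unfolding star_among_unbarred_def X_def using aX X(2) by simp
    have "cnt A' a \<le> card A'" using cnt_le_card fY(14) by blast
    moreover have "card (A' - {a}) = card A' - 1" using t by simp
    ultimately show "star_among_unbarred Y'" unfolding star_among_unbarred_def Y'_def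
      using t Y(2) by simp
  qed
  moreover have "removed n s Y Y'"
    unfolding removed_def cY cY' Y2
    by (rule disjI1, rule exI[of _ b]) (use b(1,2) fY(14-18) in \<open>simp_all add: entry_iff(1) Y_def Y'_def\<close>)
  ultimately show ?thesis by blast
qed

text \<open>A zero crosses as the letter \<open>n\<close>: unbarred with the right star, barred with
  the left one. Inside the double of \<open>Y\<close> the right star shifts barred \<open>e\<close>,
  where \<open>e\<close> is the least letter of \<open>K'\<close>. The column \<open>N\<close> shows
  \<open>e\<close> among the barred letters of its \<open>f\<close> form and \<open>n\<close> among
  those of its \<open>g\<close> form, which is how barred \<open>n\<close> comes to face the left
  star.\<close>

lemma pair_zero:
  assumes X: "doubled n A D J K" "h < s" "card A + card D + card K < n"
    and Y: "doubled n A' D' J' K'" "h' < s"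
    and t: "K' \<noteq> {}" "s = h' + card A' + card K'"
    and e: "e \<in> D' \<union> K'" "card ((D' \<union> K') \<inter> {e..}) = card K'" "(D' - A' \<union> J') \<inter> {e..} = {}"
    and fit: "fits_unbarred n h s A D J K n"
  defines "X \<equiv> Col h (Some s) A (card K) D" and "Y \<equiv> Col h' None A' (card K') D'"
  shows "\<exists>X' Y' M L N R. pair_step n s X Y X' Y' M L N R \<and> move3 n s X Y X' Y' \<and> removed n s Y Y'"
proof -
  note fX = doubled_facts[OF X(1)] and fY = doubled_facts[OF Y(1)]
  note cX = doubled_column[OF X(1), of h "Some s", folded X_def]
  note cY = doubled_column[OF Y(1), of h' None, folded Y_def]
  let ?B = "A - D \<union> J" and ?E = "D \<union> K" and ?B' = "A' - D' \<union> J'" and ?C' = "D' - A' \<union> J'"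
  have aX: "n \<notin> ?B" "cnt ?B n = s - 1 - h" using fit unfolding fits_unbarred_def by blast+
  have en: "e \<in> {1..n}" using e(1) fY(27) by blast
  then have nn: "n \<in> {1..n}" by simp
  \<comment> \<open>A letter of \<open>D'\<close> from \<open>e\<close> on would be doubled, as
    \<open>C'\<close> has none there; counting then requires a letter of \<open>J'\<close> from
    \<open>e\<close> on as partner, but \<open>J'\<close> is part of \<open>C'\<close>.\<close>
  have D0: "D' \<inter> {e..} = {}"
  proof (rule ccontr)
    assume "D' \<inter> {e..} \<noteq> {}"
    then obtain d where d: "d \<in> D'" "e \<le> d" by blast
    then have dA: "d \<in> A' \<inter> D'" using e(3) by auto
    have e1: "1 \<le> e" using en by simp
    have up: "S \<inter> {e..} = S \<inter> {e - 1<..}" for S :: "nat set" using e1 by auto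
    have J0: "J' \<inter> {e..} = {}" using e(3) by auto
    have "cnt J' (e - 1) = card J'" using cnt_upper[of J' "e - 1"] J0 fY unfolding up by simp
    moreover have "card J' = card (A' \<inter> D')" using fY(1) unfolding matched_def by simp
    moreover have "cnt (A' \<inter> D') (e - 1) + card ((A' \<inter> D') \<inter> {e..}) = card (A' \<inter> D')"
      using cnt_upper[of "A' \<inter> D'" "e - 1"] fY unfolding up by simp
    moreover have "card ((A' \<inter> D') \<inter> {e..}) \<noteq> 0" using dA d fY by auto
    ultimately show False using fY(11)[of "e - 1"] by linarith
  qed
  have "(D' \<union> K') \<inter> {e..} = K' \<inter> {e..}" using D0 by auto
  then have "K' \<inter> {e..} = K'" using card_subset_eq[OF fY(17), of "K' \<inter> {e..}"] e(2) by simp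
  then have Ke: "K' \<subseteq> {e..}" by blast
  have eK: "e \<in> K'" using e(1) D0 by auto
  \<comment> \<open>Any other letter from \<open>e\<close> on would be spare without lying below
    \<open>e\<close>, although \<open>K'\<close> consists of the largest spare letters.\<close>
  have full: "t \<in> A' \<union> K'" if "t \<in> {1..n}" "e \<le> t" for t
  proof (rule ccontr)
    assume "t \<notin> A' \<union> K'"
    then have "t \<notin> A' \<union> D' \<union> J' \<union> K'" using that D0 e(3) by auto
    then show False using fY(13)[OF that(1) _ eK] that by simp
  qed
  have nA: "n \<in> A' \<union> K'" using full[OF nn] en by simp
  have nC: "n \<notin> ?C'" using e(3) en by auto
  have s_cnt: "s = h' + cnt (A' \<union> K') n"
    using t(2) cnt_full[of "A' \<union> K'" n] fY(20,24) by force
  define Y' where "Y' = Col h' (Some s) A' (card (K' - {e})) D'"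
  note Y2 = doubled_remove_zero[OF Y(1) eK Ke]
  note cY' = doubled_column[OF Y2, of h' "Some s", folded Y'_def]
  obtain x where x: "x \<in> {1..n}" "x \<le> n" "x \<notin> ?B \<union> ?E" "{x<..n} \<subseteq> ?E" "?B \<inter> {x<..n} = {}"
    and R1: "\<forall>A' C' h'. A' \<subseteq> {1..n} \<longrightarrow> C' \<subseteq> {1..n} \<longrightarrow> A' \<inter> C' = {} \<longrightarrow> n \<in> A' \<longrightarrow> s = h' + cnt A' n \<longrightarrow>
       hstep n s (Col h (Some s) ?B 0 ?E) (Col h' None A' 0 C')
        (Col h None (insert x ?B) 0 (insert x ?E - {n}))
        (Col h' (Some s) (A' - {n}) 0 C')"
    and L1: "hstep n s (Col h (Some s) (A \<union> K) 0 (D - A \<union> J))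
        (Col h None (insert x ?B) 0 (insert x ?E - {n}))
        (Col h None (insert x (A \<union> K)) 0 (D - A \<union> J))
        (Col h (Some s) ?B 0 (insert x ?E - {n}))"
    by (rule left_unbarred[OF X(1,2) nn fit])
  have R1': "hstep n s (Col h (Some s) ?B 0 ?E) (Col h' None (A' \<union> K') 0 ?C')
        (Col h None (insert x ?B) 0 (insert x ?E - {n})) (Col h' (Some s) (A' \<union> K' - {n}) 0 ?C')"
    using R1 fY(22,24,25) nA s_cnt by blast
  obtain JN where N: "matched n (A' \<union> K' - {n}) (insert e ?C') JN"
    "A' \<union> K' - {n} - insert e ?C' \<union> JN = A' \<union> K' - {e}"
    "insert e ?C' - (A' \<union> K' - {n}) \<union> JN = insert n ?C'"
  proof (rule matched_bump[of ?C' n "A' \<union> K' - {e}" e n])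
    have i: "insert e (A' \<union> K' - {e}) = A' \<union> K'" using eK by auto
    show thesis if "matched n (insert e ?C') (insert e (A' \<union> K' - {e}) - {n}) J"
      "insert e ?C' - (insert e (A' \<union> K' - {e}) - {n}) \<union> J = insert n ?C'"
      "insert e (A' \<union> K' - {e}) - {n} - insert e ?C' \<union> J = A' \<union> K' - {e}" for J
      using that(2,3) matched_sym[OF that(1)]
        \<open>\<And>J. matched n (A' \<union> K' - {n}) (insert e ?C') J \<Longrightarrow> _ \<Longrightarrow> _ \<Longrightarrow> thesis\<close>
      unfolding i by blast
    show "e = n \<and> n \<notin> A' \<union> K' - {e} \<or> e < n \<and> e \<notin> A' \<union> K' - {e} \<and> n \<in> A' \<union> K' - {e}"
      using en nA by (cases "e = n") auto
    show "{e<..<n} \<subseteq> ?C' \<union> (A' \<union> K' - {e})"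
    proof
      fix t assume "t \<in> {e<..<n}"
      then show "t \<in> ?C' \<union> (A' \<union> K' - {e})" using full[of t] en by auto
    qed
    show "?C' \<subseteq> {1..n}" "A' \<union> K' - {e} \<subseteq> {1..n}" "?C' \<inter> (A' \<union> K' - {e}) = {}"
      using fY(24,25,22) by blast+
    show "e \<in> {1..n}" "n \<in> {1..n}" "e \<notin> ?C'" "n \<notin> ?C'" using en nn e(3) nC by auto
  qed
  have cardP: "card (A' \<union> K' - {n}) = card A' + card K' - 1" using nA fY(20) by simp
  have pos: "0 < card K'" using t(1) fY(17) by (simp add: card_gt_0_iff)
  have R2: "hstep n s (Col h' (Some s) (A' \<union> K' - {n}) 0 ?C') (Col h' None ?B' 0 (D' \<union> K'))
     (Col h' None (A' \<union> K' - {n}) 0 (insert e ?C')) (Col h' (Some s) ?B' 0 (D' \<union> K' - {e}))"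
  proof (rule hstep_Barred[OF _ _ _ matched_disjoint[OF fY(26,27,23)] _ _ e(1) _ Y(2) _ _ N(1) refl refl])
    show "s = h' + card ?B' + card ((D' \<union> K') \<inter> {e..})" using fY(18) e(2) t(2) by simp
    show "h' + card (A' \<union> K' - {n}) + card (?C' \<inter> {e..}) < s" using cardP e(3) t(2) pos by simp
    show "s \<le> Suc (h' + card (A' \<union> K' - {n}) + card ?C')" using cardP t(2) pos by simp
    show "A' \<union> K' - {n} \<subseteq> {1..n}" "?C' \<subseteq> {1..n}" "(A' \<union> K' - {n}) \<inter> ?C' = {}"
      using fY(24,25,22) by blast+
    show "?B' - (D' \<union> K') \<union> {} = ?B'" "D' \<union> K' - ?B' \<union> {} = D' \<union> K'"
      "?B' \<inter> (D' \<union> K' - {e}) = {}" using fY(23) by blast+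
  qed
  have xE: "insert n (insert x ?E - {n}) = insert x ?E" using x subsetD[OF x(4), of n] by (cases "x = n") auto
  have cB: "card ?B = s - 1 - h" using aX cnt_full[of ?B n] fX(26) by force
  have L2: "hstep n s (Col h (Some s) ?B 0 (insert x ?E - {n})) (Col h' None (A' \<union> K' - {n}) 0 (insert e ?C'))
     (Col h None ?B 0 (insert x ?E)) (Col h' (Some s) (A' \<union> K' - {e}) 0 ?C')"
  proof (rule hstep_Barred[OF _ _ _ N _ _ X(2)])
    show "s = h' + card (A' \<union> K' - {n}) + card (insert n ?C' \<inter> {n..})"
    proof -
      have q: "insert n ?C' \<inter> {n..} = {n}" using e(3) en by auto
      show ?thesis unfolding q using cardP t(2) pos by simp
    qed
    have "(insert x ?E - {n}) \<inter> {n..} = {}" using x(1) fX(27) by auto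
    then show "h + card ?B + card ((insert x ?E - {n}) \<inter> {n..}) < s" using cB X(2) by simp
    show "matched n ?B (insert x ?E) {}" by (rule matched_disjoint) (use fX(22-27) x(1,3) in blast)+
    show "?B \<subseteq> {1..n}" "insert x ?E - {n} \<subseteq> {1..n}" "?B \<inter> (insert x ?E - {n}) = {}"
      using fX(23,26,27) x(1,3) by blast+
    show "s \<le> Suc (h + card ?B + card (insert x ?E - {n}))" using cB X(2) by linarith
    show "(A' \<union> K' - {e}) \<inter> ?C' = {}" using fY(22) by blast
    show "?C' = insert n ?C' - {n}" using nC by blast
    show "insert x ?E = insert n (insert x ?E - {n})" using xE by simp
  qed simp
  \<comment> \<open>Everything above \<open>x\<close> lies in \<open>D \<union> K\<close>, so
    \<open>x\<close> is the largest spare letter left, the one that an additional zero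
    takes.\<close>
  have xmax: "q \<le> x" if "q \<in> {1..n}" "q \<notin> A \<union> D \<union> J \<union> K" for q
  proof (rule ccontr)
    assume "\<not> q \<le> x"
    then have "q \<in> {x<..n}" using that by simp
    then show False using x(4) that by auto
  qed
  have X2: "doubled n A D J (insert x K)"
    by (rule doubled_insert_zero[OF X(1) x(1) _ xmax]) (use x in auto)
  have cK: "card (insert x K) = Suc (card K)" using x fX by simp
  define X' where "X' = Col h None A (Suc (card K)) D"
  note cX' = doubled_column[OF X2(1), of h None, unfolded cK, folded X'_def]
  have i: "A' \<union> (K' - {e}) = A' \<union> K' - {e}" "D' \<union> (K' - {e}) = D' \<union> K' - {e}"
    "A \<union> insert x K = insert x (A \<union> K)" "D \<union> insert x K = insert x ?E" using eK fY(8,9) by auto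
  have "pair_step n s X Y X' Y' (Col h None (insert x ?B) 0 (insert x ?E - {n}))
    (Col h' (Some s) (A' \<union> K' - {n}) 0 ?C') (Col h' None (A' \<union> K' - {n}) 0 (insert e ?C'))
    (Col h (Some s) ?B 0 (insert x ?E - {n}))"
    unfolding pair_step_def cX(6,7) cY(6,7) cX'(6,7) cY'(6,7) i
    using R1' R2 L1 L2 by blast
  moreover have "move3 n s X Y X' Y'"
    unfolding move3_def
  proof (intro exI conjI)
    have k: "card (K' - {e}) + 1 = card K'" using eK fY(17) pos by simp
    show "is_f n X h (Some s) A (card K) D" unfolding is_f_def using cX(1) by (simp add: X_def)
    show "is_g n Y h' None ?B' (card (K' - {e}) + 1) ?C'" unfolding is_g_def cY k using cY(1) by (simp add: Y_def)
    show "is_f n X' h None A (card K + 1) D" unfolding is_f_def using cX'(1) by (simp add: X'_def)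
    show "is_g n Y' h' (Some s) ?B' (card (K' - {e})) ?C'" unfolding is_g_def cY' using cY'(1) by (simp add: Y'_def)
    show "star_among_zeros X" unfolding star_among_zeros_def X_def using cB fX(18) X(2) by simp
    show "star_among_zeros Y'" unfolding star_among_zeros_def Y'_def using t(2) k pos by simp
  qed
  moreover have "removed n s Y Y'"
    unfolding removed_def cY cY'
    by (rule disjI2, rule exI[of _ e]) (use e(1,2) fY(14-18) t(2) i in \<open>simp_all add: entry_iff(3) Y_def Y'_def\<close>)
  ultimately show ?thesis by blast
qed

text \<open>\<open>c\<close> enters the right half of \<open>X\<close> through \<open>f\<close>, and
  the \<open>g\<close> form of the result shows \<open>y\<close>, the least letter from
  \<open>c\<close> on outside \<open>B \<union> D \<union> K\<close>; hence the left star brings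
  barred \<open>y\<close> into the left half. The column \<open>N\<close> receives barred
  \<open>d\<close> in its \<open>f\<close> form but shows \<open>c\<close> in its \<open>g\<close>
  form, so the left star, too, brings \<open>c\<close> out of \<open>Y\<close>.\<close>

lemma pair_barred:
  assumes X: "doubled n A D J K" "h < s" "card A + card D + card K < n"
    and Y: "doubled n A' D' J' K'" "h' < s"
    and c: "c \<in> D' - A' \<union> J'" "s = h' + card A' + card K' + card ((D' - A' \<union> J') \<inter> {c..})"
    and d: "d \<in> D' \<union> K'" "s = h' + card A' + card ((D' \<union> K') \<inter> {d..})" "d \<le> c"
      "h' + card A' + card K' + card ((D' - A' \<union> J') \<inter> {d..}) \<le> s"
    and fit: "fits_barred n h s A D J K c"
  defines "X \<equiv> Col h (Some s) A (card K) D" and "Y \<equiv> Col h' None A' (card K') D'"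
  shows "\<exists>X' Y' M L N R. pair_step n s X Y X' Y' M L N R \<and> move2 n s c X Y X' Y' \<and> removed n s Y Y'"
proof -
  note fX = doubled_facts[OF X(1)] and fY = doubled_facts[OF Y(1)]
  note cX = doubled_column[OF X(1), of h "Some s", folded X_def]
  note cY = doubled_column[OF Y(1), of h' None, folded Y_def]
  let ?B = "A - D \<union> J" and ?E = "D \<union> K" and ?B' = "A' - D' \<union> J'" and ?C' = "D' - A' \<union> J'"
  have aX: "c \<notin> ?E" "h + card A + card (?E \<inter> {c..}) = s - 1" "h + card A + card K < s"
    using fit unfolding fits_barred_def by blast+
  obtain y0 where y0: "y0 \<in> {1..n}" "c \<le> y0" "y0 \<notin> ?B \<union> ?E" "?E \<inter> {c..y0} = {}"
    using fit unfolding fits_barred_def by blast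
  have cn: "c \<in> {1..n}" using c(1) fY(25) by blast
  have dn: "d \<in> {1..n}" using d(1) fY(27) by blast
  have fC: "finite ?C'" using fY(15,16) by simp
  have "?C' \<inter> {c..} \<subseteq> ?C' \<inter> {d..}" using d(3) by auto
  \<comment> \<open>The row of \<open>c\<close> and the bound at \<open>d\<close> leave no room for
    a letter of \<open>C'\<close> from \<open>d\<close> to just below \<open>c\<close>.\<close>
  then have Ceq: "?C' \<inter> {d..} = ?C' \<inter> {c..}"
    using card_seteq[of "?C' \<inter> {d..}" "?C' \<inter> {c..}"] fC c(2) d(4) by simp
  have gapC: "?C' \<inter> {d..<c} = {}"
  proof -
    have "?C' \<inter> {d..<c} \<subseteq> ?C' \<inter> {d..} \<inter> {..<c}" by auto
    then show ?thesis unfolding Ceq by auto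
  qed
  have cd: "card ((D' \<union> K') \<inter> {d..}) = card (?C' \<inter> {d..}) + card K'"
    using c(2) d(2) Ceq by simp
  have C1: "0 < card (?C' \<inter> {c..})" using c(1) fC by (auto simp: card_gt_0_iff simp del: Un_iff)
  obtain A2 D2 J2 K2 where Y2: "doubled n A2 D2 J2 K2" "card K2 = card K'"
    "card D' = Suc (card D2)" "card A2 = card A'"
    "A2 \<union> K2 = insert c (A' \<union> K') - {d}" "(A2 - D2) \<union> J2 = ?B'"
    "D2 \<union> K2 = D' \<union> K' - {d}" "(D2 - A2) \<union> J2 = ?C' - {c}"
    "{d<..<c} \<subseteq> A' \<union> K'" "d \<noteq> c \<Longrightarrow> d \<in> A' \<union> K'"
    using doubled_remove_g[OF Y(1) c(1) d(1,3) gapC cd] by metis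
  define Y' where "Y' = Col h' (Some s) A2 (card K') D2"
  note cY' = doubled_column[OF Y2(1), of h' "Some s", unfolded Y2(2), folded Y'_def]
  define y where "y = Min {y \<in> {c..n}. y \<notin> ?B \<union> ?E}"
  have yin: "y \<in> {y \<in> {c..n}. y \<notin> ?B \<union> ?E}"
    unfolding y_def by (rule Min_in) (use y0(1,2,3) in auto)
  have ymin: "y \<le> z" if "c \<le> z" "z \<le> n" "z \<notin> ?B \<union> ?E" for z
    unfolding y_def by (rule Min_le) (use that in auto)
  have yy0: "y \<le> y0" using ymin y0(1-3) by auto
  have y: "c \<le> y" "y \<in> {1..n}" "y \<notin> ?B \<union> ?E" using yin cn by auto
  have yE: "?E \<inter> {c..y} = {}" using y0(4) yy0 by auto
  have gapB: "{c..<y} \<subseteq> ?B"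
  proof
    fix z assume z: "z \<in> {c..<y}"
    then have "z \<in> ?B \<union> ?E" using ymin[of z] y(2) by auto
    moreover have "z \<notin> ?E" using yE z by auto
    ultimately show "z \<in> ?B" by blast
  qed
  have yF: "y \<notin> A \<union> D \<union> J" "y \<notin> K" using y(3) by blast+
  have ynC: "y \<notin> D - A \<union> J" using yF by blast
  have Ecy: "?E \<inter> {c..} = ?E \<inter> {y..}"
  proof -
    have "{c..} = {c..y} \<union> {y..}" using y(1) by auto
    then show ?thesis using yE by blast
  qed
  have Ky: "K \<inter> {y..} = K"
  proof -
    have "y < w" if "w \<in> K" for w using fX(13)[OF y(2) _ that] yF by blast
    then show ?thesis by (auto simp: less_imp_le)
  qed
  have cE: "card (?E \<inter> {y..}) = card (D \<inter> {y..}) + card K"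
  proof -
    have "?E \<inter> {y..} = (D \<inter> {y..}) \<union> K" using Ky by blast
    moreover have "card ((D \<inter> {y..}) \<union> K) = card (D \<inter> {y..}) + card K"
      using fX(9,15,17) by (intro card_Un_disjoint) auto
    ultimately show ?thesis by simp
  qed
  have up: "S \<inter> {y..} = S \<inter> {y<..}" if "y \<notin> S" for S using that by (auto simp: le_less)
  \<comment> \<open>At the spare letter \<open>y\<close> the sets \<open>C\<close> and
    \<open>D\<close> have equally many letters up to it, and being of equal size also from it on.
    Hence barred \<open>y\<close> belongs to the same row in both halves.\<close>
  have cC: "card ((D - A \<union> J) \<inter> {y..}) = card (D \<inter> {y..})"
    using cnt_upper[of "D - A \<union> J" y] cnt_upper[of D y] fX(15,16,19) fX(30)[OF y(2) yF(1)]
      up[OF ynC] up[of D] yF(1) by simp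
  obtain JM where M: "matched n ?B (insert c ?E) JM"
    "?B - insert c ?E \<union> JM = insert y ?B - {c}" "insert c ?E - ?B \<union> JM = insert y ?E"
  proof (rule matched_bump[of ?E n "insert y ?B - {c}" c y])
    have i: "insert c (insert y ?B - {c}) - {y} = ?B"
    proof (cases "c = y")
      case True
      then show ?thesis using y(3) by blast
    next
      case False
      then have "c \<in> {c..<y}" using y(1) by simp
      then have "c \<in> ?B" using gapB by blast
      then show ?thesis using y(3) by blast
    qed
    show thesis if "matched n (insert c ?E) (insert c (insert y ?B - {c}) - {y}) J1"
      "insert c ?E - (insert c (insert y ?B - {c}) - {y}) \<union> J1 = insert y ?E"
      "insert c (insert y ?B - {c}) - {y} - insert c ?E \<union> J1 = insert y ?B - {c}" for J1
      using that(2,3) matched_sym[OF that(1)]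
        \<open>\<And>J1. matched n ?B (insert c ?E) J1 \<Longrightarrow> _ \<Longrightarrow> _ \<Longrightarrow> thesis\<close>
      unfolding i by blast
    show "?E \<subseteq> {1..n}" "insert y ?B - {c} \<subseteq> {1..n}" "?E \<inter> (insert y ?B - {c}) = {}"
      using fX(23,26,27) y(2,3) by blast+
    show "c \<in> {1..n}" "y \<in> {1..n}" "c \<notin> ?E" "y \<notin> ?E" using cn y(2,3) aX(1) by blast+
    show "c = y \<and> y \<notin> insert y ?B - {c} \<or> c < y \<and> c \<notin> insert y ?B - {c} \<and> y \<in> insert y ?B - {c}"
      using y(1) by (cases "c = y") auto
    have "{c<..<y} \<subseteq> {c..<y} - {c}" by auto
    then show "{c<..<y} \<subseteq> ?E \<union> (insert y ?B - {c})" using gapB by blast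
  qed
  obtain JN where N: "matched n (A' \<union> K') (insert d (?C' - {c})) JN"
    "A' \<union> K' - insert d (?C' - {c}) \<union> JN = insert c (A' \<union> K') - {d}"
    "insert d (?C' - {c}) - (A' \<union> K') \<union> JN = ?C'"
  proof (rule matched_bump[of "?C' - {c}" n "insert c (A' \<union> K') - {d}" d c])
    have cAK: "c \<notin> A' \<union> K'" using c(1) fY(22) by blast
    have i: "insert d (insert c (A' \<union> K') - {d}) - {c} = A' \<union> K'"
      using Y2(10) cAK by (cases "d = c") blast+
    have i2: "insert c (?C' - {c}) = ?C'" using c(1) by blast
    show thesis if "matched n (insert d (?C' - {c})) (insert d (insert c (A' \<union> K') - {d}) - {c}) J1"
      "insert d (?C' - {c}) - (insert d (insert c (A' \<union> K') - {d}) - {c}) \<union> J1 = insert c (?C' - {c})"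
      "insert d (insert c (A' \<union> K') - {d}) - {c} - insert d (?C' - {c}) \<union> J1 = insert c (A' \<union> K') - {d}" for J1
      using that(2,3) matched_sym[OF that(1)]
        \<open>\<And>J1. matched n (A' \<union> K') (insert d (?C' - {c})) J1 \<Longrightarrow> _ \<Longrightarrow> _ \<Longrightarrow> thesis\<close>
      unfolding i i2 by blast
    show "?C' - {c} \<subseteq> {1..n}" "insert c (A' \<union> K') - {d} \<subseteq> {1..n}"
      "(?C' - {c}) \<inter> (insert c (A' \<union> K') - {d}) = {}"
      using fY(22,24,25) cn by blast+
    have "d \<notin> ?C' \<or> d = c"
    proof (rule disjCI)
      assume "d \<noteq> c"
      then have "d \<in> {d..<c}" using d(3) by simp
      then show "d \<notin> ?C'" using gapC by blast
    qed
    then show "d \<notin> ?C' - {c}" by blast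
    show "d \<in> {1..n}" "c \<in> {1..n}" "c \<notin> ?C' - {c}" using cn dn by blast+
    show "d = c \<and> c \<notin> insert c (A' \<union> K') - {d} \<or>
      d < c \<and> d \<notin> insert c (A' \<union> K') - {d} \<and> c \<in> insert c (A' \<union> K') - {d}"
      using d(3) by (cases "d = c") auto
    have "d \<notin> {d<..<c}" by simp
    then show "{d<..<c} \<subseteq> ?C' - {c} \<union> (insert c (A' \<union> K') - {d})" using Y2(9) by blast
  qed
  have cardAK: "card (A' \<union> K') = card A' + card K'" by (rule fY(20))
  have R1: "hstep n s (Col h (Some s) ?B 0 ?E) (Col h' None (A' \<union> K') 0 ?C')
     (Col h None ?B 0 (insert c ?E)) (Col h' (Some s) (A' \<union> K') 0 (?C' - {c}))"
  proof (rule hstep_Barred[OF fX(26,27,23) matched_disjoint[OF fY(24,25,22)] _ _ c(1) _ X(2) _ _ M(1) refl refl])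
    show "A' \<union> K' - ?C' \<union> {} = A' \<union> K'" "?C' - (A' \<union> K') \<union> {} = ?C'"
      "(A' \<union> K') \<inter> (?C' - {c}) = {}" using fY(22) by blast+
    show "s = h' + card (A' \<union> K') + card (?C' \<inter> {c..})" using c(2) cardAK by simp
    show "h + card ?B + card (?E \<inter> {c..}) < s" using aX(2) X(2) fX(18) by simp
    have "card (?E \<inter> {c..}) \<le> card ?E" using fX(15,17) by (intro card_mono) auto
    then show "s \<le> Suc (h + card ?B + card ?E)" using aX(2) X(2) fX(18) by simp
  qed
  have R2: "hstep n s (Col h' (Some s) (A' \<union> K') 0 (?C' - {c})) (Col h' None ?B' 0 (D' \<union> K'))
     (Col h' None (A' \<union> K') 0 (insert d (?C' - {c}))) (Col h' (Some s) ?B' 0 (D' \<union> K' - {d}))"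
  proof (rule hstep_Barred[OF fY(24) _ _ matched_disjoint[OF fY(26,27,23)] _ _ d(1) _ Y(2) _ _ N(1) refl refl])
    show "?C' - {c} \<subseteq> {1..n}" "(A' \<union> K') \<inter> (?C' - {c}) = {}" using fY(22,25) by blast+
    show "?B' - (D' \<union> K') \<union> {} = ?B'" "D' \<union> K' - ?B' \<union> {} = D' \<union> K'"
      "?B' \<inter> (D' \<union> K' - {d}) = {}" using fY(23) by blast+
    show "s = h' + card ?B' + card ((D' \<union> K') \<inter> {d..})" using d(2) fY(18) by simp
    have "(?C' - {c}) \<inter> {d..} = (?C' \<inter> {c..}) - {c}" using Ceq by blast
    moreover have "c \<in> ?C' \<inter> {c..}" using c(1) by simp
    ultimately have "card ((?C' - {c}) \<inter> {d..}) = card (?C' \<inter> {c..}) - 1" by (simp del: Un_iff)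
    then show "h' + card (A' \<union> K') + card ((?C' - {c}) \<inter> {d..}) < s" using c(2) cardAK C1 by simp
    have "card (?C' \<inter> {c..}) \<le> card ?C'" using fC by (intro card_mono) auto
    moreover have "card (?C' - {c}) = card ?C' - 1" using c(1) fC by (simp del: Un_iff)
    ultimately show "s \<le> Suc (h' + card (A' \<union> K') + card (?C' - {c}))" using c(2) cardAK by linarith
  qed
  have L1: "hstep n s (Col h (Some s) (A \<union> K) 0 (D - A \<union> J)) (Col h None ?B 0 (insert c ?E))
     (Col h None (A \<union> K) 0 (insert y (D - A \<union> J))) (Col h (Some s) (insert y ?B - {c}) 0 ?E)"
  proof (rule hstep_Barred[OF fX(24,25,22) M _ _ X(2) _ _ _ refl])
    show "y \<in> insert y ?E" by simp
    have "insert y ?E \<inter> {y..} = insert y (?E \<inter> {y..})" by auto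
    moreover have "card (insert y (?E \<inter> {y..})) = Suc (card (?E \<inter> {y..}))"
      using y(3) fX(15,17) by (intro card_insert_disjoint) auto
    ultimately show "s = h + card ?B + card (insert y ?E \<inter> {y..})"
      using aX(2) X(2) fX(18) Ecy by simp
    show "h + card (A \<union> K) + card ((D - A \<union> J) \<inter> {y..}) < s"
      using cC cE Ecy aX(2) X(2) fX(20) by simp
    have "card (D \<inter> {y..}) \<le> card D" using fX(15) by (intro card_mono) auto
    then show "s \<le> Suc (h + card (A \<union> K) + card (D - A \<union> J))"
      using cE Ecy aX(2) fX(19,20) by simp
    show "matched n (A \<union> K) (insert y (D - A \<union> J)) {}"
    proof (rule matched_disjoint)
      show "A \<union> K \<subseteq> {1..n}" "insert y (D - A \<union> J) \<subseteq> {1..n}" "(A \<union> K) \<inter> insert y (D - A \<union> J) = {}"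
        using fX(22,24,25) y(2) yF by blast+
    qed
    show "?E = insert y ?E - {y}" using y(3) by blast
    show "(insert y ?B - {c}) \<inter> ?E = {}" using y(3) fX(23) by blast
  qed
  have cB: "card (insert y ?B - {c}) = card A"
  proof (cases "c = y")
    case True
    then have "insert y ?B - {c} = ?B" using y(3) by blast
    then show ?thesis using fX(18) by simp
  next
    case False
    then have "c \<in> {c..<y}" using y(1) by simp
    then have "c \<in> ?B" using gapB by blast
    moreover have "finite ?B" using fX(14,16) by simp
    moreover have "y \<notin> ?B" using y(3) by blast
    ultimately show ?thesis using fX(18) by (simp del: Un_iff)
  qed
  have L2: "hstep n s (Col h (Some s) (insert y ?B - {c}) 0 ?E) (Col h' None (A' \<union> K') 0 (insert d (?C' - {c})))
     (Col h None (insert y ?B - {c}) 0 (insert c ?E)) (Col h' (Some s) (insert c (A' \<union> K') - {d}) 0 (?C' - {c}))"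
  proof (rule hstep_Barred[OF _ fX(27) _ N c(1) _ X(2) _ _ _ refl refl])
    show "insert y ?B - {c} \<subseteq> {1..n}" "(insert y ?B - {c}) \<inter> ?E = {}"
      using fX(23,26) y(2,3) by blast+
    show "s = h' + card (A' \<union> K') + card (?C' \<inter> {c..})" using c(2) cardAK by simp
    show "h + card (insert y ?B - {c}) + card (?E \<inter> {c..}) < s" using cB aX(2) X(2) by simp
    have "card (?E \<inter> {c..}) \<le> card ?E" using fX(15,17) by (intro card_mono) auto
    then show "s \<le> Suc (h + card (insert y ?B - {c}) + card ?E)" using cB aX(2) by linarith
    show "matched n (insert y ?B - {c}) (insert c ?E) {}"
    proof (rule matched_disjoint)
      show "insert y ?B - {c} \<subseteq> {1..n}" "insert c ?E \<subseteq> {1..n}" "(insert y ?B - {c}) \<inter> insert c ?E = {}"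
        using fX(23,26,27) y(2,3) cn by blast+
    qed
    show "(insert c (A' \<union> K') - {d}) \<inter> (?C' - {c}) = {}" using fY(22) by blast
  qed
  have "y \<notin> ?B \<union> D \<union> K" using y(3) by blast
  then obtain JX where X2: "doubled n A (insert c D) JX K"
    "(A - insert c D) \<union> JX = insert y ?B - {c}"
    "(insert c D - A) \<union> JX = insert y (D - A \<union> J)"
    using doubled_insert_f[OF X(1) cn aX(1) y(1,2) _ gapB] by metis
  define X' where "X' = Col h None A (card K) (insert c D)"
  note cX' = doubled_column[OF X2(1), of h None, folded X'_def]
  have i: "insert c D \<union> K = insert c ?E" by blast
  have "pair_step n s X Y X' Y' (Col h None ?B 0 (insert c ?E))
    (Col h' (Some s) (A' \<union> K') 0 (?C' - {c})) (Col h' None (A' \<union> K') 0 (insert d (?C' - {c})))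
    (Col h (Some s) (insert y ?B - {c}) 0 ?E)"
    unfolding pair_step_def cX(6,7) cY(6,7) cX'(6,7) cY'(6,7) X2(2,3) Y2(5-8) i
    using R1 R2 L1 L2 by blast
  moreover have "move2 n s c X Y X' Y'"
    unfolding move2_def
  proof (intro exI conjI)
    show "c \<notin> D" "c \<notin> ?C' - {c}" using aX(1) by blast+
    show "is_f n X h (Some s) A (card K) D" unfolding is_f_def using cX(1) by (simp add: X_def)
    have "?C' - {c} \<union> {c} = ?C'" using c(1) by blast
    then show "is_g n Y h' None ?B' (card K') (?C' - {c} \<union> {c})"
      unfolding is_g_def cY using cY(1) by (simp add: Y_def)
    show "is_f n X' h None A (card K) (D \<union> {c})" unfolding is_f_def using cX'(1) by (simp add: X'_def)
    show "is_g n Y' h' (Some s) ?B' (card K') (?C' - {c})"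
      unfolding is_g_def cY' Y2(6,8) using cY'(1) by (simp add: Y'_def)
    have "card (?E \<inter> {c..}) \<le> card ?E" using fX(15,17) by (intro card_mono) auto
    then show "star_among_barred X" unfolding star_among_barred_def X_def using aX(2,3) fX(21) by simp
    have "card (?C' \<inter> {c..}) \<le> card ?C'" using fC by (intro card_mono) auto
    then show "star_among_barred Y'" unfolding star_among_barred_def Y'_def
      using c(2) C1 Y2(3,4) fY(19) by simp
  qed
  moreover have "removed n s Y Y'"
    unfolding removed_def cY(4,7) cY'(4) cY(3) cY'(3) Y2(6)
    by (rule disjI2, rule exI[of _ d])
      (use d(1,2) fY(14-18) Y2(7) in \<open>simp_all add: entry_iff(3) Y_def Y'_def\<close>)
  ultimately show ?thesis by blast
qed

section \<open>Recovering a column from its double\<close>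

lemma semistd_column:
  assumes "semistd n c"
  shows "doubled n (setA c) (setD c) (setJ n c) (setK n c)" "card (setK n c) = zeros c"
    "c = Col (empties c) (star c) (setA c) (card (setK n c)) (setD c)"
    "setB n c = setA c - setD c \<union> setJ n c"
    "dleft n c = Col (empties c) (star c) (setA c \<union> setK n c) 0 (setD c - setA c \<union> setJ n c)"
    "dright n c = Col (empties c) (star c) (setA c - setD c \<union> setJ n c) 0 (setD c \<union> setK n c)"
proof -
  note d = semistd_doubled[OF assms]
  have c: "c = Col (empties c) (star c) (setA c) (card (setK n c)) (setD c)"
    using d(2) by (cases c) auto
  show "doubled n (setA c) (setD c) (setJ n c) (setK n c)" "card (setK n c) = zeros c"
    "c = Col (empties c) (star c) (setA c) (card (setK n c)) (setD c)"
    "setB n c = setA c - setD c \<union> setJ n c"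
    "dleft n c = Col (empties c) (star c) (setA c \<union> setK n c) 0 (setD c - setA c \<union> setJ n c)"
    "dright n c = Col (empties c) (star c) (setA c - setD c \<union> setJ n c) 0 (setD c \<union> setK n c)"
    using d c doubled_column(4,6,7)[OF d(1), of "empties c" "star c", folded c] by blast+
qed

text \<open>\<open>B\<close> and \<open>C\<close> give back \<open>A\<close> and \<open>D\<close>,
  and \<open>K\<close> is what else the left half contains. This identifies the columns of an
  elementary move, which are known only through their halves.\<close>

lemma doubles_injective:
  assumes "semistd n c1" "semistd n c2" "dleft n c1 = dleft n c2" "dright n c1 = dright n c2"
  shows "c1 = c2"
proof -
  note 1 = semistd_column(1,2,5,6)[OF assms(1)]
  note 2 = semistd_column(1,2,5,6)[OF assms(2)]
  have e: "empties c1 = empties c2" "star c1 = star c2" "setA c1 \<union> setK n c1 = setA c2 \<union> setK n c2"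
    "setA c1 - setD c1 \<union> setJ n c1 = setA c2 - setD c2 \<union> setJ n c2" "setD c1 - setA c1 \<union> setJ n c1 = setD c2 - setA c2 \<union> setJ n c2"
    using assms(3,4) 1(3,4) 2(3,4) by auto
  have m: "setA c1 = setA c2 \<and> setD c1 = setD c2"
    using matched_unique[OF _ _ e(4,5)] doubled_facts(1)[OF 1(1)] doubled_facts(1)[OF 2(1)] by blast
  have "setK n c1 = (setA c1 \<union> setK n c1) - setA c1" using doubled_facts(8)[OF 1(1)] by blast
  also have "\<dots> = setK n c2" using m e(3) doubled_facts(8)[OF 2(1)] by auto
  finally have "zeros c1 = zeros c2" using 1(2) 2(2) by simp
  then show ?thesis using e(1,2) m by (cases c1; cases c2) simp
qed

section \<open>Why the incoming letter fits\<close>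

lemma exists_spare:
  assumes "doubled n A D J K" "card A + card D + card K < n"
  obtains q where "q \<in> {1..n}" "q \<notin> (A - D \<union> J) \<union> (D \<union> K)"
    "\<And>w. w \<in> K \<Longrightarrow> q < w"
proof -
  note f = doubled_facts[OF assms(1)]
  \<comment> \<open>The two parts of the right half have together as many letters as the column,
    fewer than \<open>n\<close>, so they cannot exhaust the alphabet.\<close>
  have "card ((A - D \<union> J) \<union> (D \<union> K)) \<le> card (A - D \<union> J) + card (D \<union> K)" by (rule card_Un_le)
  also have "\<dots> < card {1..n}" using assms(2) f(18,21) by simp
  finally have "\<not> {1..n} \<subseteq> (A - D \<union> J) \<union> (D \<union> K)"
    using card_mono[of "(A - D \<union> J) \<union> (D \<union> K)" "{1..n}"] f(14-17) by auto
  then obtain q where q: "q \<in> {1..n}" "q \<notin> (A - D \<union> J) \<union> (D \<union> K)" by blast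
  have "q < w" if "w \<in> K" for w using f(13)[OF q(1) _ that] q(2) by blast
  then show ?thesis using that q by blast
qed

lemma start_unbarred:
  assumes d: "doubled n A D J K" and total: "card A + card D + card K < n" and s: "1 \<le> s"
    and below: "\<And>q. entry (Col (s - 1) (Some s) (A - D \<union> J) 0 (D \<union> K)) (Suc s) = Some q \<Longrightarrow> Unbarred a < q"
    and b0: "b0 \<le> a" "b0 \<in> {1..n}" "b0 \<notin> D"
  shows "fits_unbarred n (s - 1) s A D J K a"
proof -
  note f = doubled_facts[OF d]
  have "s - 1 + cnt (A - D \<union> J) a < s"
    using entry_greater_Unbarred[of "A - D \<union> J" "D \<union> K" "s - 1" s 0 a] below f(14-17) s
      entry_below_star[of "s - 1" s "A - D \<union> J" 0 "D \<union> K"] by simp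
  then have c0: "cnt (A - D \<union> J) a = 0" using s by linarith
  then have B: "(A - D \<union> J) \<inter> {..a} = {}" by (simp add: cnt_zero_iff)
  have aB: "a \<notin> A - D \<union> J" using B by blast
  obtain q where q: "q \<in> {1..n}" "q \<notin> (A - D \<union> J) \<union> (D \<union> K)" "\<And>w. w \<in> K \<Longrightarrow> q < w"
    using exists_spare[OF d total] by metis
  define x0 where "x0 = (if b0 \<in> K then q else b0)"
  have x: "x0 \<le> a" "x0 \<in> {1..n}" using b0 q(1) q(3)[of b0] unfolding x0_def by auto
  have "x0 \<notin> D \<union> K" using b0 q(2) unfolding x0_def by auto
  moreover have "x0 \<notin> A - D \<union> J" using B x(1) by blast
  moreover have "(A - D \<union> J) \<inter> {x0..a} = {}" using B by auto
  ultimately show ?thesis unfolding fits_unbarred_def using x aB c0 by auto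
qed

text \<open>Whatever is beneath the star exceeds barred \<open>c\<close>, so \<open>B\<close> is
  empty and \<open>D \<union> K\<close> has no letter from \<open>c\<close> on. Then
  \<open>c\<close> is spare and would lie below any letter of \<open>K\<close>; hence
  \<open>K\<close> is empty, and \<open>c\<close> itself is the witness.\<close>

lemma start_barred:
  assumes d: "doubled n A D J K" and s: "1 \<le> s"
    and below: "\<And>q. entry (Col (s - 1) (Some s) (A - D \<union> J) 0 (D \<union> K)) (Suc s) = Some q \<Longrightarrow> Barred c < q"
    and cn: "c \<in> {1..n}"
  shows "fits_barred n (s - 1) s A D J K c"
proof -
  note f = doubled_facts[OF d]
  have "s - 1 + card (A - D \<union> J) + card ((D \<union> K) \<inter> {c..}) < s"
    using entry_greater_Barred[of "A - D \<union> J" "D \<union> K" "s - 1" s 0 c] below f(14-17) s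
      entry_below_star[of "s - 1" s "A - D \<union> J" 0 "D \<union> K"] by simp
  then have z: "card (A - D \<union> J) = 0" "card ((D \<union> K) \<inter> {c..}) = 0" using s by linarith+
  have E: "(D \<union> K) \<inter> {c..} = {}" using z(2) f(15,17) by (simp del: Un_iff)
  have B: "A - D \<union> J = {}" using z(1) f(14,16) by simp
  have cE: "c \<notin> D \<union> K" using E by auto
  moreover have "s - 1 + card A + card ((D \<union> K) \<inter> {c..}) = s - 1" using z f(18) by simp
  moreover have "K = {}"
  proof (rule ccontr)
    assume "K \<noteq> {}"
    then obtain w where w: "w \<in> K" by blast
    then have "c < w" using f(13)[OF cn _ w] B cE by blast
    then show False using E w by auto
  qed
  then have "s - 1 + card A + card K < s" using z(1) f(18) s by simp
  moreover have "\<exists>y0 \<in> {1..n}. c \<le> y0 \<and> y0 \<notin> (A - D \<union> J) \<union> (D \<union> K) \<and> (D \<union> K) \<inter> {c..y0} = {}"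
    using cn B cE E by (intro bexI[of _ c]) auto
  ultimately show ?thesis unfolding fits_barred_def by blast
qed

text \<open>The letter \<open>b\<close> lost from row \<open>s\<close> is at most \<open>a\<close>,
  and the one formerly below it exceeds \<open>a\<close>. So \<open>B0\<close> has nothing else from
  \<open>b\<close> to \<open>a\<close>, and the vacated \<open>b\<close> is the spare letter
  required.\<close>

lemma later_unbarred:
  assumes d: "doubled n A D J K"
    and d0: "B0 \<subseteq> {1..n}" "finite E0" "B0 \<inter> E0 = {}" "h < s"
    and rem: "b \<in> B0" "s = h + cnt B0 b" "A - D \<union> J = B0 - {b}" "D \<union> K = E0"
    and below: "\<And>q. entry (Col h None B0 0 E0) (Suc s) = Some q \<Longrightarrow> Unbarred a < q"
    and ba: "b \<le> a"
  shows "fits_unbarred n h s A D J K a"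
proof -
  have fB: "finite B0" using d0(1) by (meson finite_atLeastAtMost finite_subset)
  have "h + cnt B0 a < Suc s"
    using entry_greater_Unbarred[OF fB d0(2), of h "Suc s" 0 a] below d0(4) by simp
  then have e: "cnt B0 b = cnt B0 a" using rem(2) cnt_mono[of B0 B0 b a] ba by simp
  then have g: "B0 \<inter> {b<..a} = {}" using cnt_gap[OF ba] by metis
  have g2: "(B0 - {b}) \<inter> {b..a} = {}"
  proof -
    have "{b..a} - {b} \<subseteq> {b<..a}" by auto
    then show ?thesis using g by blast
  qed
  have "a \<notin> A - D \<union> J" unfolding rem using g2 ba by auto
  moreover have "cnt (A - D \<union> J) a = s - 1 - h" unfolding rem using e rem(1,2) ba by (simp add: cnt_remove)
  moreover have "\<exists>x0 \<in> {1..n}. x0 \<le> a \<and> x0 \<notin> (A - D \<union> J) \<union> (D \<union> K) \<and> (A - D \<union> J) \<inter> {x0..a} = {}"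
    unfolding rem using g2 ba d0 rem(1) by (intro bexI[of _ b]) auto
  ultimately show ?thesis unfolding fits_unbarred_def by blast
qed

text \<open>The column has lost an unbarred letter and receives a barred one, so \<open>b\<close>
  was the last letter of \<open>B0\<close>. The spare letter is \<open>c\<close> itself, unless
  \<open>c\<close> lies in \<open>B\<close>; then it is the vacated \<open>b\<close>, which is above
  \<open>c\<close>.\<close>

lemma later_barred_unbarred:
  assumes d: "doubled n A D J K"
    and d0: "B0 \<subseteq> {1..n}" "finite E0" "B0 \<inter> E0 = {}" "h < s"
    and rem: "b \<in> B0" "s = h + cnt B0 b" "A - D \<union> J = B0 - {b}" "D \<union> K = E0"
    and below: "\<And>q. entry (Col h None B0 0 E0) (Suc s) = Some q \<Longrightarrow> Barred c < q"
    and cn: "c \<in> {1..n}"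
  shows "fits_barred n h s A D J K c"
proof -
  note f = doubled_facts[OF d]
  have fB: "finite B0" using d0(1) by (meson finite_atLeastAtMost finite_subset)
  have "h + card B0 + card (E0 \<inter> {c..}) < Suc s"
    using entry_greater_Barred[OF fB d0(2), of h "Suc s" 0 c] below d0(4) by simp
  then have z: "cnt B0 b = card B0" "card (E0 \<inter> {c..}) = 0"
    using rem(2) cnt_le_card[OF fB, of b] by linarith+
  have E: "E0 \<inter> {c..} = {}" using z(2) d0(2) by simp
  have "card (B0 \<inter> {b<..}) = 0" using cnt_upper[OF fB, of b] z(1) by simp
  then have Bb: "B0 \<inter> {b<..} = {}" using fB by simp
  have cA: "card A = card B0 - 1" using f(18) rem(1,3) fB by simp
  have pos: "0 < card B0" using rem(1) fB by (auto simp: card_gt_0_iff)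
  have cE: "c \<notin> D \<union> K" unfolding rem using E by auto
  have e: "h + card A + card ((D \<union> K) \<inter> {c..}) = s - 1" unfolding rem using cA z rem(2) pos by simp
  have bn: "b \<in> {1..n}" "b \<notin> D \<union> K" "b \<notin> A - D \<union> J" using rem d0 by blast+
  \<comment> \<open>A letter of \<open>K\<close> would lie above the spare \<open>b\<close> but
    below \<open>c\<close>. Then \<open>c\<close> is not spare, so it lies in \<open>B0\<close>
    beyond its last element \<open>b\<close>.\<close>
  have "K = {}"
  proof (rule ccontr)
    assume "K \<noteq> {}"
    then obtain w where w: "w \<in> K" by blast
    then have bw: "b < w" using f(13)[OF bn(1) _ w] bn by blast
    have wc: "w < c" using E w rem(4) by (auto simp: not_le[symmetric])
    then have "c \<in> A - D \<union> J" using f(13)[OF cn _ w] cE by auto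
    then have "c \<in> B0 \<inter> {b<..}" using rem(3) bw wc by auto
    then show False using Bb by blast
  qed
  then have k: "h + card A + card K < s" using cA z rem(2) pos by simp
  define y0 where "y0 = (if c \<in> A - D \<union> J then b else c)"
  have "c \<le> b" if "c \<in> A - D \<union> J" using that rem(3) Bb by (metis DiffD1 IntI empty_iff greaterThan_iff not_le)
  then have "y0 \<in> {1..n}" "c \<le> y0" "y0 \<notin> (A - D \<union> J) \<union> (D \<union> K)"
    using bn cn cE unfolding y0_def by (auto split: if_splits)
  moreover have "(D \<union> K) \<inter> {c..y0} = {}" unfolding rem using E by auto
  ultimately show ?thesis unfolding fits_barred_def using cE e k by blast
qed

text \<open>The letter formerly below row \<open>s\<close> exceeds barred \<open>c\<close>, so
  \<open>E0\<close> has nothing from \<open>c\<close> to just below \<open>e\<close>, and the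
  vacated \<open>e\<close> is the spare letter. Being spare it lies below \<open>K\<close>;
  therefore all of \<open>K\<close> is counted by \<open>{c..}\<close>, which bounds the number of
  zeros.\<close>

lemma later_barred_barred:
  assumes d: "doubled n A D J K"
    and d0: "E0 \<subseteq> {1..n}" "finite B0" "B0 \<inter> E0 = {}" "h < s"
    and rem: "e \<in> E0" "s = h + card B0 + card (E0 \<inter> {e..})" "A - D \<union> J = B0" "D \<union> K = E0 - {e}"
    and below: "\<And>q. entry (Col h None B0 0 E0) (Suc s) = Some q \<Longrightarrow> Barred c < q"
    and ce: "c \<le> e"
  shows "fits_barred n h s A D J K c"
proof -
  note f = doubled_facts[OF d]
  have fE: "finite E0" using d0(1) by (meson finite_atLeastAtMost finite_subset)
  have "h + card B0 + card (E0 \<inter> {c..}) < Suc s"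
    using entry_greater_Barred[OF d0(2) fE, of h "Suc s" 0 c] below d0(4) by simp
  then have l: "card (E0 \<inter> {c..}) \<le> card (E0 \<inter> {e..})" using rem(2) by simp
  have sub: "E0 \<inter> {e..} \<subseteq> E0 \<inter> {c..}" using ce by auto
  have eq: "E0 \<inter> {e..} = E0 \<inter> {c..}" by (rule card_seteq[OF _ sub l]) (use fE in simp)
  have gap: "(E0 - {e}) \<inter> {c..e} = {}"
  proof -
    have "E0 \<inter> {c..e} \<subseteq> (E0 \<inter> {c..}) \<inter> {..e}" by auto
    also have "\<dots> \<subseteq> {e}" unfolding eq[symmetric] by auto
    finally show ?thesis by blast
  qed
  have cE: "c \<notin> D \<union> K" unfolding rem using gap ce by auto
  have i: "(E0 - {e}) \<inter> {c..} = E0 \<inter> {e..} - {e}" using eq by blast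
  have "card (E0 \<inter> {e..} - {e}) = card (E0 \<inter> {e..}) - 1" using rem(1) by simp
  moreover have "0 < card (E0 \<inter> {e..})" using rem(1) fE by (auto simp: card_gt_0_iff)
  ultimately have *: "h + card A + card ((D \<union> K) \<inter> {c..}) = s - 1"
    unfolding rem(4) i using rem(2) f(18) unfolding rem(3) by simp
  have en: "e \<in> {1..n}" "e \<notin> D \<union> K" "e \<notin> A - D \<union> J" using rem d0 by blast+
  have "e < w" if "w \<in> K" for w using f(13)[OF en(1) _ that] en by blast
  then have "K \<subseteq> (D \<union> K) \<inter> {c..}" using ce by fastforce
  then have "card K \<le> card ((D \<union> K) \<inter> {c..})" using f(15,17) by (intro card_mono) auto
  then have "h + card A + card K < s" using * d0(4) by linarith
  moreover have "\<exists>y0 \<in> {1..n}. c \<le> y0 \<and> y0 \<notin> (A - D \<union> J) \<union> (D \<union> K) \<and> (D \<union> K) \<inter> {c..y0} = {}"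
    using en ce gap rem(4) by (intro bexI[of _ e]) auto
  ultimately show ?thesis unfolding fits_barred_def using cE * by blast
qed

definition row_move :: "nat \<Rightarrow> nat \<Rightarrow> col \<Rightarrow> col \<Rightarrow> col \<Rightarrow> col \<Rightarrow> bool" where
  "row_move n s X Y X' Y' \<longleftrightarrow> (case entry Y s of
       Some (Unbarred a) \<Rightarrow> move1 n s a X Y X' Y'
     | Some (Barred b) \<Rightarrow> (\<exists>c. entry (dleft n Y) s = Some (Barred c) \<and> move2 n s c X Y X' Y')
     | Some Zero \<Rightarrow> move3 n s X Y X' Y'
     | None \<Rightarrow> False)"

text \<open>\<open>r1\<close> and \<open>r4\<close> are the weak inequalities within row
  \<open>s\<close>, \<open>r2\<close> and \<open>r3\<close> the strict ones between rows
  \<open>s\<close> and \<open>s + 1\<close>. \<open>C\<close> is a column of \<open>W\<close>, and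
  \<open>X\<close> is what it has become when the star is in it; \<open>kind\<close> separates the
  starting column from the later ones.\<close>

lemma pair_exists:
  assumes C: "semistd n C" and Y: "semistd n Y" "star Y = None" "empties Y < s" "s \<le> height Y"
    and r1: "\<And>x y. entry (dleft n Y) s = Some x \<Longrightarrow> entry (dright n Y) s = Some y \<Longrightarrow> x \<le> y"
    and r2: "\<And>x y. entry (dright n Y) s = Some x \<Longrightarrow> entry (dleft n Y) (Suc s) = Some y \<Longrightarrow> x < y"
    and r3: "\<And>x y. entry (dleft n Y) s = Some x \<Longrightarrow> entry (dright n C) (Suc s) = Some y \<Longrightarrow> x < y"
    and r4: "\<And>x y. entry (dright n C) s = Some x \<Longrightarrow> entry (dleft n Y) s = Some y \<Longrightarrow> x \<le> y"
    and z: "\<not> (entry Y s = Some Zero \<and> entry Y (Suc s) = Some Zero)"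
    and X: "semistd n X" "star X = Some s" "empties X = empties C"
      "card (setA X) + card (setD X) + zeros X < n"
    and kind: "X = C \<and> empties C = s - 1 \<and> 1 \<le> s \<and>
        (\<forall>a. entry Y s = Some (Unbarred a) \<longrightarrow> (\<exists>b \<in> {1..n}. b \<le> a \<and> b \<notin> setD C)) \<or>
      star C = None \<and> empties C < s \<and> s \<le> height C \<and> removed n s C X"
  shows "\<exists>X' Y' M L N R. pair_step n s X Y X' Y' M L N R \<and> removed n s Y Y' \<and> row_move n s X Y X' Y'"
proof -
  define A D h J K where X_sets: "A = setA X" "D = setD X" "h = empties X" "J = setJ n X" "K = setK n X"
  note dX = semistd_column[OF X(1), unfolded X(2), folded X_sets]
  note d = dX(1) and K = dX(2) and Xc = dX(3) and RX = dX(6)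
  define A' D' h' J' K' where Y_sets: "A' = setA Y" "D' = setD Y" "h' = empties Y" "J' = setJ n Y" "K' = setK n Y"
  note dY = semistd_column[OF Y(1), unfolded Y(2), folded Y_sets]
  note d' = dY(1) and Yc = dY(3) and LY = dY(5) and RY = dY(6)
  note f' = doubled_facts[OF d']
  have h's: "h' < s" using Y(3) Y_sets by simp
  have sY: "s \<le> h' + card A' + card K' + card D'" using Y(4) Yc height_None by metis
  have hs: "h < s" using kind X(3) X_sets by auto
  have total: "card A + card D + card K < n" using X(4) K X_sets by simp
  note dC = semistd_column(1)[OF C] and BC = semistd_column(4)[OF C]
    and RC = semistd_column(6)[OF C, folded X(3), folded X_sets]
  note fC = doubled_facts[OF dC]
  let ?B0 = "setA C - setD C \<union> setJ n C" and ?E0 = "setD C \<union> setK n C"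
  have fin0: "finite ?B0" "finite ?E0" using fC(14-17) by auto
  have rem: "(\<exists>b \<in> ?B0. entry (dright n C) s = Some (Unbarred b) \<and> s = h + cnt ?B0 b \<and>
        A - D \<union> J = ?B0 - {b} \<and> D \<union> K = ?E0) \<or>
     (\<exists>e \<in> ?E0. entry (dright n C) s = Some (Barred e) \<and> s = h + card ?B0 + card (?E0 \<inter> {e..}) \<and>
        A - D \<union> J = ?B0 \<and> D \<union> K = ?E0 - {e})" if "star C = None" "removed n s C X"
    using that(2) unfolding removed_def dX(4) BC X_sets[symmetric] RC that(1) entry_iff[OF fin0]
    by auto
  have exL: "entry (dleft n Y) s \<noteq> None"
    unfolding LY using entry_iff(4)[of "A' \<union> K'" "D' - A' \<union> J'" h' 0 s] f'(14-17,19,20) h's sY by auto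
  have exR: "entry (dright n Y) s \<noteq> None"
    unfolding RY using entry_iff(4)[of "A' - D' \<union> J'" "D' \<union> K'" h' 0 s] f'(14-17,18,21) h's sY by auto
  have exY: "entry Y s \<noteq> None"
    unfolding Yc using entry_iff(4)[of A' D' h' "card K'" s] f'(14,15) h's sY by auto
  have finL: "finite (A' \<union> K')" "finite (D' - A' \<union> J')" and finR: "finite (A' - D' \<union> J')" "finite (D' \<union> K')"
    using f'(14-17) by auto
  note eL = entry_iff[OF finL] and eR = entry_iff[OF finR]
  have X_unb: "fits_unbarred n h s A D J K a"
    if a: "entry (dleft n Y) s = Some (Unbarred a)" "a \<in> {1..n}"
      and b0: "X = C \<Longrightarrow> \<exists>b \<in> {1..n}. b \<le> a \<and> b \<notin> setD C" for a
    using kind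
  proof
    assume k: "X = C \<and> empties C = s - 1 \<and> 1 \<le> s \<and>
        (\<forall>a. entry Y s = Some (Unbarred a) \<longrightarrow> (\<exists>b \<in> {1..n}. b \<le> a \<and> b \<notin> setD C))"
    then obtain b where b: "b \<in> {1..n}" "b \<le> a" "b \<notin> D" using b0 X_sets by auto
    have hh: "h = s - 1" using k X_sets by simp
    have "Unbarred a < q" if "entry (Col (s - 1) (Some s) (A - D \<union> J) 0 (D \<union> K)) (Suc s) = Some q" for q
      using r3[OF a(1)] that k RX hh by auto
    then show ?thesis
      using start_unbarred[OF d total _ _ b(2,1,3), of s] k unfolding hh by blast
  next
    assume k: "star C = None \<and> empties C < s \<and> s \<le> height C \<and> removed n s C X"
    have bel: "Unbarred a < q" if "entry (Col h None ?B0 0 ?E0) (Suc s) = Some q" for q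
      using r3[OF a(1)] that RC k by auto
    consider b where "b \<in> ?B0" "entry (dright n C) s = Some (Unbarred b)" "s = h + cnt ?B0 b"
        "A - D \<union> J = ?B0 - {b}" "D \<union> K = ?E0" | e where "entry (dright n C) s = Some (Barred e)"
      using rem[OF conjunct1[OF k]] k by metis
    then show ?thesis
    proof cases
      case 1
      have "b \<le> a" using r4[OF 1(2) a(1)] by simp
      then show ?thesis
        using later_unbarred[OF d fC(26) fin0(2) fC(23) hs 1(1,3,4,5) bel] by blast
    next
      case 2
      then show ?thesis using r4[OF 2 a(1)] by simp
    qed
  qed
  have X_bar: "fits_barred n h s A D J K c"
    if c: "entry (dleft n Y) s = Some (Barred c)" "c \<in> {1..n}" for c
    using kind
  proof
    assume k: "X = C \<and> empties C = s - 1 \<and> 1 \<le> s \<and>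
        (\<forall>a. entry Y s = Some (Unbarred a) \<longrightarrow> (\<exists>b \<in> {1..n}. b \<le> a \<and> b \<notin> setD C))"
    have hh: "h = s - 1" using k X_sets by simp
    have "Barred c < q" if "entry (Col (s - 1) (Some s) (A - D \<union> J) 0 (D \<union> K)) (Suc s) = Some q" for q
      using r3[OF c(1)] that k RX hh by auto
    then show ?thesis
      using start_barred[OF d _ _ c(2), of s] k unfolding hh by blast
  next
    assume k: "star C = None \<and> empties C < s \<and> s \<le> height C \<and> removed n s C X"
    have bel: "Barred c < q" if "entry (Col h None ?B0 0 ?E0) (Suc s) = Some q" for q
      using r3[OF c(1)] that RC k by auto
    consider b where "b \<in> ?B0" "entry (dright n C) s = Some (Unbarred b)" "s = h + cnt ?B0 b"
        "A - D \<union> J = ?B0 - {b}" "D \<union> K = ?E0"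
      | e where "e \<in> ?E0" "entry (dright n C) s = Some (Barred e)"
        "s = h + card ?B0 + card (?E0 \<inter> {e..})" "A - D \<union> J = ?B0" "D \<union> K = ?E0 - {e}"
      using rem[OF conjunct1[OF k]] k by metis
    then show ?thesis
    proof cases
      case 1
      then show ?thesis
        using later_barred_unbarred[OF d fC(26) fin0(2) fC(23) hs 1(1,3,4,5) bel c(2)] by blast
    next
      case 2
      have "c \<le> e" using r4[OF 2(2) c(1)] by simp
      then show ?thesis
        using later_barred_barred[OF d fC(27) fin0(1) fC(23) hs 2(1,3,4,5) bel] by blast
    qed
  qed
  show ?thesis
  proof (cases "the (entry Y s)")
    case (Unbarred a)
    then have eY: "entry Y s = Some (Unbarred a)" using exY by auto
    then have t: "a \<in> A'" "s = h' + cnt A' a" unfolding Yc using entry_iff(1)[OF f'(14,15)] by auto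
    have an: "a \<in> {1..n}" using t f'(2) by blast
    have sA: "s \<le> h' + card A'" using t(2) cnt_le_card[OF f'(14), of a] by simp
    \<comment> \<open>Row \<open>s\<close> lies within the unbarred rows of \<open>Y\<close>, and
      the unbarred part of the right half is equally long, so its letter in that row is
      unbarred.\<close>
    obtain b where b: "b \<in> A' - D' \<union> J'" "s = h' + cnt (A' - D' \<union> J') b"
      and eb: "entry (dright n Y) s = Some (Unbarred b)"
    proof (cases "the (entry (dright n Y) s)")
      case (Unbarred b)
      then have e: "entry (dright n Y) s = Some (Unbarred b)" using exR by auto
      then show thesis using that[OF _ _ e] unfolding RY eR by blast
    next
      case Zero
      then have e: "entry (dright n Y) s = Some Zero" using exR by auto
      then show thesis unfolding RY eR by auto
    next
      case (Barred e)
      then have "entry (dright n Y) s = Some (Barred e)" using exR by auto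
      then have "e \<in> D' \<union> K'" "s = h' + card (A' - D' \<union> J') + 0 + card ((D' \<union> K') \<inter> {e..})"
        unfolding RY eR by blast+
      moreover have "0 < card ((D' \<union> K') \<inter> {e..})" using calculation(1) finR(2)
        by (auto simp: card_gt_0_iff simp del: Un_iff)
      ultimately show thesis using sA f'(18) by simp
    qed
    \<comment> \<open>With \<open>B' = A' - D' \<union> J'\<close> this gives \<open>s = h' + cnt B'
      b \<le> h' + cnt A' b \<le> h' + cnt (A' \<union> K') b \<le> s\<close>. All terms are equal,
      so \<open>K'\<close> has no letter up to \<open>b\<close>, and \<open>A'\<close> has as many
      letters up to \<open>b\<close> as up to \<open>a\<close>.\<close>
    have "\<forall>q. entry (dleft n Y) (Suc s) = Some q \<longrightarrow> Unbarred b < q" using r2[OF eb] by blast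
    then have b3: "h' + cnt (A' \<union> K') b \<le> s"
      unfolding LY using entry_greater_Unbarred[OF finL, of h' "Suc s" 0 b] h's by simp
    have KA: "cnt (A' \<union> K') b = cnt A' b + cnt K' b" using f'(8) by (intro cnt_Un) auto
    have e: "cnt A' b = cnt A' a" "cnt K' b = 0"
      using f'(28)[of b] KA b(2) b3 t(2) by linarith+
    have ab: "a \<le> b"
    proof (rule ccontr)
      assume n: "\<not> a \<le> b"
      then have "A' \<inter> {b<..a} \<noteq> {}" using t by auto
      then show False using cnt_gap[of b a A'] e(1) n by simp
    qed
    have "cnt K' a = 0" using cnt_mono[of K' K' a b] ab e(2) by simp
    then have s_cnt: "s = h' + cnt (A' \<union> K') a"
      using t(2) cnt_Un[of A' K' a] f'(8) by (simp add: Int_commute)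
    have eLa: "entry (dleft n Y) s = Some (Unbarred a)" unfolding LY eL using t(1) s_cnt by blast
    have "\<exists>b \<in> {1..n}. b \<le> a \<and> b \<notin> setD C" if "X = C"
      using kind eY that X(2) by auto
    note xu = X_unb[OF eLa an this]
    have "\<exists>X' Y' M L N R. pair_step n s X Y X' Y' M L N R \<and> move1 n s a X Y X' Y' \<and> removed n s Y Y'"
      using pair_unbarred[OF d hs total d' h's t b ab e xu] unfolding Xc[symmetric] Yc[symmetric]
      by blast
    then show ?thesis unfolding row_move_def eY option.case letter.case by blast
  next
    case Zero
    then have eY: "entry Y s = Some Zero" using exY by auto
    then have s1: "h' + card A' < s" "s \<le> h' + card A' + card K'"
      using Yc entry_iff(2)[OF f'(14,15), of h' "card K'" s] by auto
    \<comment> \<open>Row \<open>s\<close> is the last row of zeros, hence the last unbarred row of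
      the left half; this is why the letter facing the star is \<open>n\<close>.\<close>
    have "\<not> Suc s \<le> h' + card A' + card K'"
      using z eY Yc entry_iff(2)[OF f'(14,15), of h' "card K'" "Suc s"] s1 by auto
    then have s2: "s = h' + card A' + card K'" using s1 by simp
    have K0: "K' \<noteq> {}" using s1 s2 by auto
    obtain e where e: "e \<in> D' \<union> K'" "s = h' + card (A' - D' \<union> J') + card ((D' \<union> K') \<inter> {e..})"
      and ee: "entry (dright n Y) s = Some (Barred e)"
    proof (cases "the (entry (dright n Y) s)")
      case (Unbarred b)
      then have "entry (dright n Y) s = Some (Unbarred b)" using exR by auto
      then have "s = h' + cnt (A' - D' \<union> J') b" unfolding RY eR by blast
      then show thesis using cnt_le_card[OF finR(1), of b] f'(18) s1(1) by simp
    next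
      case Zero
      then have e: "entry (dright n Y) s = Some Zero" using exR by auto
      then show thesis unfolding RY eR by auto
    next
      case (Barred e)
      then have e: "entry (dright n Y) s = Some (Barred e)" using exR by auto
      then show thesis using that[OF _ _ e] unfolding RY eR by simp
    qed
    have e2: "card ((D' \<union> K') \<inter> {e..}) = card K'" using e(2) s2 f'(18) by simp
    have "\<forall>q. entry (dleft n Y) (Suc s) = Some q \<longrightarrow> Barred e < q" using r2[OF ee] by blast
    then have "h' + card (A' \<union> K') + card ((D' - A' \<union> J') \<inter> {e..}) < Suc s"
      unfolding LY using entry_greater_Barred[OF finL, of h' "Suc s" 0 e] h's by simp
    then have "card ((D' - A' \<union> J') \<inter> {e..}) = 0" using s2 f'(20) by simp
    then have e3: "(D' - A' \<union> J') \<inter> {e..} = {}" using finL(2) by (simp del: Un_iff)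
    have en: "e \<in> {1..n}" using e(1) f'(27) by blast
    then have nn: "n \<in> {1..n}" by simp
    have nC: "n \<notin> D' - A' \<union> J'" using e3 en by auto
    have nA: "n \<in> A' \<union> K'"
    proof (rule ccontr)
      assume "n \<notin> A' \<union> K'"
      then have "n \<notin> A' \<union> D' \<union> J' \<union> K'" using nC by blast
      moreover obtain w where "w \<in> K'" using K0 by blast
      ultimately have "n < w" "w \<le> n" using f'(13)[OF nn] f'(5) by auto
      then show False by simp
    qed
    have "cnt (A' \<union> K') n = card A' + card K'" using cnt_full[of "A' \<union> K'" n] f'(20,24) by force
    then have eLn: "entry (dleft n Y) s = Some (Unbarred n)" unfolding LY eL using nA s2 by simp
    have b0: "\<exists>b \<in> {1..n}. b \<le> n \<and> b \<notin> setD C" if "X = C"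
    proof -
      obtain q where "q \<in> {1..n}" "q \<notin> (A - D \<union> J) \<union> (D \<union> K)" by (rule exists_spare[OF d total])
      then show ?thesis using that X_sets by auto
    qed
    note xu = X_unb[OF eLn nn b0]
    have "\<exists>X' Y' M L N R. pair_step n s X Y X' Y' M L N R \<and> move3 n s X Y X' Y' \<and> removed n s Y Y'"
      using pair_zero[OF d hs total d' h's K0 s2 e(1) e2 e3 xu] unfolding Xc[symmetric] Yc[symmetric]
      by blast
    then show ?thesis unfolding row_move_def eY option.case letter.case by blast
  next
    case (Barred d1)
    then have eY: "entry Y s = Some (Barred d1)" using exY by auto
    then have t: "d1 \<in> D'" "s = h' + card A' + card K' + card (D' \<inter> {d1..})"
      using Yc entry_iff(3)[OF f'(14,15), of h' "card K'" s] by auto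
    moreover have "0 < card (D' \<inter> {d1..})" using t(1) f'(15) by (auto simp: card_gt_0_iff)
    ultimately have s1: "h' + card A' + card K' < s" by simp
    obtain c where c: "c \<in> D' - A' \<union> J'" "s = h' + card A' + card K' + card ((D' - A' \<union> J') \<inter> {c..})"
      and ec: "entry (dleft n Y) s = Some (Barred c)"
    proof (cases "the (entry (dleft n Y) s)")
      case (Unbarred b)
      then have "entry (dleft n Y) s = Some (Unbarred b)" using exL by auto
      then have "s = h' + cnt (A' \<union> K') b" unfolding LY eL by blast
      then show thesis using cnt_le_card[OF finL(1), of b] f'(20) s1(1) by simp
    next
      case Zero
      then have e: "entry (dleft n Y) s = Some Zero" using exL by auto
      then show thesis unfolding LY eL by auto
    next
      case (Barred e)
      then have e: "entry (dleft n Y) s = Some (Barred e)" using exL by auto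
      then show thesis using that[OF _ _ e] f'(20) unfolding LY eL by simp
    qed
    obtain e where e: "e \<in> D' \<union> K'" "s = h' + card A' + card ((D' \<union> K') \<inter> {e..})"
      and ee: "entry (dright n Y) s = Some (Barred e)"
    proof (cases "the (entry (dright n Y) s)")
      case (Unbarred b)
      then have "entry (dright n Y) s = Some (Unbarred b)" using exR by auto
      then have "s = h' + cnt (A' - D' \<union> J') b" unfolding RY eR by blast
      then show thesis using cnt_le_card[OF finR(1), of b] f'(18) s1(1) by simp
    next
      case Zero
      then have e: "entry (dright n Y) s = Some Zero" using exR by auto
      then show thesis unfolding RY eR by auto
    next
      case (Barred e)
      then have e: "entry (dright n Y) s = Some (Barred e)" using exR by auto
      then show thesis using that[OF _ _ e] f'(18) unfolding RY eR by simp
    qed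
    have le: "e \<le> c" using r1[OF ec ee] by simp
    have "\<forall>q. entry (dleft n Y) (Suc s) = Some q \<longrightarrow> Barred e < q" using r2[OF ee] by blast
    then have "h' + card (A' \<union> K') + card ((D' - A' \<union> J') \<inter> {e..}) < Suc s"
      unfolding LY using entry_greater_Barred[OF finL, of h' "Suc s" 0 e] h's by simp
    then have b4: "h' + card A' + card K' + card ((D' - A' \<union> J') \<inter> {e..}) \<le> s" using f'(20) by simp
    have cn: "c \<in> {1..n}" using c(1) f'(25) by blast
    note xb = X_bar[OF ec cn]
    have "\<exists>X' Y' M L N R. pair_step n s X Y X' Y' M L N R \<and> move2 n s c X Y X' Y' \<and> removed n s Y Y'"
      using pair_barred[OF d hs total d' h's c e le b4 xb]
      unfolding Xc[symmetric] Yc[symmetric] by blast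
    then show ?thesis unfolding row_move_def eY option.case letter.case using ec by blast
  qed
qed

section \<open>Slides in row \<open>s\<close>\<close>

lemma semistd_iff:
  "semistd n c \<longleftrightarrow> setA c \<subseteq> {1..n} \<and> setD c \<subseteq> {1..n} \<and>
     (\<exists>J. admissible_J n (setA c) (setD c) J) \<and> card (setA c) + card (setD c) + zeros c \<le> n"
proof -
  have "card (setA c \<union> setD c \<union> setJ n c) = card (setA c) + card (setD c)"
    if c: "setA c \<subseteq> {1..n}" "setD c \<subseteq> {1..n}" and ex: "\<exists>J. admissible_J n (setA c) (setD c) J"
  proof -
    obtain J where J: "matched n (setA c) (setD c) J" using matched_exists[OF c] ex by blast
    then show ?thesis unfolding setJ_def delta_eq(2)[OF J] by (rule card_matched(1))
  qed
  then show ?thesis unfolding semistd_def by metis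
qed

lemma sorted_list_upper_part:
  assumes "finite I" "I2 \<subseteq> I" "\<And>x y. x \<in> I2 \<Longrightarrow> y \<in> I - I2 \<Longrightarrow> y < x"
  shows "sorted_list_of_set I2 = drop (card (I - I2)) (sorted_list_of_set I)"
proof -
  have f: "finite I2" "finite (I - I2)" using assms(1,2) finite_subset by auto
  let ?l = "sorted_list_of_set (I - I2) @ sorted_list_of_set I2"
  have "sorted_wrt (<) ?l" using assms(3) f by (auto simp: sorted_wrt_append)
  then have "sorted ?l" "distinct ?l" using strict_sorted_iff by blast+
  moreover have "set ?l = I" using f assms(2) by auto
  ultimately have "sorted_list_of_set I = ?l"
    by (metis sorted_list_of_set.idem_if_sorted_distinct)
  then show ?thesis by simp
qed

text \<open>Erasing from the top removes the smallest letters of \<open>A\<close> and reaches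
  \<open>D\<close> only once \<open>A\<close> is used up. Keep the largest letters of
  \<open>J\<close>, as many as there are doubled letters left: both sorted lists lose initial
  segments of equal length, so the componentwise inequalities persist.\<close>

lemma semistd_truncate:
  assumes "semistd n c" and "A2 \<subseteq> setA c" "D2 = setD c \<or> A2 = {} \<and> D2 \<subseteq> setD c" "k2 \<le> zeros c"
    and up: "\<And>x y. x \<in> A2 \<Longrightarrow> y \<in> setA c - A2 \<Longrightarrow> y < x"
  shows "semistd n (Col h st A2 k2 D2)"
proof -
  note s = assms(1)[unfolded semistd_iff]
  have fin: "finite (setA c)" "finite (setD c)" using s by (meson finite_atLeastAtMost finite_subset)+
  have sub: "A2 \<subseteq> {1..n}" "D2 \<subseteq> {1..n}" using s assms(2,3) by auto
  have "card A2 \<le> card (setA c)" "card D2 \<le> card (setD c)"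
    using fin assms(2,3) by (auto intro: card_mono)
  then have le: "card A2 + card D2 + k2 \<le> n" using s assms(4) by linarith
  have "\<exists>J. admissible_J n A2 D2 J"
  proof (cases "A2 = {}")
    case True
    then have "admissible_J n A2 D2 {}" unfolding admissible_J_def by simp
    then show ?thesis ..
  next
    case False
    then have D2: "D2 = setD c" using assms(3) by blast
    obtain J where J: "admissible_J n (setA c) (setD c) J" using s by blast
    define I I2 where "I = setA c \<inter> setD c" and "I2 = A2 \<inter> setD c"
    have fI: "finite I" "I2 \<subseteq> I" unfolding I_def I2_def using fin assms(2) by auto
    have I2: "sorted_list_of_set I2 = drop (card (I - I2)) (sorted_list_of_set I)"
      by (rule sorted_list_upper_part[OF fI]) (use up in \<open>auto simp: I_def I2_def\<close>)
    have Jn: "J \<subseteq> {1..n} - (setA c \<union> setD c)" "card J = card I"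
      using J admissible_J_iff_cnt s unfolding I_def by auto
    have fJ: "finite J" using Jn(1) finite_subset by blast
    define J2 where "J2 = set (drop (card (I - I2)) (sorted_list_of_set J))"
    have sJ: "sorted_list_of_set J2 = drop (card (I - I2)) (sorted_list_of_set J)"
      unfolding J2_def
      by (rule sorted_list_of_set.idem_if_sorted_distinct) (auto intro: sorted_wrt_drop)
    have J2J: "J2 \<subseteq> J" unfolding J2_def using fJ by (metis set_drop_subset set_sorted_list_of_set)
    have c2: "card J2 = card J - card (I - I2)"
      using arg_cong[OF sJ, of length] by simp
    have cI: "card (I - I2) = card I - card I2" "card I2 \<le> card I"
      using fI by (auto simp: card_Diff_subset finite_subset intro: card_mono)
    have "admissible_J n A2 D2 J2"
      unfolding admissible_J_def D2 I2_def[symmetric]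
    proof (intro conjI allI impI)
      show "J2 \<subseteq> {1..n} - (A2 \<union> setD c - I2) - I2" using J2J Jn(1) assms(2) unfolding I2_def by auto
      show c: "card J2 = card I2" using c2 cI Jn(2) by simp
      fix i assume "i < card J2"
      then have "card (I - I2) + i < card J" using c2 by simp
      then show "sorted_list_of_set I2 ! i < sorted_list_of_set J2 ! i"
        unfolding I2 sJ using J Jn(2) unfolding admissible_J_def I_def[symmetric] by simp
    qed
    then show ?thesis ..
  qed
  then show ?thesis unfolding semistd_iff using sub le by simp
qed

lemma erase_facts:
  assumes c: "semistd n c" "empties c = 0" "star c = None" and h: "h \<le> height c"
  shows "semistd n (erase h c)" "empties (erase h c) = h" "star (erase h c) = None"
    "height (erase h c) = height c" "h < i \<Longrightarrow> entry (erase h c) i = entry c i"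
    "setD (erase h c) \<subseteq> setD c"
proof -
  define A D k where "A = setA c" "D = setD c" "k = zeros c"
  have cc: "c = Col 0 None A k D" using c(2,3) unfolding A_D_k_def by (cases c) auto
  note s = c(1)[unfolded semistd_iff, folded A_D_k_def]
  have fin: "finite A" "finite D" using s by (meson finite_atLeastAtMost finite_subset)+
  let ?lA = "sorted_list_of_set A" and ?lD = "sorted_list_of_set D"
  \<comment> \<open>With truncated subtraction, \<open>q\<close> is the number of erased barred
    letters, and 0 unless the erasure goes beyond all unbarred letters and zeros.\<close>
  define q where "q = h - card A - k"
  have ls: "drop h (letters c) = map Unbarred (drop h ?lA) @ replicate (k - (h - card A)) Zero @
      map Barred (drop q (rev ?lD))"
    unfolding letters_def cc q_def by (simp add: drop_map diff_diff_add)
  define A2 D2 where "A2 = set (drop h ?lA)" and "D2 = set (drop q (rev ?lD))"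
  have "count_list (map Unbarred l) Zero = 0" "count_list (map Barred l) Zero = 0"
    "count_list (replicate m Zero) Zero = m" for l :: "nat list" and m
    by (induction l) (induction m; simp)+
  then have e: "erase h c = Col h None A2 (k - (h - card A)) D2"
    unfolding erase_def ls Let_def A2_def D2_def by (auto simp: count_list_append)
  have lA: "sorted_list_of_set A2 = drop h ?lA"
    unfolding A2_def by (rule sorted_list_of_set.idem_if_sorted_distinct) (auto intro: sorted_wrt_drop)
  have D2': "D2 = set (take (card D - q) ?lD)" unfolding D2_def by (simp add: drop_rev)
  have lD: "sorted_list_of_set D2 = take (card D - q) ?lD"
    unfolding D2' by (rule sorted_list_of_set.idem_if_sorted_distinct) (auto intro: sorted_wrt_take)
  have ll: "letters (erase h c) = drop h (letters c)"
    unfolding ls unfolding e letters_def by (simp add: lA lD drop_rev)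
  have len: "length (letters c) = height c" using length_letters[of 0 None A k D] height_None[of 0 A k D] cc by simp
  show "empties (erase h c) = h" "star (erase h c) = None" unfolding e by simp_all
  have hh: "height (erase h c) = h + length (letters (erase h c))"
    unfolding e height_None length_letters by simp
  then show ht: "height (erase h c) = height c" unfolding ll using len h by simp
  show "setD (erase h c) \<subseteq> setD c" unfolding e A_D_k_def(2)[symmetric] D2' using fin(2) by (auto dest: in_set_takeD)
  have sub: "A2 \<subseteq> A" unfolding A2_def using fin(1) by (metis set_drop_subset set_sorted_list_of_set)
  have D2c: "D2 = D \<or> A2 = {} \<and> D2 \<subseteq> D"
  proof (cases "h < card A")
    case True
    then show ?thesis unfolding D2' q_def using fin(2) by simp
  next
    case False
    then show ?thesis unfolding D2' A2_def using fin(2) by (auto dest: in_set_takeD)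
  qed
  show "semistd n (erase h c)"
    unfolding e
  proof (rule semistd_truncate[OF c(1)], unfold A_D_k_def(1,2,3)[symmetric])
    fix x y assume x: "x \<in> A2" and y: "y \<in> A - A2"
    have "y \<in> set (take h ?lA)"
      using y fin(1) unfolding A2_def
      by (metis Diff_iff Un_iff append_take_drop_id set_append set_sorted_list_of_set)
    moreover have "sorted_wrt (<) (take h ?lA @ drop h ?lA)" using fin by simp
    ultimately show "y < x" using x unfolding A2_def sorted_wrt_append by blast
  qed (use sub D2c in auto)
  show "entry (erase h c) i = entry c i" if i: "h < i"
  proof -
    have 1: "entry (erase h c) i = (if i \<le> height c then Some (letters (erase h c) ! (i - Suc h)) else None)"
      using entry_None[of h A2 "k - (h - card A)" D2 i] height_None[of h A2 "k - (h - card A)" D2] i ht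
      unfolding e by simp
    have 2: "entry c i = (if i \<le> height c then Some (letters c ! (i - 1)) else None)"
      using entry_None[of 0 A k D i] height_None[of 0 A k D] i unfolding cc by simp
    show ?thesis unfolding 1 2 ll using h i len by simp
  qed
qed

lemma initial_segment:
  fixes X :: "nat set"
  assumes "finite X" "\<And>x y. x \<in> X \<Longrightarrow> 1 \<le> y \<Longrightarrow> y \<le> x \<Longrightarrow> y \<in> X" "0 \<notin> X"
  shows "X = {1..card X}"
proof (cases "X = {}")
  case False
  define m where "m = Max X"
  have m: "m \<in> X" "\<And>x. x \<in> X \<Longrightarrow> x \<le> m" unfolding m_def using assms(1) False by auto
  have "X = {1..m}"
  proof
    show "X \<subseteq> {1..m}" using m(2) assms(3) by (auto simp: Suc_le_eq intro: Nat.gr0I)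
    show "{1..m} \<subseteq> X" using assms(2)[OF m(1)] by auto
  qed
  then show ?thesis by simp
qed simp

lemma double_of_restarred:
  "dleft n (Col h' st' A k D) =
     Col h' st' (setA (dleft n (Col h st A k D))) 0 (setD (dleft n (Col h st A k D)))"
  "dright n (Col h' st' A k D) =
     Col h' st' (setA (dright n (Col h st A k D))) 0 (setD (dright n (Col h st A k D)))"
  by (simp_all add: dleft_def dright_def setB_def setC_def setK_def setJ_def setI_def)

lemma semistd_restarred: "semistd n (Col h st A k D) \<longleftrightarrow> semistd n (Col h' st' A k D)"
  unfolding semistd_iff by simp

lemma dble_unstar:
  "dleft n (unstar c) = unstar (dleft n c)" "dright n (unstar c) = unstar (dright n c)"
  "semistd n (unstar c) = semistd n c"
  unfolding semistd_iff
  by (simp_all add: unstar_def dleft_def dright_def setB_def setC_def setK_def setJ_def setI_def)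

lemma entry_at_star:
  assumes "h < s" "s \<le> Suc (h + card A + k + card D)"
  shows "entry (Col h (Some s) A k D) s = None"
  using assms
  by (auto simp: entry_def height_Some column_boxes_def Let_def nth_append length_letters min_def)

lemma double_disjoint:
  assumes "semistd n c"
  shows "dleft n (dleft n c) = dleft n c" "dright n (dleft n c) = dleft n c"
    "dleft n (dright n c) = dright n c" "dright n (dright n c) = dright n c"
    "height (dleft n c) = height c" "height (dright n c) = height c"
    "card (setA (dleft n c)) + card (setD (dleft n c)) = card (setA c) + zeros c + card (setD c)"
    "card (setA (dright n c)) + card (setD (dright n c)) = card (setA c) + zeros c + card (setD c)"
proof -
  note c = semistd_column(1,2,5,6)[OF assms]
  note f = doubled_facts[OF c(1)]
  show "dleft n (dleft n c) = dleft n c" "dright n (dleft n c) = dleft n c"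
    unfolding c(3) by (rule disjoint_column[OF f(24,25,22)])+
  show "dleft n (dright n c) = dright n c" "dright n (dright n c) = dright n c"
    unfolding c(4) by (rule disjoint_column[OF f(26,27,23)])+
  show "card (setA (dleft n c)) + card (setD (dleft n c)) = card (setA c) + zeros c + card (setD c)"
    "card (setA (dright n c)) + card (setD (dright n c)) = card (setA c) + zeros c + card (setD c)"
    unfolding c(3,4) using f(18-21) c(2) by simp_all
  have hc: "height c = empties c + (case star c of None \<Rightarrow> 0 | Some _ \<Rightarrow> 1) + card (setA c) + zeros c + card (setD c)" for c
    by (cases c; cases "star c") (auto simp: height_None height_Some)
  show "height (dleft n c) = height c" "height (dright n c) = height c"
    unfolding hc[of c] hc[of "dleft n c"] hc[of "dright n c"] unfolding c(3,4) using f(18-21) c(2) by simp_all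
qed

lemma entry_above_height: "height c < i \<Longrightarrow> entry c i = None"
  by (simp add: entry_def)

lemma height_col: "height c = empties c + (case star c of None \<Rightarrow> 0 | Some _ \<Rightarrow> 1) +
    card (setA c) + zeros c + card (setD c)"
  by (cases c; cases "star c") (auto simp: height_None height_Some)

lemma height_le:
  assumes "semistd n c" shows "card (setA c) + card (setD c) + zeros c \<le> n"
  using assms semistd_iff by blast


section \<open>Both slides combined\<close>

lemma tcol_map_upt: "1 \<le> j \<Longrightarrow> j \<le> N \<Longrightarrow> tcol (map f [1..<Suc N]) j = f j"
  by (simp del: upt_Suc)

text \<open>The right star runs from column \<open>2 * j0\<close> to \<open>2 * m\<close>, the left
  one from \<open>2 * j0 - 1\<close> to \<open>2 * m - 1\<close>, and the auxiliary columns
  alternate by parity. The right star sits in a right half at even positions and in a column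
  \<open>L\<close> at odd ones; the left star sits in a left half at odd positions and in a column
  \<open>R\<close> at even ones. The tableau \<open>V\<close> left by the first slide supplies the
  columns \<open>M\<close> and \<open>Q\<close> that the second one meets.\<close>

lemma ojdt_horizontal:
  fixes W :: tableau and Xc X' M L Q R :: "nat \<Rightarrow> col"
  assumes j0: "1 \<le> j0" "j0 \<le> m" "m \<le> length W"
    and W: "\<And>j. 1 \<le> j \<Longrightarrow> j \<le> length W \<Longrightarrow> semistd n (tcol W j)"
    and start: "Xc j0 = tcol W j0"
    and ps: "\<And>j. j0 \<le> j \<Longrightarrow> j < m \<Longrightarrow>
      pair_step n s (Xc j) (tcol W (Suc j)) (X' j) (Xc (Suc j)) (M j) (L j) (Q j) (R j)"
    and Xc: "\<And>j. j0 \<le> j \<Longrightarrow> j \<le> m \<Longrightarrow> semistd n (Xc j)"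
    and X': "\<And>j. j0 \<le> j \<Longrightarrow> j < m \<Longrightarrow> semistd n (X' j)"
    and last: "star (Xc m) = Some s" "height (Xc m) = s" "1 \<le> s"
    and beyond: "m < length W \<Longrightarrow> height (tcol W (Suc m)) < s"
  shows "\<exists>Rs Ls T'. ojdt n W s j0 Rs Ls T' \<and> (\<forall>(U, i, j) \<in> set Rs \<union> set Ls. i = s) \<and>
    (\<forall>j. j0 \<le> j \<longrightarrow> j < m \<longrightarrow>
       elementary_move n Rs Ls s j (Xc j) (tcol W (Suc j)) (X' j) (Xc (Suc j))) \<and>
    (\<forall>i j X Y X1 Y1. elementary_move n Rs Ls i j X Y X1 Y1 \<longrightarrow> j0 \<le> j \<and> j < m \<and> X = Xc j \<and>
       Y = tcol W (Suc j) \<and> X1 = X' j \<and> Y1 = Xc (Suc j))"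
proof -
  define N where "N = 2 * length W"
  define oldR where "oldR = (\<lambda>k. tcol (dble n W) k)"
  define stR where "stR = (\<lambda>k. if even k then dright n (Xc (k div 2)) else L (k div 2))"
  define newR where "newR = (\<lambda>k. if even k then M (k div 2) else Q (k div 2))"
  define UR where "UR = slide_tableau N (2 * j0) oldR stR newR"
  define V where "V = slide_tableau N (2 * j0) oldR (\<lambda>i. unstar (stR i)) newR (2 * m)"
  define oldL where "oldL = (\<lambda>k. tcol V k)"
  define stL where "stL = (\<lambda>k. if odd k then dleft n (Xc (Suc (k div 2))) else R (k div 2))"
  define newL where "newL = (\<lambda>k. if odd k then dleft n (X' (Suc (k div 2))) else dright n (X' (k div 2)))"
  define UL where "UL = slide_tableau N (2 * j0 - 1) oldL stL newL"
  define VL where "VL = slide_tableau N (2 * j0 - 1) oldL (\<lambda>i. unstar (stL i)) newL (2 * m - 1)"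
  define T' where "T' = map (\<lambda>j. if j0 \<le> j \<and> j < m then X' j else if j = m then unstar (Xc m)
    else tcol W j) [1..<Suc (length W)]"
  define Rs where "Rs = map (\<lambda>k. (UR k, s, k)) [2 * j0..<Suc (2 * m)]"
  define Ls where "Ls = map (\<lambda>k. (UL k, s, k)) [2 * j0 - 1..<Suc (2 * m - 1)]"
  have odd_ex: "\<exists>j. k = 2 * j - 1 \<and> 1 \<le> j" if "odd k" for k :: nat
    using that by (intro exI[of _ "Suc (k div 2)"]) (auto elim: oddE)
  have ev: "stR (2 * j) = dright n (Xc j)" "newR (2 * j) = M j" "stL (2 * j) = R j"
    "newL (2 * j) = dright n (X' j)" "stR (Suc (2 * j)) = L j" "newR (Suc (2 * j)) = Q j" for j
    unfolding stR_def newR_def stL_def newL_def by simp_all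
  have od: "stL (2 * j - 1) = dleft n (Xc j)" "newL (2 * j - 1) = dleft n (X' j)" if j: "1 \<le> j" for j
  proof -
    have "odd (2 * j - 1)" "Suc ((2 * j - 1) div 2) = j" using j by (cases j; simp)+
    then show "stL (2 * j - 1) = dleft n (Xc j)" "newL (2 * j - 1) = dleft n (X' j)"
      unfolding stL_def newL_def by simp_all
  qed
  have oR: "oldR (2 * j) = dright n (tcol W j)" "oldR (2 * j - 1) = dleft n (tcol W j)"
    if "1 \<le> j" "j \<le> length W" for j
    unfolding oldR_def using nth_dble[OF that, of n] by simp_all
  have lenW: "length (dble n W) = N" unfolding N_def length_dble ..
  have URt: "tcol (UR k) i = (if 2 * j0 \<le> i \<and> i < k then newR i else if i = k then stR i else oldR i)"
    if "1 \<le> i" "i \<le> N" for i k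
    unfolding UR_def using nth_slide[OF that] by simp
  have ULt: "tcol (UL k) i = (if 2 * j0 - 1 \<le> i \<and> i < k then newL i else if i = k then stL i else oldL i)"
    if "1 \<le> i" "i \<le> N" for i k
    unfolding UL_def using nth_slide[OF that] by simp
  have oL: "oldL i = (if 2 * j0 \<le> i \<and> i < 2 * m then newR i else if i = 2 * m then unstar (stR i) else oldR i)"
    if "1 \<le> i" "i \<le> N" for i
    unfolding oldL_def V_def using nth_slide[OF that] by simp
  have W0: "dble n W = UR (2 * j0)"
  proof (rule nth_equalityI)
    show "length (dble n W) = length (UR (2 * j0))" unfolding lenW UR_def by simp
    fix i assume "i < length (dble n W)"
    then have i: "1 \<le> Suc i" "Suc i \<le> N" unfolding lenW by simp_all
    have "oldR (2 * j0) = stR (2 * j0)" using oR(1)[of j0] j0 ev(1)[of j0] start by simp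
    then have "oldR (Suc i) = tcol (UR (2 * j0)) (Suc i)"
      unfolding URt[OF i] by (cases "Suc i = 2 * j0") auto
    then show "dble n W ! i = UR (2 * j0) ! i" by (simp add: oldR_def)
  qed
  have slideR: "sjdt n (dble n W, s, 2 * j0) Rs V"
    unfolding W0 Rs_def V_def UR_def
  proof (rule sjdt_slide)
    show "1 \<le> 2 * j0" "2 * j0 \<le> 2 * m" "2 * m \<le> N" using j0 unfolding N_def by auto
    fix k assume k: "2 * j0 \<le> k" "k < 2 * m"
    show "hstep n s (stR k) (oldR (Suc k)) (newR k) (stR (Suc k))"
    proof (cases "even k")
      case True
      then obtain j where j: "k = 2 * j" by (elim evenE)
      then have jj: "j0 \<le> j" "j < m" using k by auto
      have "Suc k = 2 * Suc j - 1" using j by simp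
      then have "oldR (Suc k) = dleft n (tcol W (Suc j))" using oR(2)[of "Suc j"] jj j0 by simp
      then show ?thesis using ps[OF jj] ev j unfolding pair_step_def by simp
    next
      case False
      then obtain j where j: "k = 2 * j + 1" by (elim oddE)
      then have jj: "j0 \<le> j" "j < m" using k by auto
      have "Suc k = 2 * Suc j" using j by simp
      then have "oldR (Suc k) = dright n (tcol W (Suc j))" "stR (Suc k) = dright n (Xc (Suc j))"
        using oR(1)[of "Suc j"] jj j0 ev(1)[of "Suc j"] by simp_all
      then show ?thesis using ps[OF jj] ev j unfolding pair_step_def by simp
    qed
  next
    note dd = double_disjoint[OF Xc[of m]]
    have "height (dright n (Xc m)) = s" using dd(6) last j0 by simp
    then show "entry (dright n (stR (2 * m))) (Suc s) = None"
      unfolding ev(1) using dd(4) j0 by (simp add: entry_above_height)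
    show "star (stR (2 * m)) = Some s" "zeros (stR (2 * m)) = 0"
      unfolding ev(1) using last by (simp_all add: dright_def)
    assume "2 * m < N"
    then have m: "m < length W" unfolding N_def by simp
    have "Suc (2 * m) = 2 * Suc m - 1" by simp
    then have o: "oldR (Suc (2 * m)) = dleft n (tcol W (Suc m))" using oR(2)[of "Suc m"] m by simp
    note dW = double_disjoint[OF W[of "Suc m"]]
    show "entry (dleft n (oldR (Suc (2 * m)))) s = None"
      unfolding o using dW(1,5) beyond[OF m] m by (simp add: entry_above_height)
  qed
  have lenV: "length V = N" unfolding V_def by simp
  have V0: "V = UL (2 * j0 - 1)"
  proof (rule nth_equalityI)
    show "length V = length (UL (2 * j0 - 1))" unfolding lenV UL_def by simp
    fix i assume "i < length V"
    then have i: "1 \<le> Suc i" "Suc i \<le> N" unfolding lenV by simp_all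
    have k: "1 \<le> 2 * j0 - 1" "2 * j0 - 1 \<le> N" "\<not> 2 * j0 \<le> 2 * j0 - 1" "2 * j0 - 1 \<noteq> 2 * m"
      using j0 unfolding N_def by auto
    have "oldL (2 * j0 - 1) = oldR (2 * j0 - 1)" using oL[OF k(1,2)] k(3,4) by simp
    also have "\<dots> = stL (2 * j0 - 1)" using oR(2)[of j0] od(1)[of j0] j0 start by simp
    finally have "oldL (Suc i) = tcol (UL (2 * j0 - 1)) (Suc i)"
      unfolding ULt[OF i] by (cases "Suc i = 2 * j0 - 1") auto
    then show "V ! i = UL (2 * j0 - 1) ! i" by (simp add: oldL_def)
  qed
  have slideL: "sjdt n (V, s, 2 * j0 - 1) Ls VL"
    unfolding Ls_def VL_def
    apply (subst V0) unfolding UL_def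
  proof (rule sjdt_slide)
    show "1 \<le> 2 * j0 - 1" "2 * j0 - 1 \<le> 2 * m - 1" "2 * m - 1 \<le> N" using j0 unfolding N_def by auto
    fix k assume k: "2 * j0 - 1 \<le> k" "k < 2 * m - 1"
    have kN: "1 \<le> Suc k" "Suc k \<le> N" using k j0 unfolding N_def by auto
    show "hstep n s (stL k) (oldL (Suc k)) (newL k) (stL (Suc k))"
    proof (cases "even k")
      case True
      then obtain j where j: "k = 2 * j" by (elim evenE)
      then have jj: "j0 \<le> j" "j < m" using k by auto
      have o: "oldL (Suc k) = Q j" using oL[OF kN] j jj ev(6)[of j] by simp
      have "Suc k = 2 * Suc j - 1" using j by simp
      then have "stL (Suc k) = dleft n (Xc (Suc j))" using od(1)[of "Suc j"] by simp
      then show ?thesis using ps[OF jj] ev(3,4)[of j] j o unfolding pair_step_def by simp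
    next
      case False
      then obtain j where j: "k = 2 * j - 1" "1 \<le> j" using odd_ex by blast
      then have jj: "j0 \<le> j" "j < m" using k by auto
      have sk: "Suc k = 2 * j" using j by simp
      have "oldL (Suc k) = M j" using oL[OF kN] sk jj ev(2)[of j] by simp
      then show ?thesis using ps[OF jj] od[OF j(2)] ev(3)[of j] j(1) sk unfolding pair_step_def by simp
    qed
  next
    note dd = double_disjoint[OF Xc[of m]]
    have m1: "1 \<le> m" using j0 by simp
    have "height (dleft n (Xc m)) = s" using dd(5) last j0 by simp
    then show "entry (dright n (stL (2 * m - 1))) (Suc s) = None"
      unfolding od(1)[OF m1] using dd(2) j0 by (simp add: entry_above_height)
    show "star (stL (2 * m - 1)) = Some s" "zeros (stL (2 * m - 1)) = 0"
      unfolding od(1)[OF m1] using last by (simp_all add: dleft_def)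
    have sm: "Suc (2 * m - 1) = 2 * m" using m1 by simp
    have o: "oldL (2 * m) = unstar (dright n (Xc m))"
      using oL[of "2 * m"] j0 m1 ev(1)[of m] unfolding N_def by simp
    have h: "height (dright n (Xc m)) = s" "star (dright n (Xc m)) = Some s"
      using dd(6) last j0 by (simp_all add: dright_def)
    \<comment> \<open>Column \<open>2 * m\<close> has already lost its star, so its height is below
      \<open>s\<close> and it offers nothing in row \<open>s\<close> to the left star.\<close>
    have "height (unstar (dright n (Xc m))) < s"
      using h height_col[of "dright n (Xc m)"] height_col[of "unstar (dright n (Xc m))"]
      by (simp add: unstar_def)
    then show "entry (dleft n (oldL (Suc (2 * m - 1)))) s = None"
      unfolding sm o dble_unstar(1) using dd(3) j0 by (simp add: entry_above_height)
  qed
  have lenT: "length T' = length W" unfolding T'_def by (simp del: upt_Suc)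
  have T't: "tcol T' j = (if j0 \<le> j \<and> j < m then X' j else if j = m then unstar (Xc m) else tcol W j)"
    if "1 \<le> j" "j \<le> length W" for j
    unfolding T'_def by (rule tcol_map_upt[OF that])
  have VLt: "tcol VL i = (if 2 * j0 - 1 \<le> i \<and> i < 2 * m - 1 then newL i
      else if i = 2 * m - 1 then unstar (stL i) else oldL i)" if "1 \<le> i" "i \<le> N" for i
    unfolding VL_def using nth_slide[OF that] by simp
  have VLd: "VL = dble n T'"
  proof (rule nth_equalityI)
    show "length VL = length (dble n T')" unfolding length_dble lenT VL_def N_def by simp
    fix i assume "i < length VL"
    then have i: "1 \<le> Suc i" "Suc i \<le> N" unfolding VL_def by simp_all
    have "tcol VL (Suc i) = tcol (dble n T') (Suc i)"
    proof (cases "even (Suc i)")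
      case True
      then obtain j where j: "Suc i = 2 * j" by (elim evenE)
      then have jj: "1 \<le> j" "j \<le> length W" using i unfolding N_def by auto
      have d: "tcol (dble n T') (2 * j) = dright n (tcol T' j)" using nth_dble(2)[of j T'] jj lenT by simp
      have cond: "(2 * j0 - 1 \<le> 2 * j) = (j0 \<le> j)" "(2 * j < 2 * m - 1) = (j < m)"
        "(2 * j = 2 * m - 1) = False" "(2 * j0 \<le> 2 * j) = (j0 \<le> j)"
        "(2 * j < 2 * m) = (j < m)" "(2 * j = 2 * m) = (j = m)"
        using jj j0 by presburger+
      have "tcol VL (2 * j) = dright n (tcol T' j)"
        using VLt[OF i] oL[OF i] ev(1,4)[of j] oR(1)[OF jj] dble_unstar(2) j0(2)
        unfolding j cond T't[OF jj] by (cases "j < m") (auto split: if_splits)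
      then show ?thesis unfolding j d .
    next
      case False
      then obtain j where j: "Suc i = 2 * j - 1" "1 \<le> j" using odd_ex by blast
      then have jj: "1 \<le> j" "j \<le> length W" using i unfolding N_def by auto
      have d: "tcol (dble n T') (2 * j - 1) = dleft n (tcol T' j)" using nth_dble(1)[of j T'] jj lenT by simp
      have cond: "(2 * j0 - 1 \<le> 2 * j - 1) = (j0 \<le> j)" "(2 * j - 1 < 2 * m - 1) = (j < m)"
        "(2 * j - 1 = 2 * m - 1) = (j = m)" "(2 * j0 \<le> 2 * j - 1) = (j0 < j)"
        "(2 * j - 1 < 2 * m) = (j \<le> m)" "(2 * j - 1 = 2 * m) = False"
        using jj j0 by presburger+
      have "tcol VL (2 * j - 1) = dleft n (tcol T' j)"
        using VLt[OF i] oL[OF i] od[OF jj(1)] oR(2)[OF jj] dble_unstar(1) j0(2)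
        unfolding j(1) cond T't[OF jj] by (cases "j < m") (auto split: if_splits)
      then show ?thesis unfolding j(1) d .
    qed
    then show "VL ! i = dble n T' ! i" by simp
  qed
  have "semistd n c" if c: "c \<in> set T'" for c
  proof -
    obtain i where i: "i < length W" "c = T' ! i"
      using c lenT by (metis in_set_conv_nth)
    define j where "j = Suc i"
    have j: "1 \<le> j" "j \<le> length W" "c = tcol T' j" using i unfolding j_def by simp_all
    show ?thesis unfolding j(3) T't[OF j(1,2)] using X'[of j] Xc[of m] j0 W[OF j(1,2)] dble_unstar(3) by auto
  qed
  then have oj: "ojdt n W s j0 Rs Ls T'" unfolding ojdt_def using slideR slideL VLd by blast
  have rows: "\<forall>(U, i, j) \<in> set Rs \<union> set Ls. i = s" unfolding Rs_def Ls_def by auto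
  have inR: "(U, i, k) \<in> set Rs \<longleftrightarrow> U = UR k \<and> i = s \<and> 2 * j0 \<le> k \<and> k \<le> 2 * m" for U i k
    unfolding Rs_def by (auto simp del: upt_Suc)
  have inL: "(U, i, k) \<in> set Ls \<longleftrightarrow> U = UL k \<and> i = s \<and> 2 * j0 - 1 \<le> k \<and> k \<le> 2 * m - 1" for U i k
    unfolding Ls_def by (auto simp del: upt_Suc)
  have cols: "dleft n (Xc j) = tcol (UL (2 * j - 1)) (2 * j - 1)" "dright n (Xc j) = tcol (UR (2 * j)) (2 * j)"
     "dleft n (tcol W (Suc j)) = tcol (UR (2 * j)) (2 * j + 1)"
     "dright n (tcol W (Suc j)) = tcol (UR (2 * j)) (2 * j + 2)"
     "dleft n (X' j) = tcol (UL (2 * j + 1)) (2 * j - 1)" "dright n (X' j) = tcol (UL (2 * j + 1)) (2 * j)"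
     "dleft n (Xc (Suc j)) = tcol (UL (2 * j + 1)) (2 * j + 1)"
     "dright n (Xc (Suc j)) = tcol (UR (2 * j + 2)) (2 * j + 2)"
    if j: "j0 \<le> j" "j < m" for j
  proof -
    have N: "2 * j + 2 \<le> N" "1 \<le> j" using j j0 unfolding N_def by auto
    have e: "2 * Suc j = 2 * j + 2" "2 * Suc j - 1 = 2 * j + 1" by simp_all
    note o1 = oR(1)[of "Suc j", unfolded e] and o2 = oR(2)[of "Suc j", unfolded e]
      and s1 = ev(1)[of "Suc j", unfolded e] and l1 = od(1)[of "Suc j", unfolded e]
    show "dleft n (Xc j) = tcol (UL (2 * j - 1)) (2 * j - 1)" using ULt[of "2 * j - 1" "2 * j - 1"] N od(1) by simp
    show "dright n (Xc j) = tcol (UR (2 * j)) (2 * j)" using URt[of "2 * j" "2 * j"] N ev(1) by simp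
    show "dleft n (tcol W (Suc j)) = tcol (UR (2 * j)) (2 * j + 1)"
      using URt[of "2 * j + 1" "2 * j"] N o2 j j0 by simp
    show "dright n (tcol W (Suc j)) = tcol (UR (2 * j)) (2 * j + 2)"
      using URt[of "2 * j + 2" "2 * j"] N o1 j j0 by simp
    have a1: "2 * j0 - 1 \<le> 2 * j - 1 \<and> 2 * j - 1 < 2 * j + 1" using j j0 by (intro conjI) linarith+
    show "dleft n (X' j) = tcol (UL (2 * j + 1)) (2 * j - 1)"
      using ULt[of "2 * j - 1" "2 * j + 1"] N od(2)[of j] a1 by simp
    have a2: "2 * j0 - 1 \<le> 2 * j \<and> 2 * j < 2 * j + 1" using j by (intro conjI) linarith+
    show "dright n (X' j) = tcol (UL (2 * j + 1)) (2 * j)" using ULt[of "2 * j" "2 * j + 1"] N ev(4) a2 by simp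
    show "dleft n (Xc (Suc j)) = tcol (UL (2 * j + 1)) (2 * j + 1)"
      using ULt[of "2 * j + 1" "2 * j + 1"] N l1 by simp
    show "dright n (Xc (Suc j)) = tcol (UR (2 * j + 2)) (2 * j + 2)"
      using URt[of "2 * j + 2" "2 * j + 2"] N s1 by simp
  qed
  have em: "elementary_move n Rs Ls s j (Xc j) (tcol W (Suc j)) (X' j) (Xc (Suc j))"
    if j: "j0 \<le> j" "j < m" for j
    unfolding elementary_move_def
  proof (intro conjI exI)
    show "(UR (2 * j), s, 2 * j) \<in> set Rs" "(UR (2 * j + 2), s, 2 * j + 2) \<in> set Rs"
      "(UL (2 * j - 1), s, 2 * j - 1) \<in> set Ls" "(UL (2 * j + 1), s, 2 * j + 1) \<in> set Ls"
      unfolding inR inL using j j0 by auto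
  qed (use j j0 Xc X' W[of "Suc j"] cols[OF j] in auto)
  \<comment> \<open>Each position occurs in exactly one state of each slide, so the states
    witnessing a move are known, and their halves identify its four columns.\<close>
  have un: "j0 \<le> j \<and> j < m \<and> X = Xc j \<and> Y = tcol W (Suc j) \<and> X1 = X' j \<and> Y1 = Xc (Suc j)"
    if h: "elementary_move n Rs Ls i j X Y X1 Y1" for i j X Y X1 Y1
  proof -
    have j1: "1 \<le> j" and ss: "semistd n X" "semistd n Y" "semistd n X1" "semistd n Y1"
      using h unfolding elementary_move_def by blast+
    obtain U0 U1 V0 V1 where u: "(U0, i, 2 * j) \<in> set Rs" "(U1, i, 2 * j + 2) \<in> set Rs"
        "(V0, i, 2 * j - 1) \<in> set Ls" "(V1, i, 2 * j + 1) \<in> set Ls"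
        "dleft n X = tcol V0 (2 * j - 1)" "dright n X = tcol U0 (2 * j)"
        "dleft n Y = tcol U0 (2 * j + 1)" "dright n Y = tcol U0 (2 * j + 2)"
        "dleft n X1 = tcol V1 (2 * j - 1)" "dright n X1 = tcol V1 (2 * j)"
        "dleft n Y1 = tcol V1 (2 * j + 1)" "dright n Y1 = tcol U1 (2 * j + 2)"
      using h unfolding elementary_move_def by blast
    have jj: "j0 \<le> j" "j < m" using u(1,2) unfolding inR by auto
    have uu: "U0 = UR (2 * j)" "U1 = UR (2 * j + 2)" "V0 = UL (2 * j - 1)" "V1 = UL (2 * j + 1)"
      using u(1-4) unfolding inR inL by blast+
    note c = cols[OF jj, folded uu]
    have "X = Xc j" by (rule doubles_injective[OF ss(1) Xc]) (use jj c u in simp_all)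
    moreover have "Y = tcol W (Suc j)" by (rule doubles_injective[OF ss(2) W[of "Suc j"]]) (use jj j0 c u in simp_all)
    moreover have "X1 = X' j" by (rule doubles_injective[OF ss(3) X']) (use jj c u in simp_all)
    moreover have "Y1 = Xc (Suc j)" by (rule doubles_injective[OF ss(4) Xc]) (use jj c u in simp_all)
    ultimately show ?thesis using jj by blast
  qed
  show ?thesis using oj rows em un by blast
qed

section \<open>What the tableau provides\<close>

lemma removed_card:
  assumes "removed n s C X" "semistd n C" "semistd n X" "star C = None"
  shows "Suc (card (setA X) + zeros X + card (setD X)) = card (setA C) + zeros C + card (setD C)"
proof -
  define J K where JK: "J = setJ n C" "K = setK n C"
  note dC = semistd_column[OF assms(2), folded JK]
  note d = dC(1) and B = dC(4) JK(2)[symmetric] and R = dC(6)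
  note f = doubled_facts[OF d]
  have fin: "finite (setA C - setD C \<union> J)" "finite (setD C \<union> K)" using f(14-17) by auto
  note cC = double_disjoint(8)[OF assms(2)] and cX = double_disjoint(8)[OF assms(3)]
  \<comment> \<open>A right half has as many letters as its column, so a letter lost from the half
    is a letter lost from the column. The star compensates for it in the height.\<close>
  have "Suc (card (setB n X) + card (setD X \<union> setK n X)) =
      card (setA C - setD C \<union> J) + card (setD C \<union> K)"
    using assms(1) unfolding removed_def B R assms(4) entry_iff[OF fin]
  proof (elim disjE exE conjE)
    fix b assume b: "b \<in> setA C - setD C \<union> J" "setB n X = setA C - setD C \<union> J - {b}"
      "setD X \<union> setK n X = setD C \<union> K"
    show ?thesis unfolding b(2,3) using card_Suc_Diff1[OF fin(1) b(1)] by simp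
  next
    fix b assume b: "b \<in> setD C \<union> K" "setB n X = setA C - setD C \<union> J"
      "setD X \<union> setK n X = setD C \<union> K - {b}"
    show ?thesis unfolding b(2,3) using card_Suc_Diff1[OF fin(2) b(1)] by simp
  qed
  then show ?thesis using cC cX B by (simp add: dright_def)
qed

text \<open>The unbarred letters end in row \<open>h + card A\<close> of the right half but in row
  \<open>h + card A + card K\<close> of the left half. Zeros in rows \<open>s\<close> and
  \<open>s + 1\<close> would put a barred letter in row \<open>s\<close> of the right half and an
  unbarred one in row \<open>s + 1\<close> of the left half, against the strict inequality.\<close>

lemma no_adjacent_zeros:
  assumes Y: "semistd n Y" "star Y = None"
    and r2: "\<And>x y. entry (dright n Y) s = Some x \<Longrightarrow> entry (dleft n Y) (Suc s) = Some y \<Longrightarrow> x < y"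
  shows "\<not> (entry Y s = Some Zero \<and> entry Y (Suc s) = Some Zero)"
proof
  assume z: "entry Y s = Some Zero \<and> entry Y (Suc s) = Some Zero"
  define A D h J K where Y_sets: "A = setA Y" "D = setD Y" "h = empties Y" "J = setJ n Y" "K = setK n Y"
  note d = semistd_column(1,3,5,6)[OF Y(1), unfolded Y(2), folded Y_sets]
  note f = doubled_facts[OF d(1)]
  have 1: "h + card A < s" "Suc s \<le> h + card A + card K"
    using z d(2) entry_iff(2)[OF f(14,15), of h "card K"] by auto
  have fR: "finite (A - D \<union> J)" "finite (D \<union> K)" and fL: "finite (A \<union> K)" "finite (D - A \<union> J)"
    using f(14-17) by auto
  have "entry (dright n Y) s \<noteq> None"
    unfolding d(4) using entry_iff(4)[OF fR, of h 0 s] 1 f(18,21) by auto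
  moreover have "\<And>a. entry (dright n Y) s \<noteq> Some (Unbarred a)"
    unfolding d(4) entry_iff[OF fR] using cnt_le_card[OF fR(1)] f(18) 1
    by (metis add_le_cancel_left not_le)
  moreover have "entry (dright n Y) s \<noteq> Some Zero" unfolding d(4) entry_iff[OF fR] by simp
  ultimately obtain e where e: "entry (dright n Y) s = Some (Barred e)"
    by (metis letter.exhaust option.exhaust)
  have "entry (dleft n Y) (Suc s) \<noteq> None"
    unfolding d(3) using entry_iff(4)[OF fL, of h 0 "Suc s"] 1 f(20) by auto
  moreover have "\<And>a. entry (dleft n Y) (Suc s) \<noteq> Some (Barred a)"
  proof
    fix a assume "entry (dleft n Y) (Suc s) = Some (Barred a)"
    then have a: "a \<in> D - A \<union> J" "Suc s = h + card (A \<union> K) + 0 + card ((D - A \<union> J) \<inter> {a..})"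
      unfolding d(3) entry_iff[OF fL] by blast+
    have "0 < card ((D - A \<union> J) \<inter> {a..})" using a(1) fL(2) by (auto simp: card_gt_0_iff simp del: Un_iff)
    then show False using a(2) 1 f(20) by simp
  qed
  moreover have "entry (dleft n Y) (Suc s) \<noteq> Some Zero" unfolding d(3) entry_iff[OF fL] by simp
  ultimately obtain u where u: "entry (dleft n Y) (Suc s) = Some (Unbarred u)"
    by (metis letter.exhaust option.exhaust)
  show False using r2[OF e u] by simp
qed

text \<open>To be applied before erasing, where the starting column still has a letter in row
  \<open>s\<close>. In its right half this letter is at most the one in the left half of the next
  column, which is at most \<open>a\<close>. So it is an unbarred letter of \<open>B\<close>, and
  \<open>B\<close> is disjoint from \<open>D\<close>.\<close>

lemma first_column_witness:
  assumes P: "semistd n P" "star P = None" "empties P = 0" "1 \<le> s" "s \<le> height P"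
    and Q: "semistd n Q" "star Q = None" "empties Q = 0" "entry Q s = Some (Unbarred a)"
    and r: "\<And>x y. entry (dright n P) s = Some x \<Longrightarrow> entry (dleft n Q) s = Some y \<Longrightarrow> x \<le> y"
  shows "\<exists>b \<in> {1..n}. b \<le> a \<and> b \<notin> setD P"
proof -
  define J K where P_sets: "J = setJ n P" "K = setK n P"
  note d = semistd_column(1,2,6)[OF P(1), unfolded P(2,3), folded P_sets]
  define A' D' J' K' where Q_sets: "A' = setA Q" "D' = setD Q" "J' = setJ n Q" "K' = setK n Q"
  note d' = semistd_column(1,3,5)[OF Q(1), unfolded Q(2,3), folded Q_sets]
  note f = doubled_facts[OF d(1)] and f' = doubled_facts[OF d'(1)]
  have fR: "finite (setA P - setD P \<union> J)" "finite (setD P \<union> K)" using f(14-17) by auto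
  have fL: "finite (A' \<union> K')" "finite (D' - A' \<union> J')" using f'(14-17) by auto
  have a: "a \<in> A'" "s = cnt A' a" using Q(4) d'(2) entry_iff(1)[OF f'(14,15), of 0 "card K'" s a] by auto
  \<comment> \<open>Adding \<open>K'\<close> to \<open>A'\<close> can only push letters down, so the
    letter in row \<open>s\<close> of the left half does not exceed \<open>a\<close>.\<close>
  have c: "s \<le> cnt (A' \<union> K') a" unfolding a(2) by (rule cnt_mono) auto
  have "entry (dleft n Q) s \<noteq> None"
    unfolding d'(3) using entry_iff(4)[OF fL, of 0 0 s] P(4) c cnt_le_card[OF fL(1), of a] by auto
  moreover have "\<not> Unbarred a < q" if "entry (dleft n Q) s = Some q" for q
  proof -
    have "\<not> 0 + cnt (A' \<union> K') a < s" using c by simp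
    then obtain q2 where "entry (dleft n Q) s = Some q2" "\<not> Unbarred a < q2"
      using entry_greater_Unbarred[OF fL, of 0 s 0 a] P(4) unfolding d'(3) by auto
    then show ?thesis using that by simp
  qed
  ultimately obtain q where q: "entry (dleft n Q) s = Some q" "\<not> Unbarred a < q" by auto
  have hP: "s \<le> card (setA P) + zeros P + card (setD P)" using P(5) height_col[of P] P(2,3) by simp
  have "entry (dright n P) s \<noteq> None"
    unfolding d(3) using entry_iff(4)[OF fR, of 0 0 s] P(4) hP f(18,21) d(2) by auto
  then obtain y where y: "entry (dright n P) s = Some y" by auto
  have "y \<le> Unbarred a" using r[OF y q(1)] q(2) by simp
  then obtain b where b: "y = Unbarred b" "b \<le> a" by (cases y) auto
  have e: "entry (dright n P) s = Some (Unbarred b)" using y b(1) by simp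
  have "b \<in> setA P - setD P \<union> J" using e unfolding d(3) entry_iff[OF fR] by (rule conjunct1)
  then have "b \<in> {1..n}" "b \<notin> setD P" using f(26) f(7) by blast+
  then show ?thesis using b(2) by blast
qed

text \<open>Trades the diagram \<open>S\<close> for data on single columns and for the rows of the
  two doubles, the only form in which it enters the slides.\<close>

lemma skew_setup:
  fixes n s j0 :: nat and T W :: tableau and S :: "(nat \<times> nat) set"
  assumes "skew_orthogonal_semistandard n T S" "interior_corner S (s, j0)"
    and W: "W = starred_skew T S s j0"
  shows "1 \<le> s" "1 \<le> j0" "j0 \<le> length T" "s \<le> height (tcol T j0)" "length W = length T"
    "\<And>j. 1 \<le> j \<Longrightarrow> j \<le> length T \<Longrightarrow> semistd n (tcol T j) \<and> star (tcol T j) = None \<and> empties (tcol T j) = 0"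
    "\<And>j k. 1 \<le> j \<Longrightarrow> j \<le> k \<Longrightarrow> k \<le> length T \<Longrightarrow> height (tcol T k) \<le> height (tcol T j)"
    "\<And>j. 1 \<le> j \<Longrightarrow> j \<le> length T \<Longrightarrow> semistd n (tcol W j) \<and> height (tcol W j) = height (tcol T j)"
    "star (tcol W j0) = Some s" "empties (tcol W j0) = s - 1" "setD (tcol W j0) \<subseteq> setD (tcol T j0)"
    "\<And>j. 1 \<le> j \<Longrightarrow> j \<le> length T \<Longrightarrow> j \<noteq> j0 \<Longrightarrow> star (tcol W j) = None"
    "\<And>j. j0 < j \<Longrightarrow> j \<le> length T \<Longrightarrow> empties (tcol W j) < s \<and> entry (tcol W j) s = entry (tcol T j) s"
    "rows_weakly_increasing (dble n W)" "rows_weakly_increasing (dble n T)"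
proof -
  have oT: "orthogonal_tableau n T" and yd: "young_diagram S" and ST: "S \<subseteq> tboxes T"
    and rS: "rows_weakly_increasing (dble n (skew T S))" and rT: "rows_weakly_increasing (dble n T)"
    using assms(1) unfolding skew_orthogonal_semistandard_def orthogonal_semistandard_def by blast+
  show "rows_weakly_increasing (dble n T)" by (rule rT)
  have cor: "(s, j0) \<in> S" "(s, Suc j0) \<notin> S" "(Suc s, j0) \<notin> S"
    using assms(2) unfolding interior_corner_def by auto
  have box: "1 \<le> j \<and> j \<le> length T \<and> 1 \<le> i \<and> i \<le> height (tcol T j)" if "(i, j) \<in> S" for i j
    using that ST unfolding tboxes_def by auto
  show s1: "1 \<le> s" and j1: "1 \<le> j0" "j0 \<le> length T" and sh: "s \<le> height (tcol T j0)" using box[OF cor(1)] by auto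
  have down: "(i', j') \<in> S" if "(i, j) \<in> S" "1 \<le> i'" "i' \<le> i" "1 \<le> j'" "j' \<le> j" for i j i' j'
    using yd that unfolding young_diagram_def by fastforce
  define hh where "hh j = card {i. (i, j) \<in> S}" for j
  \<comment> \<open>\<open>erase\<close> sees only the number of boxes of \<open>S\<close> in a
    column; for a Young diagram they are the topmost ones, so the number determines them.\<close>
  have seg: "{i. (i, j) \<in> S} = {1..hh j}" for j
    unfolding hh_def
  proof (rule initial_segment)
    have "{i. (i, j) \<in> S} \<subseteq> fst ` S" by force
    then show "finite {i. (i, j) \<in> S}" using yd finite_subset unfolding young_diagram_def by blast
    show "0 \<notin> {i. (i, j) \<in> S}" using box[of 0 j] by auto
    fix x y assume "x \<in> {i. (i, j) \<in> S}" "1 \<le> y" "y \<le> x"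
    then show "y \<in> {i. (i, j) \<in> S}" using down[of x j y j] box[of x j] by simp
  qed
  have inS: "(i, j) \<in> S \<longleftrightarrow> 1 \<le> i \<and> i \<le> hh j" for i j
    using arg_cong[OF seg[of j], of "\<lambda>X. i \<in> X"] by simp
  have h0: "hh j0 = s" using cor(1,3) unfolding inS by simp
  have hT: "hh j \<le> height (tcol T j)" for j
  proof (cases "hh j = 0")
    case False
    then have "(hh j, j) \<in> S" unfolding inS by simp
    then show ?thesis using box by blast
  qed simp
  \<comment> \<open>With \<open>s\<close> empty boxes in a later column the box
    \<open>(s, j0 + 1)\<close> would lie in \<open>S\<close>, against the interior corner.\<close>
  have h_later: "hh j < s" if "j0 < j" for j
  proof (rule ccontr)
    assume "\<not> hh j < s"
    then have "(s, j) \<in> S" unfolding inS using s1 by simp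
    then have "(s, Suc j0) \<in> S" using down[of s j s "Suc j0"] s1 that by simp
    then show False using cor(2) by simp
  qed
  show cT: "semistd n (tcol T j) \<and> star (tcol T j) = None \<and> empties (tcol T j) = 0"
    if "1 \<le> j" "j \<le> length T" for j
    using oT that unfolding orthogonal_tableau_def by simp
  show "height (tcol T k) \<le> height (tcol T j)" if "1 \<le> j" "j \<le> k" "k \<le> length T" for j k
  proof (cases "j = k")
    case False
    have "sorted_wrt (\<ge>) (map height T)" using oT unfolding orthogonal_tableau_def by blast
    from sorted_wrt_nth_less[OF this, of "j - 1" "k - 1"] show ?thesis using that False by simp
  qed simp
  have lS: "length (skew T S) = length T" unfolding skew_def by (simp del: upt_Suc)
  have nS: "tcol (skew T S) j = erase (hh j) (tcol T j)" if "1 \<le> j" "j \<le> length T" for j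
    unfolding skew_def hh_def by (rule tcol_map_upt[OF that])
  have eS: "semistd n (tcol (skew T S) j) \<and> empties (tcol (skew T S) j) = hh j \<and> star (tcol (skew T S) j) = None \<and>
      height (tcol (skew T S) j) = height (tcol T j) \<and> setD (tcol (skew T S) j) \<subseteq> setD (tcol T j) \<and>
      (\<forall>i > hh j. entry (tcol (skew T S) j) i = entry (tcol T j) i)"
    if j: "1 \<le> j" "j \<le> length T" for j
  proof -
    have c: "semistd n (tcol T j)" "empties (tcol T j) = 0" "star (tcol T j) = None" using cT[OF j] by auto
    note e = erase_facts[OF c hT]
    show ?thesis unfolding nS[OF j] by (intro conjI allI impI e)
  qed
  show lW: "length W = length T" unfolding W starred_skew_def Let_def using lS by simp
  have nW: "tcol W j = tcol (skew T S) j" if "j \<noteq> j0" "1 \<le> j" for j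
    unfolding W starred_skew_def Let_def using that j1 by (simp add: nth_list_update)
  let ?c = "tcol (skew T S) j0"
  have nW0: "tcol W j0 = Col (s - 1) (Some s) (setA ?c) (zeros ?c) (setD ?c)"
    unfolding W starred_skew_def Let_def using j1 lS by simp
  have c0: "?c = Col s None (setA ?c) (zeros ?c) (setD ?c)" using eS[OF j1] h0 by (cases ?c) auto
  show "star (tcol W j0) = Some s" "empties (tcol W j0) = s - 1" "setD (tcol W j0) \<subseteq> setD (tcol T j0)"
    unfolding nW0 using eS[OF j1] by auto
  show "semistd n (tcol W j) \<and> height (tcol W j) = height (tcol T j)" if j: "1 \<le> j" "j \<le> length T" for j
  proof (cases "j = j0")
    case True
    have "semistd n (tcol W j0)"
      unfolding nW0 using eS[OF j1] semistd_restarred[of n s None "setA ?c" "zeros ?c" "setD ?c"] c0 by metis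
    moreover have "height (tcol W j0) = height ?c"
      unfolding nW0 height_col using eS[OF j1] h0 s1 by simp
    ultimately show ?thesis using True eS[OF j1] by simp
  next
    case False
    then show ?thesis using nW[OF False j(1)] eS[OF j] by simp
  qed
  show "star (tcol W j) = None" if "1 \<le> j" "j \<le> length T" "j \<noteq> j0" for j
    using nW[OF that(3,1)] eS[OF that(1,2)] by simp
  show "empties (tcol W j) < s \<and> entry (tcol W j) s = entry (tcol T j) s" if "j0 < j" "j \<le> length T" for j
    using nW[of j] eS[of j] that j1 h_later[OF that(1)] by simp
  \<comment> \<open>A star directly beneath the empty boxes acts on entries like one more empty box,
    so starring does not affect the rows of the double.\<close>
  have te: "tentry (dble n W) i k = tentry (dble n (skew T S)) i k" for i k
  proof (cases "1 \<le> k \<and> k \<le> 2 * length T")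
    case True
    define j where "j = (k + 1) div 2"
    have j: "1 \<le> j" "j \<le> length T" and k: "k = 2 * j - 1 \<or> k = 2 * j"
      using True unfolding j_def by presburger+
    have lv: "j \<le> length W" "j \<le> length (skew T S)" using j lW lS by simp_all
    have "entry (dleft n (tcol W j)) i = entry (dleft n (tcol (skew T S) j)) i \<and>
      entry (dright n (tcol W j)) i = entry (dright n (tcol (skew T S) j)) i"
    proof (cases "j = j0")
      case True
      have "entry (dleft n (tcol W j0)) i = entry (dleft n ?c) i"
        unfolding nW0 using entry_star_top[OF s1]
        by (subst c0, subst (1 2) double_of_restarred(1)[of n _ _ _ _ _ 0 None]) simp
      moreover have "entry (dright n (tcol W j0)) i = entry (dright n ?c) i"
        unfolding nW0 using entry_star_top[OF s1]
        by (subst c0, subst (1 2) double_of_restarred(2)[of n _ _ _ _ _ 0 None]) simp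
      ultimately show ?thesis using True by simp
    next
      case False
      then show ?thesis using nW[OF False j(1)] by simp
    qed
    then show ?thesis
      using k tentry_dble[OF j(1) lv(1), of n i] tentry_dble[OF j(1) lv(2), of n i] by auto
  next
    case False
    then show ?thesis unfolding tentry_def length_dble lW lS by auto
  qed
  show "rows_weakly_increasing (dble n W)" using rS unfolding rows_weakly_increasing_def te .
qed

lemma row_move_properties:
  assumes "row_move n s X Y X' Y'"
  shows "semistd n X'" "semistd n Y'" "star Y' = Some s" "empties Y' = empties Y"
  using assms unfolding row_move_def
  by (auto split: option.splits letter.splits simp: move1_def move2_def move3_def is_f_def is_g_def)

section \<open>The slide along row \<open>s\<close>\<close>

theorem theorem6p3:
  fixes n s j0 :: nat and T W :: tableau and S :: "(nat \<times> nat) set"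
  assumes "skew_orthogonal_semistandard n T S"
    and "interior_corner S (s, j0)"
    and "W = starred_skew T S s j0"
    and "\<exists>c \<in> set T. height c = s"
    and "\<And>j x y. tentry (dble n W) s (j + 1) = Some x \<Longrightarrow> tentry (dble n W) (s + 1) j = Some y
           \<Longrightarrow> x < y"
  shows "(\<nexists>j. tentry W s j = Some Zero \<and> tentry W (s + 1) j = Some Zero)
    \<and> (\<exists>Rs Ls T'. ojdt n W s j0 Rs Ls T')
    \<and> (\<forall>Rs Ls T'. ojdt n W s j0 Rs Ls T' \<longrightarrow>
         (\<forall>(U, i, j) \<in> set Rs \<union> set Ls. i = s)
       \<and> (\<forall>j \<ge> j0. (s, j + 1) \<in> tboxes T \<longrightarrow>
            (\<exists>X Y X' Y'. elementary_move n Rs Ls s j X Y X' Y'))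
       \<and> (\<forall>i j X Y X' Y'. elementary_move n Rs Ls i j X Y X' Y' \<longrightarrow>
            (case tentry W s (j + 1) of
               Some (Unbarred a) \<Rightarrow> move1 n s a X Y X' Y'
             | Some (Barred b) \<Rightarrow>
                 (\<exists>c. tentry (dble n W) s (2 * (j + 1) - 1) = Some (Barred c) \<and> move2 n s c X Y X' Y')
             | Some Zero \<Rightarrow> move3 n s X Y X' Y'
             | None \<Rightarrow> False)))"
proof -
  note W = skew_setup[OF assms(1-3)]
  note lenW = W(5)
  have tW: "tentry (dble n W) i (2 * j - 1) = entry (dleft n (tcol W j)) i"
    "tentry (dble n W) i (2 * j) = entry (dright n (tcol W j)) i" if "1 \<le> j" "j \<le> length T" for i j
    using tentry_dble[of j W n i] that lenW by simp_all
  have tT: "tentry (dble n T) i (2 * j - 1) = entry (dleft n (tcol T j)) i"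
    "tentry (dble n T) i (2 * j) = entry (dright n (tcol T j)) i" if "1 \<le> j" "j \<le> length T" for i j
    using tentry_dble[of j T n i] that by simp_all
  have sW: "semistd n (tcol W j)" if "1 \<le> j" "j \<le> length T" for j using W(8)[OF that] by blast
  have r1: "x \<le> y" if "1 \<le> j" "j \<le> length T" "entry (dleft n (tcol W j)) s = Some x"
      "entry (dright n (tcol W j)) s = Some y" for j x y
  proof -
    have "2 * j - 1 \<le> 2 * j" by simp
    then show ?thesis using W(14) that(3,4) tW[OF that(1,2)] unfolding rows_weakly_increasing_def by metis
  qed
  have r2: "x < y" if "1 \<le> j" "j \<le> length T" "entry (dright n (tcol W j)) s = Some x"
      "entry (dleft n (tcol W j)) (Suc s) = Some y" for j x y
  proof -
    have "2 * j - 1 + 1 = 2 * j" using that by simp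
    then show ?thesis using assms(5)[of "2 * j - 1" x y] that(3,4) tW[OF that(1,2)] by simp
  qed
  have odd_next: "2 * Suc j - 1 = 2 * j + 1" for j by simp
  have r3: "x < y" if "1 \<le> j" "Suc j \<le> length T" "entry (dleft n (tcol W (Suc j))) s = Some x"
      "entry (dright n (tcol W j)) (Suc s) = Some y" for j x y
    using assms(5)[of "2 * j" x y] that(3,4) tW(1)[of "Suc j" s, unfolded odd_next] tW(2)[of j "Suc s"] that(1,2)
    by simp
  have r4: "x \<le> y" if "1 \<le> j" "Suc j \<le> length T" "entry (dright n (tcol W j)) s = Some x"
      "entry (dleft n (tcol W (Suc j))) s = Some y" for j x y
  proof -
    have "2 * j \<le> 2 * j + 1" by simp
    moreover have "tentry (dble n W) s (2 * j + 1) = Some y"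
      using tW(1)[of "Suc j" s, unfolded odd_next] that by simp
    moreover have "tentry (dble n W) s (2 * j) = Some x" using tW(2)[of j s] that by simp
    ultimately show ?thesis using W(14) unfolding rows_weakly_increasing_def by blast
  qed
  have z: "\<not> (entry (tcol W j) s = Some Zero \<and> entry (tcol W j) (Suc s) = Some Zero)"
    if j: "1 \<le> j" "j \<le> length T" for j
  proof (cases "j = j0")
    case True
    have "tcol W j0 = Col (s - 1) (Some s) (setA (tcol W j0)) (zeros (tcol W j0)) (setD (tcol W j0))"
      using W(9,10) by (cases "tcol W j0") auto
    moreover have "entry (Col (s - 1) (Some s) (setA (tcol W j0)) (zeros (tcol W j0)) (setD (tcol W j0))) s = None"
      by (rule entry_at_star) (use W(1) in auto)
    ultimately have "entry (tcol W j0) s = None" by simp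
    then show ?thesis using True by simp
  next
    case False
    then show ?thesis using no_adjacent_zeros[OF sW[OF j] W(12)[OF j False]] r2[OF j] by blast
  qed
  have part1: "\<nexists>j. tentry W s j = Some Zero \<and> tentry W (s + 1) j = Some Zero"
  proof
    assume "\<exists>j. tentry W s j = Some Zero \<and> tentry W (s + 1) j = Some Zero"
    then obtain j where j: "tentry W s j = Some Zero" "tentry W (s + 1) j = Some Zero" by blast
    then have "1 \<le> j" "j \<le> length T" unfolding tentry_def lenW by (auto split: if_splits)
    then show False using z[of j] j unfolding tentry_def lenW by simp
  qed
  \<comment> \<open>The last column that reaches row \<open>s\<close>. Heights decrease weakly, so
    all columns before it reach row \<open>s\<close> as well.\<close>
  define m where "m = Max {j. 1 \<le> j \<and> j \<le> length T \<and> s \<le> height (tcol T j)}"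
  have fm: "finite {j. 1 \<le> j \<and> j \<le> length T \<and> s \<le> height (tcol T j)}" by simp
  have "m \<in> {j. 1 \<le> j \<and> j \<le> length T \<and> s \<le> height (tcol T j)}"
    unfolding m_def using W(2-4) by (intro Max_in[OF fm]) auto
  then have m: "1 \<le> m" "m \<le> length T" "s \<le> height (tcol T m)" by auto
  have mmax: "j \<le> m" if "1 \<le> j" "j \<le> length T" "s \<le> height (tcol T j)" for j
    unfolding m_def using that by (intro Max_ge[OF fm]) auto
  have jm: "j0 \<le> m" using mmax W(2-4) by blast
  have tall: "s \<le> height (tcol T j)" if "1 \<le> j" "j \<le> m" for j
    using W(7)[of j m] that m by linarith
  \<comment> \<open>A column of height \<open>s\<close> cannot lie beyond \<open>m\<close>, so
    column \<open>m\<close> is no higher than \<open>s\<close>: nothing will stand below the star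
    there.\<close>
  have hm: "height (tcol T m) = s"
  proof -
    obtain i where i: "i < length T" "height (T ! i) = s" using assms(4) by (metis in_set_conv_nth)
    then have "Suc i \<le> m" using mmax[of "Suc i"] by simp
    then have "height (tcol T m) \<le> s" using W(7)[of "Suc i" m] m(2) i(2) by simp
    then show ?thesis using m(3) by simp
  qed
  have col_le: "empties c + card (setA c) + zeros c + card (setD c) + (case star c of None \<Rightarrow> 0 | Some _ \<Rightarrow> 1) = height c" for c
    using height_col[of c] by simp
  have Tn: "height (tcol T j) \<le> n" if "1 \<le> j" "j \<le> length T" for j
    using W(6)[OF that] height_col[of "tcol T j"] height_le[of n "tcol T j"] by simp
  \<comment> \<open>Column \<open>j\<close> at the moment when it holds the star: its empty boxes
    and height are those of the original, and unless it is the starting column its right half has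
    lost the letter of row \<open>s\<close>.\<close>
  define inv where "inv = (\<lambda>j X. semistd n X \<and> star X = Some s \<and> empties X = empties (tcol W j) \<and>
     height X = height (tcol T j) \<and> (j = j0 \<and> X = tcol W j \<or> j0 < j \<and> removed n s (tcol W j) X))"
  define stepc where "stepc = (\<lambda>j X Y' X' M L N R. pair_step n s X (tcol W (Suc j)) X' Y' M L N R \<and>
     row_move n s X (tcol W (Suc j)) X' Y')"
  have next_ex: "\<exists>Y'. inv (Suc j) Y' \<and> (\<exists>X' M L N R. stepc j X Y' X' M L N R)"
    if X: "inv j X" and j: "j0 \<le> j" "j < m" for j X
  proof -
    let ?C = "tcol W j" and ?Y = "tcol W (Suc j)"
    have j1: "1 \<le> j" "j \<le> length T" "1 \<le> Suc j" "Suc j \<le> length T" "Suc j \<le> m" "j0 < Suc j"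
      using j W(2) m by auto
    note iX = X[unfolded inv_def]
    \<comment> \<open>Heights are at most \<open>n\<close>, and the star uses up one box.\<close>
    have hX: "card (setA X) + card (setD X) + zeros X < n"
      using iX col_le[of X] Tn[OF j1(1,2)] by auto
    have Yf: "star ?Y = None" "empties ?Y < s" "s \<le> height ?Y" "entry ?Y s = entry (tcol T (Suc j)) s"
      using W(12)[of "Suc j"] W(13)[of "Suc j"] W(8)[of "Suc j"] tall[of "Suc j"] j1 j by auto
    have kind: "X = ?C \<and> empties ?C = s - 1 \<and> 1 \<le> s \<and>
        (\<forall>a. entry ?Y s = Some (Unbarred a) \<longrightarrow> (\<exists>b \<in> {1..n}. b \<le> a \<and> b \<notin> setD ?C)) \<or>
      star ?C = None \<and> empties ?C < s \<and> s \<le> height ?C \<and> removed n s ?C X"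
    proof (cases "j = j0")
      case True
      have "\<exists>b \<in> {1..n}. b \<le> a \<and> b \<notin> setD ?C" if a: "entry ?Y s = Some (Unbarred a)" for a
      proof -
        have "x \<le> y" if "entry (dright n (tcol T j)) s = Some x" "entry (dleft n (tcol T (Suc j))) s = Some y" for x y
        proof -
          have "2 * j \<le> 2 * j + 1" by simp
          moreover have "tentry (dble n T) s (2 * j + 1) = Some y"
            using tT(1)[of "Suc j" s, unfolded odd_next] that j1 by simp
          moreover have "tentry (dble n T) s (2 * j) = Some x" using tT(2)[of j s] that j1 by simp
          ultimately show ?thesis using W(15) unfolding rows_weakly_increasing_def by blast
        qed
        then have "\<exists>b \<in> {1..n}. b \<le> a \<and> b \<notin> setD (tcol T j)"
          using first_column_witness[of n "tcol T j" s "tcol T (Suc j)" a] W(6)[OF j1(1,2)] W(6)[OF j1(3,4)]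
            W(1) tall[of j] j1 j a Yf(4) by simp
        then show ?thesis using W(11) True by blast
      qed
      then show ?thesis using iX True W(1,10) by auto
    next
      case False
      then show ?thesis using iX W(12)[OF j1(1,2) False] W(13)[of j] W(8)[OF j1(1,2)] tall[of j] j j1 by auto
    qed
    have "\<exists>X' Y' M L N R. pair_step n s X ?Y X' Y' M L N R \<and> removed n s ?Y Y' \<and> row_move n s X ?Y X' Y'"
      by (rule pair_exists[OF sW[OF j1(1,2)] sW[OF j1(3,4)] Yf(1-3) r1[OF j1(3,4)] r2[OF j1(3,4)]
        r3[OF j1(1,4)] r4[OF j1(1,4)] z[OF j1(3,4)] _ _ _ hX kind]) (use iX in auto)
    then obtain X' Y' M L N R where p: "pair_step n s X ?Y X' Y' M L N R" "removed n s ?Y Y'"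
      and c: "row_move n s X ?Y X' Y'" by blast
    note pp = row_move_properties[OF c]
    have "height Y' = height ?Y"
      using removed_card[OF p(2) sW[OF j1(3,4)] pp(2) Yf(1)] col_le[of Y'] col_le[of ?Y] pp(3,4) Yf(1) by simp
    then have "inv (Suc j) Y'" unfolding inv_def using pp p(2) W(8)[OF j1(3,4)] j1(6) by simp
    then show ?thesis unfolding stepc_def using p(1) c by blast
  qed
  \<comment> \<open>Each move depends on the column produced by the previous one, so the starred
    columns are chosen successively, counted from \<open>j0\<close>.\<close>
  have "\<exists>f. \<forall>i. (j0 + i \<le> m \<longrightarrow> inv (j0 + i) (f i)) \<and>
    (j0 + i < m \<longrightarrow> (\<exists>X' M L N R. stepc (j0 + i) (f i) (f (Suc i)) X' M L N R))"
  proof (rule dependent_nat_choice)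
    have "inv j0 (tcol W j0)" unfolding inv_def using sW W(8)[OF W(2,3)] W(2,3,9) by simp
    then show "\<exists>x. j0 + 0 \<le> m \<longrightarrow> inv (j0 + 0) x" by auto
  next
    fix X i assume X: "j0 + i \<le> m \<longrightarrow> inv (j0 + i) X"
    show "\<exists>Y. (j0 + Suc i \<le> m \<longrightarrow> inv (j0 + Suc i) Y) \<and>
      (j0 + i < m \<longrightarrow> (\<exists>X' M L N R. stepc (j0 + i) X Y X' M L N R))"
    proof (cases "j0 + i < m")
      case True
      then show ?thesis using next_ex[of "j0 + i" X] X by auto
    qed auto
  qed
  then obtain f where f: "\<And>i. j0 + i \<le> m \<Longrightarrow> inv (j0 + i) (f i)"
    "\<And>i. j0 + i < m \<Longrightarrow> \<exists>X' M L N R. stepc (j0 + i) (f i) (f (Suc i)) X' M L N R" by blast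
  define Xc where "Xc = (\<lambda>j. f (j - j0))"
  have iXc: "inv j (Xc j)" if "j0 \<le> j" "j \<le> m" for j
    using f(1)[of "j - j0"] that unfolding Xc_def by simp
  have "\<exists>X' M L N R. stepc j (Xc j) (Xc (Suc j)) X' M L N R" if "j0 \<le> j" "j < m" for j
    using f(2)[of "j - j0"] that unfolding Xc_def by (simp add: Suc_diff_le)
  then obtain X' M L N R where st: "\<And>j. j0 \<le> j \<Longrightarrow> j < m \<Longrightarrow>
    stepc j (Xc j) (Xc (Suc j)) (X' j) (M j) (L j) (N j) (R j)" by metis
  have run: "\<exists>Rs Ls T'. ojdt n W s j0 Rs Ls T' \<and> (\<forall>(U, i, j) \<in> set Rs \<union> set Ls. i = s) \<and>
    (\<forall>j. j0 \<le> j \<longrightarrow> j < m \<longrightarrow>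
       elementary_move n Rs Ls s j (Xc j) (tcol W (Suc j)) (X' j) (Xc (Suc j))) \<and>
    (\<forall>i j X Y X1 Y1. elementary_move n Rs Ls i j X Y X1 Y1 \<longrightarrow> j0 \<le> j \<and> j < m \<and> X = Xc j \<and>
       Y = tcol W (Suc j) \<and> X1 = X' j \<and> Y1 = Xc (Suc j))"
  proof (rule ojdt_horizontal)
    show "1 \<le> j0" "j0 \<le> m" "m \<le> length W" using W(2) jm m lenW by auto
    show "\<And>j. 1 \<le> j \<Longrightarrow> j \<le> length W \<Longrightarrow> semistd n (tcol W j)" using sW lenW by simp
    show "Xc j0 = tcol W j0" using iXc[of j0] jm unfolding inv_def by simp
    show "pair_step n s (Xc j) (tcol W (Suc j)) (X' j) (Xc (Suc j)) (M j) (L j) (N j) (R j)"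
      if "j0 \<le> j" "j < m" for j using st[OF that] unfolding stepc_def by blast
    show "semistd n (Xc j)" if "j0 \<le> j" "j \<le> m" for j using iXc[OF that] unfolding inv_def by blast
    show "semistd n (X' j)" if "j0 \<le> j" "j < m" for j
      using st[OF that] row_move_properties(1) unfolding stepc_def by blast
    show "star (Xc m) = Some s" "height (Xc m) = s" using iXc[of m] jm hm unfolding inv_def by auto
    show "1 \<le> s" by (rule W(1))
    show "height (tcol W (Suc m)) < s" if "m < length W"
    proof -
      have "\<not> s \<le> height (tcol T (Suc m))" using mmax[of "Suc m"] that lenW by auto
      then show ?thesis using W(8)[of "Suc m"] that lenW by simp
    qed
  qed
  then obtain Rs Ls T' where oj: "ojdt n W s j0 Rs Ls T'" and rows: "\<forall>(U, i, j) \<in> set Rs \<union> set Ls. i = s"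
    and em: "\<And>j. j0 \<le> j \<Longrightarrow> j < m \<Longrightarrow>
       elementary_move n Rs Ls s j (Xc j) (tcol W (Suc j)) (X' j) (Xc (Suc j))"
    and un: "\<And>i j X Y X1 Y1. elementary_move n Rs Ls i j X Y X1 Y1 \<Longrightarrow> j0 \<le> j \<and> j < m \<and> X = Xc j \<and>
       Y = tcol W (Suc j) \<and> X1 = X' j \<and> Y1 = Xc (Suc j)"
    by blast
  \<comment> \<open>By determinism any other run has the same states, so the claims about all runs
    reduce to the run just constructed.\<close>
  have uniq: "Rs2 = Rs \<and> Ls2 = Ls" if o2: "ojdt n W s j0 Rs2 Ls2 T2" for Rs2 Ls2 T2
  proof -
    obtain V where V: "sjdt n (dble n W, s, 2 * j0) Rs V" "sjdt n (V, s, 2 * j0 - 1) Ls (dble n T')"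
      using oj unfolding ojdt_def by blast
    obtain V2 where V2: "sjdt n (dble n W, s, 2 * j0) Rs2 V2"
      "sjdt n (V2, s, 2 * j0 - 1) Ls2 (dble n T2)"
      using o2 unfolding ojdt_def by blast
    have e: "Rs2 = Rs \<and> V2 = V" by (rule sjdt_deterministic[OF V2(1) V(1)])
    then have "Ls2 = Ls \<and> dble n T2 = dble n T'" using sjdt_deterministic[OF V2(2)] V(2) by simp
    then show ?thesis using e by simp
  qed
  have part2: "\<exists>X Y X' Y'. elementary_move n Rs Ls s j X Y X' Y'" if "j0 \<le> j" "(s, j + 1) \<in> tboxes T" for j
  proof -
    have "Suc j \<le> m" using that(2) mmax[of "Suc j"] unfolding tboxes_def by simp
    then show ?thesis using em[of j] that(1) by auto
  qed
  have part3: "case tentry W s (j + 1) of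
               Some (Unbarred a) \<Rightarrow> move1 n s a X Y X1 Y1
             | Some (Barred b) \<Rightarrow>
                 (\<exists>c. tentry (dble n W) s (2 * (j + 1) - 1) = Some (Barred c) \<and> move2 n s c X Y X1 Y1)
             | Some Zero \<Rightarrow> move3 n s X Y X1 Y1
             | None \<Rightarrow> False" if e: "elementary_move n Rs Ls i j X Y X1 Y1" for i j X Y X1 Y1
  proof -
    note u = un[OF e]
    have j: "1 \<le> j + 1" "j + 1 \<le> length T" using u m by auto
    have e1: "tentry W s (j + 1) = entry (tcol W (Suc j)) s" unfolding tentry_def using j lenW by simp
    have e2: "tentry (dble n W) s (2 * (j + 1) - 1) = entry (dleft n (tcol W (Suc j))) s"
      using tW(1)[OF j, of s] by simp
    have q: "X = Xc j" "Y = tcol W (Suc j)" "X1 = X' j" "Y1 = Xc (Suc j)" using u by blast+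
    show ?thesis unfolding e1 e2 q using st[of j] u unfolding stepc_def row_move_def by blast
  qed
  show ?thesis
  proof (intro conjI)
    show "\<exists>Rs Ls T'. ojdt n W s j0 Rs Ls T'" using oj by blast
    show "\<forall>Rs Ls T'. ojdt n W s j0 Rs Ls T' \<longrightarrow>
         (\<forall>(U, i, j) \<in> set Rs \<union> set Ls. i = s)
       \<and> (\<forall>j \<ge> j0. (s, j + 1) \<in> tboxes T \<longrightarrow>
            (\<exists>X Y X' Y'. elementary_move n Rs Ls s j X Y X' Y'))
       \<and> (\<forall>i j X Y X' Y'. elementary_move n Rs Ls i j X Y X' Y' \<longrightarrow>
            (case tentry W s (j + 1) of
               Some (Unbarred a) \<Rightarrow> move1 n s a X Y X' Y'
             | Some (Barred b) \<Rightarrow>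
                 (\<exists>c. tentry (dble n W) s (2 * (j + 1) - 1) = Some (Barred c) \<and> move2 n s c X Y X' Y')
             | Some Zero \<Rightarrow> move3 n s X Y X' Y'
             | None \<Rightarrow> False))"
    proof (intro allI impI)
      fix Rs2 Ls2 T2 assume "ojdt n W s j0 Rs2 Ls2 T2"
      then have e: "Rs2 = Rs" "Ls2 = Ls" using uniq by blast+
      show "(\<forall>(U, i, j) \<in> set Rs2 \<union> set Ls2. i = s)
       \<and> (\<forall>j \<ge> j0. (s, j + 1) \<in> tboxes T \<longrightarrow>
            (\<exists>X Y X' Y'. elementary_move n Rs2 Ls2 s j X Y X' Y'))
       \<and> (\<forall>i j X Y X' Y'. elementary_move n Rs2 Ls2 i j X Y X' Y' \<longrightarrow>
            (case tentry W s (j + 1) of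
               Some (Unbarred a) \<Rightarrow> move1 n s a X Y X' Y'
             | Some (Barred b) \<Rightarrow>
                 (\<exists>c. tentry (dble n W) s (2 * (j + 1) - 1) = Some (Barred c) \<and> move2 n s c X Y X' Y')
             | Some Zero \<Rightarrow> move3 n s X Y X' Y'
             | None \<Rightarrow> False))"
        unfolding e by (intro conjI rows allI impI part2 part3) assumption+
    qed
  qed (rule part1)
qed

end
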